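(* Let $T$ be a complete first-order theory (countable or uncountable) with monster model $\mathcal U$, and let $M$ be a model of $T$. The following are equivalent: (i) $M$ is eventually stable. (ii) Every type $p\in S_x(M)$ has an extension to a global type $p'\in S_x(\mathcal U)$ which is generically stable over $M$.
   Context: $M$ has no order if for no formula $\phi(x,y)$ (without parameters) are there sequences $(a_i)_{i<\omega},(b_i)_{i<\omega}$ in $M$ with $M\models\phi(a_i,b_j)$ iff $i\le j$. A formula $\phi(x,y)$ (possibly with parameters) is eventually NIP in $M$ if for every infinite sequence $(c_i)$ in $M$ there are a subsequence $(a_i)$, $n\in\mathbb N$ and $E\subseteq\{1,\dots,n\}$ with $\mathcal U\models\neg\exists y\big(\bigwedge_{j\in E}\phi(a_{i_j},y)\wedge\bigwedge_{j\notin E}\neg\phi(a_{i_j},y)\big)$ for all $i_1<\dots<i_n<\omega$; $M$ is eventually NIP if every formula is eventually NIP in $M$. $M$ is eventually stable if it has no order and is eventually NIP. A global type $p'$ is generically stable over $M$ if it is $M$-invariant and for every Morley sequence $(a_i)$ of $p'$ over $M$ (i.e. $a_i\models p'|_{Ma_{<i}}$), $\lim tp(a_i/\mathcal U)=p'$, meaning $\phi\in p'$ iff $\phi(a_i)$ holds for all large $i$, for each $L(\mathcal U)$-formula $\phi$. *)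

theory Defs
  imports Main
begin

unbundle cardinal_syntax

section \<open>Languages, formulas and structures\<close>

text \<open>Constants are function symbols of arity 0. The symbols are sets, not whole types, so that
  a language may have no function symbols or no relation symbols.\<close>

record ('f, 'r) language =
  Funs :: "'f set"
  Rels :: "'r set"
  far :: "'f \<Rightarrow> nat"
  rar :: "'r \<Rightarrow> nat"

text \<open>Terms and formulas carry parameters, which denote themselves: \<open>Par c\<close> is the constant naming the
  element \<open>c\<close>. Formulas of \<open>L\<close> proper are those without parameters.\<close>

datatype (dead 'f, tpars: 'u) trm =
    Var nat
  | Par 'u
  | Fn 'f "('f, 'u) trm list"
  for map: trm_map

datatype (dead 'f, dead 'r, fpars: 'u) fm =
    Eq "('f, 'u) trm" "('f, 'u) trm"
  | Rel 'r "('f, 'u) trm list"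
  | Neg "('f, 'r, 'u) fm"
  | And "('f, 'r, 'u) fm" "('f, 'r, 'u) fm"
  | Ex nat "('f, 'r, 'u) fm"
  for map: fm_map

primrec tvars :: "('f, 'u) trm \<Rightarrow> nat set" where
  "tvars (Var i) = {i}"
| "tvars (Par c) = {}"
| "tvars (Fn f ts) = \<Union> (set (map tvars ts))"

primrec fv :: "('f, 'r, 'u) fm \<Rightarrow> nat set" where
  "fv (Eq s t) = tvars s \<union> tvars t"
| "fv (Rel R ts) = \<Union> (set (map tvars ts))"
| "fv (Neg \<phi>) = fv \<phi>"
| "fv (And \<phi> \<psi>) = fv \<phi> \<union> fv \<psi>"
| "fv (Ex i \<phi>) = fv \<phi> - {i}"

primrec wf_trm :: "('f, 'r) language \<Rightarrow> ('f, 'u) trm \<Rightarrow> bool" where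
  "wf_trm L (Var i) \<longleftrightarrow> True"
| "wf_trm L (Par c) \<longleftrightarrow> True"
| "wf_trm L (Fn f ts) \<longleftrightarrow> f \<in> Funs L \<and> length ts = far L f \<and> list_all (wf_trm L) ts"

primrec wf_fm :: "('f, 'r) language \<Rightarrow> ('f, 'r, 'u) fm \<Rightarrow> bool" where
  "wf_fm L (Eq s t) \<longleftrightarrow> wf_trm L s \<and> wf_trm L t"
| "wf_fm L (Rel R ts) \<longleftrightarrow> R \<in> Rels L \<and> length ts = rar L R \<and> list_all (wf_trm L) ts"
| "wf_fm L (Neg \<phi>) \<longleftrightarrow> wf_fm L \<phi>"
| "wf_fm L (And \<phi> \<psi>) \<longleftrightarrow> wf_fm L \<phi> \<and> wf_fm L \<psi>"
| "wf_fm L (Ex i \<phi>) \<longleftrightarrow> wf_fm L \<phi>"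

text \<open>The \<open>L(A)\<close>-formulas in the variables \<open>x\<^sub>0, \<dots>, x\<^sub>n\<^sub>-\<^sub>1\<close>.\<close>

definition Form :: "('f, 'r) language \<Rightarrow> 'u set \<Rightarrow> nat \<Rightarrow> ('f, 'r, 'u) fm set" where
  "Form L A n = {\<phi>. wf_fm L \<phi> \<and> fpars \<phi> \<subseteq> A \<and> fv \<phi> \<subseteq> {..<n}}"

definition tuples :: "'u set \<Rightarrow> nat \<Rightarrow> 'u list set" where
  "tuples A n = {a. length a = n \<and> set a \<subseteq> A}"

record ('f, 'r, 'u) struct =
  carr :: "'u set"
  fint :: "'f \<Rightarrow> 'u list \<Rightarrow> 'u"
  rint :: "'r \<Rightarrow> 'u list \<Rightarrow> bool"

definition is_struct :: "('f, 'r) language \<Rightarrow> ('f, 'r, 'u) struct \<Rightarrow> bool" where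
  "is_struct L S \<longleftrightarrow> carr S \<noteq> {} \<and>
     (\<forall>f\<in>Funs L. \<forall>a\<in>tuples (carr S) (far L f). fint S f a \<in> carr S)"

primrec eval :: "('f, 'r, 'u) struct \<Rightarrow> (nat \<Rightarrow> 'u) \<Rightarrow> ('f, 'u) trm \<Rightarrow> 'u" where
  "eval S e (Var i) = e i"
| "eval S e (Par c) = c"
| "eval S e (Fn f ts) = fint S f (map (eval S e) ts)"

primrec sat :: "('f, 'r, 'u) struct \<Rightarrow> (nat \<Rightarrow> 'u) \<Rightarrow> ('f, 'r, 'u) fm \<Rightarrow> bool" where
  "sat S e (Eq s t) \<longleftrightarrow> eval S e s = eval S e t"
| "sat S e (Rel R ts) \<longleftrightarrow> rint S R (map (eval S e) ts)"
| "sat S e (Neg \<phi>) \<longleftrightarrow> \<not> sat S e \<phi>"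
| "sat S e (And \<phi> \<psi>) \<longleftrightarrow> sat S e \<phi> \<and> sat S e \<psi>"
| "sat S e (Ex i \<phi>) \<longleftrightarrow> (\<exists>d\<in>carr S. sat S (e(i := d)) \<phi>)"

text \<open>\<open>S \<Turnstile> \<phi>(a)\<close>, meant for \<open>\<phi>\<close> in \<open>length a\<close> variables. For a partitioned formula \<open>\<phi>(x, y)\<close> with
  \<open>|x| = n\<close> and \<open>|y| = m\<close>, the variables of \<open>x\<close> are those below \<open>n\<close>, the variables of \<open>y\<close> the following
  \<open>m\<close> ones, and \<open>\<phi>(a, b)\<close> is evaluated at \<open>a @ b\<close>.\<close>

definition holds :: "('f, 'r, 'u) struct \<Rightarrow> ('f, 'r, 'u) fm \<Rightarrow> 'u list \<Rightarrow> bool" where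
  "holds S \<phi> a \<longleftrightarrow> sat S (\<lambda>i. a ! i) \<phi>"

section \<open>Theories, elementary substructures, types\<close>

text \<open>Theories are taken to be closed under consequence, so that a complete (consistent) theory
  contains every sentence or its negation. Consistency is provided by the models at hand.\<close>

definition complete_theory :: "('f, 'r) language \<Rightarrow> ('f, 'r, 'u) fm set \<Rightarrow> bool" where
  "complete_theory L T \<longleftrightarrow> T \<subseteq> Form L {} 0 \<and> (\<forall>\<sigma>\<in>Form L {} 0. \<sigma> \<in> T \<or> Neg \<sigma> \<in> T)"

definition is_model :: "('f, 'r) language \<Rightarrow> ('f, 'r, 'u) struct \<Rightarrow> ('f, 'r, 'u) fm set \<Rightarrow> bool" where
  "is_model L S T \<longleftrightarrow> is_struct L S \<and> (\<forall>\<sigma>\<in>T. holds S \<sigma> [])"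

text \<open>For structures \<open>M\<close> and \<open>U\<close>; agreement of the interpretations on \<open>M\<close> is the case of atomic
  formulas.\<close>

definition elementary_sub ::
  "('f, 'r) language \<Rightarrow> ('f, 'r, 'u) struct \<Rightarrow> ('f, 'r, 'u) struct \<Rightarrow> bool" where
  "elementary_sub L M U \<longleftrightarrow> carr M \<subseteq> carr U \<and>
     (\<forall>n. \<forall>\<phi>\<in>Form L {} n. \<forall>a\<in>tuples (carr M) n. holds M \<phi> a \<longleftrightarrow> holds U \<phi> a)"

text \<open>\<open>S\<^sub>n(A)\<close>, the complete \<open>n\<close>-types over \<open>A \<subseteq> U\<close>; consistency with the theory of \<open>U\<close> with names for
  \<open>A\<close> is finite satisfiability in \<open>U\<close>.\<close>

definition ctypes ::
  "('f, 'r) language \<Rightarrow> ('f, 'r, 'u) struct \<Rightarrow> 'u set \<Rightarrow> nat \<Rightarrow> ('f, 'r, 'u) fm set set" where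
  "ctypes L U A n = {p. p \<subseteq> Form L A n \<and>
     (\<forall>F. finite F \<and> F \<subseteq> p \<longrightarrow> (\<exists>a\<in>tuples (carr U) n. \<forall>\<phi>\<in>F. holds U \<phi> a)) \<and>
     (\<forall>\<phi>\<in>Form L A n. \<phi> \<in> p \<or> Neg \<phi> \<in> p)}"

definition restrict_type :: "('f, 'r, 'u) fm set \<Rightarrow> 'u set \<Rightarrow> ('f, 'r, 'u) fm set" where
  "restrict_type p A = {\<phi>\<in>p. fpars \<phi> \<subseteq> A}"

definition realizes ::
  "('f, 'r, 'u) struct \<Rightarrow> nat \<Rightarrow> 'u list \<Rightarrow> ('f, 'r, 'u) fm set \<Rightarrow> bool" where
  "realizes U n a p \<longleftrightarrow> a \<in> tuples (carr U) n \<and> (\<forall>\<phi>\<in>p. holds U \<phi> a)"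

section \<open>The monster model\<close>

definition automorphism ::
  "('f, 'r) language \<Rightarrow> ('f, 'r, 'u) struct \<Rightarrow> ('u \<Rightarrow> 'u) \<Rightarrow> bool" where
  "automorphism L U \<sigma> \<longleftrightarrow> bij_betw \<sigma> (carr U) (carr U) \<and>
     (\<forall>f\<in>Funs L. \<forall>a\<in>tuples (carr U) (far L f). \<sigma> (fint U f a) = fint U f (map \<sigma> a)) \<and>
     (\<forall>R\<in>Rels L. \<forall>a\<in>tuples (carr U) (rar L R). rint U R a \<longleftrightarrow> rint U R (map \<sigma> a))"

definition partial_elementary ::
  "('f, 'r) language \<Rightarrow> ('f, 'r, 'u) struct \<Rightarrow> 'u set \<Rightarrow> ('u \<Rightarrow> 'u) \<Rightarrow> bool" where
  "partial_elementary L U A h \<longleftrightarrow> A \<subseteq> carr U \<and> h ` A \<subseteq> carr U \<and>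
     (\<forall>n. \<forall>\<phi>\<in>Form L {} n. \<forall>a\<in>tuples A n. holds U \<phi> a \<longleftrightarrow> holds U \<phi> (map h a))"

definition saturated :: "('f, 'r) language \<Rightarrow> 'k rel \<Rightarrow> ('f, 'r, 'u) struct \<Rightarrow> bool" where
  "saturated L \<kappa> U \<longleftrightarrow> (\<forall>A n. A \<subseteq> carr U \<and> |A| <o \<kappa> \<longrightarrow>
     (\<forall>p\<in>ctypes L U A n. \<exists>a. realizes U n a p))"

definition strongly_homogeneous ::
  "('f, 'r) language \<Rightarrow> 'k rel \<Rightarrow> ('f, 'r, 'u) struct \<Rightarrow> bool" where
  "strongly_homogeneous L \<kappa> U \<longleftrightarrow> (\<forall>A h. |A| <o \<kappa> \<and> partial_elementary L U A h \<longrightarrow>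
     (\<exists>\<sigma>. automorphism L U \<sigma> \<and> (\<forall>a\<in>A. \<sigma> a = h a)))"

text \<open>A monster model of \<open>T\<close>: \<open>\<kappa>\<close>-saturated and strongly \<open>\<kappa>\<close>-homogeneous for a cardinal \<open>\<kappa>\<close> above
  \<open>|L| + \<aleph>\<^sub>0\<close>. Small means of cardinality less than \<open>\<kappa>\<close>.\<close>

definition monster ::
  "('f, 'r) language \<Rightarrow> ('f, 'r, 'u) fm set \<Rightarrow> 'k rel \<Rightarrow> ('f, 'r, 'u) struct \<Rightarrow> bool" where
  "monster L T \<kappa> U \<longleftrightarrow> is_model L U T \<and>
     Card_order \<kappa> \<and> natLeq <o \<kappa> \<and> |Funs L| <o \<kappa> \<and> |Rels L| <o \<kappa> \<and>
     saturated L \<kappa> U \<and> strongly_homogeneous L \<kappa> U"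

section \<open>Eventual stability\<close>

definition no_order :: "('f, 'r) language \<Rightarrow> ('f, 'r, 'u) struct \<Rightarrow> bool" where
  "no_order L M \<longleftrightarrow> \<not> (\<exists>n m. \<exists>\<phi>\<in>Form L {} (n + m). \<exists>a b :: nat \<Rightarrow> 'u list.
     (\<forall>i. a i \<in> tuples (carr M) n \<and> b i \<in> tuples (carr M) m) \<and>
     (\<forall>i j. holds M \<phi> (a i @ b j) \<longleftrightarrow> i \<le> j))"

text \<open>The subsequence is \<open>a i = c (r i)\<close>, and \<open>i\<^sub>1 < \<dots> < i\<^sub>N\<close> is given by \<open>s\<close>.\<close>

definition eventually_NIP_formula ::
  "('f, 'r, 'u) struct \<Rightarrow> ('f, 'r, 'u) struct \<Rightarrow> nat \<Rightarrow> nat \<Rightarrow> ('f, 'r, 'u) fm \<Rightarrow> bool" where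
  "eventually_NIP_formula U M n m \<phi> \<longleftrightarrow>
     (\<forall>c :: nat \<Rightarrow> 'u list. (\<forall>i. c i \<in> tuples (carr M) n) \<longrightarrow>
       (\<exists>r :: nat \<Rightarrow> nat. strict_mono r \<and>
         (\<exists>N. \<exists>E\<subseteq>{1..N}. \<forall>s :: nat \<Rightarrow> nat. strict_mono_on {1..N} s \<longrightarrow>
           \<not> (\<exists>y\<in>tuples (carr U) m.
                (\<forall>j\<in>E. holds U \<phi> (c (r (s j)) @ y)) \<and>
                (\<forall>j\<in>{1..N} - E. \<not> holds U \<phi> (c (r (s j)) @ y))))))"

definition eventually_NIP ::
  "('f, 'r) language \<Rightarrow> ('f, 'r, 'u) struct \<Rightarrow> ('f, 'r, 'u) struct \<Rightarrow> bool" where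
  "eventually_NIP L U M \<longleftrightarrow>
     (\<forall>n m. \<forall>\<phi>\<in>Form L (carr U) (n + m). eventually_NIP_formula U M n m \<phi>)"

definition eventually_stable ::
  "('f, 'r) language \<Rightarrow> ('f, 'r, 'u) struct \<Rightarrow> ('f, 'r, 'u) struct \<Rightarrow> bool" where
  "eventually_stable L U M \<longleftrightarrow> no_order L M \<and> eventually_NIP L U M"

section \<open>Generic stability\<close>

definition invariant_type ::
  "('f, 'r) language \<Rightarrow> ('f, 'r, 'u) struct \<Rightarrow> 'u set \<Rightarrow> nat \<Rightarrow> ('f, 'r, 'u) fm set \<Rightarrow> bool" where
  "invariant_type L U A n p \<longleftrightarrow>
     (\<forall>\<sigma>. automorphism L U \<sigma> \<and> (\<forall>a\<in>A. \<sigma> a = a) \<longrightarrow>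
       (\<forall>\<phi>\<in>Form L (carr U) n. \<phi> \<in> p \<longleftrightarrow> fm_map \<sigma> \<phi> \<in> p))"

definition Morley_sequence ::
  "('f, 'r, 'u) struct \<Rightarrow> 'u set \<Rightarrow> nat \<Rightarrow> ('f, 'r, 'u) fm set \<Rightarrow> (nat \<Rightarrow> 'u list) \<Rightarrow> bool" where
  "Morley_sequence U A n p a \<longleftrightarrow>
     (\<forall>i. realizes U n (a i) (restrict_type p (A \<union> (\<Union>j<i. set (a j)))))"

definition lim_type ::
  "('f, 'r) language \<Rightarrow> ('f, 'r, 'u) struct \<Rightarrow> nat \<Rightarrow> (nat \<Rightarrow> 'u list) \<Rightarrow> ('f, 'r, 'u) fm set \<Rightarrow> bool"
  where
  "lim_type L U n a p \<longleftrightarrow>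
     (\<forall>\<phi>\<in>Form L (carr U) n. \<phi> \<in> p \<longleftrightarrow> (\<exists>i\<^sub>0. \<forall>i\<ge>i\<^sub>0. holds U \<phi> (a i)))"

definition generically_stable ::
  "('f, 'r) language \<Rightarrow> ('f, 'r, 'u) struct \<Rightarrow> 'u set \<Rightarrow> nat \<Rightarrow> ('f, 'r, 'u) fm set \<Rightarrow> bool" where
  "generically_stable L U A n p \<longleftrightarrow> invariant_type L U A n p \<and>
     (\<forall>a. Morley_sequence U A n p a \<longrightarrow> lim_type L U n a p)"

end

theory Submission
  imports Defs "HOL-Library.Ramsey"
begin

text \<open>
  (i) \<open>\<Longrightarrow>\<close> (ii): extend \<open>p\<close> to a global coheir \<open>p'\<close>, a type finitely satisfiable in \<open>M\<close>. Since \<open>M\<close> has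
  no order, \<open>p'\<close> is definable over \<open>M\<close>, by Ramsey's theorem. A type that is both definable over and
  finitely satisfiable in \<open>M\<close> commutes with itself. So if \<open>\<phi>(x, b) \<in> p'\<close> failed infinitely often along
  a Morley sequence, these failures could be interleaved arbitrarily with generic realizations of
  \<open>\<phi>(x, b)\<close>, and all truth patterns would be consistent for Morley sequences. This property is reflected
  to a sequence in \<open>M\<close> and contradicts eventual NIP.

  (ii) \<open>\<Longrightarrow>\<close> (i): compactness applied to Morley sequences of order type \<open>\<omega> + \<omega>\<close> shows that for a generically
  stable type some pattern ``\<open>N\<close> times false, then \<open>N\<close> times true'' is inconsistent. Hence a majority
  vote along a Morley sequence defines the type, which is then definable over \<open>M\<close> by invariance, and
  finitely satisfiable in \<open>M\<close>. For eventual NIP of a sequence in \<open>M\<close>, take an ultralimit of it,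
  extend this to a generically stable type and reflect the inconsistent pattern to a subsequence. An order
  in \<open>M\<close> would give two ultralimit types whose extensions do not commute.
\<close>

section \<open>Substitution\<close>

text \<open>Eventual NIP concerns sequences in \<open>M\<close>, generic stability concerns Morley
  sequences, which may lie outside \<open>M\<close>. As the language may be uncountable, a sequence
  in \<open>M\<close> cannot be expected to imitate a Morley sequence for all formulas at once.
  Definability bridges this gap: that Morley sequences of length \<open>k\<close> satisfy
  \<open>P\<close> becomes \<open>iter k P\<close>, a condition on the type alone, and tuples of
  \<open>M\<close> can be chosen one by one so that finitely many such conditions survive each step.
  Every application concerns a single formula. Commutation uses the two properties asymmetrically:
  definability turns membership of an instance in the type into a condition on its parameters, and
  finite satisfiability then moves these parameters into \<open>M\<close>. The same argument for two
  types excludes an order: for the ultralimits of its two sequences, the truth value of the ordering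
  formula depends on which of the two types is realized first. Definability of a coheir is proved
  first for parameters in \<open>M\<close>. Since \<open>M\<close> need not realize the type of a
  parameter in \<open>U\<close>, the passage to \<open>U\<close> requires a second construction of
  an order.\<close>

primrec trm_subst ::
  "(nat \<Rightarrow> ('f, 'u) trm) \<Rightarrow> ('u \<Rightarrow> ('f, 'u) trm) \<Rightarrow> ('f, 'u) trm \<Rightarrow> ('f, 'u) trm" where
  "trm_subst \<theta> \<tau> (Var i) = \<theta> i"
| "trm_subst \<theta> \<tau> (Par c) = \<tau> c"
| "trm_subst \<theta> \<tau> (Fn f ts) = Fn f (map (trm_subst \<theta> \<tau>) ts)"

text \<open>The level \<open>k\<close> bounds the variables of the terms substituted so far, so that \<open>k\<close> is a fresh
  name for the next bound variable.\<close>

primrec fm_subst ::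
  "(nat \<Rightarrow> ('f, 'u) trm) \<Rightarrow> ('u \<Rightarrow> ('f, 'u) trm) \<Rightarrow> nat \<Rightarrow> ('f, 'r, 'u) fm \<Rightarrow> ('f, 'r, 'u) fm"
  where
  "fm_subst \<theta> \<tau> k (Eq s t) = Eq (trm_subst \<theta> \<tau> s) (trm_subst \<theta> \<tau> t)"
| "fm_subst \<theta> \<tau> k (Rel R ts) = Rel R (map (trm_subst \<theta> \<tau>) ts)"
| "fm_subst \<theta> \<tau> k (Neg \<phi>) = Neg (fm_subst \<theta> \<tau> k \<phi>)"
| "fm_subst \<theta> \<tau> k (And \<phi> \<psi>) = And (fm_subst \<theta> \<tau> k \<phi>) (fm_subst \<theta> \<tau> k \<psi>)"
| "fm_subst \<theta> \<tau> k (Ex i \<phi>) = Ex k (fm_subst (\<theta>(i := Var k)) \<tau> (Suc k) \<phi>)"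

lemma finite_tpars: "finite (tpars t)"
  by (induction t) auto

lemma finite_fpars: "finite (fpars \<phi>)"
  by (induction \<phi>) (auto simp: finite_tpars)

lemma eval_cong: "(\<And>i. i \<in> tvars t \<Longrightarrow> e i = e' i) \<Longrightarrow> eval S e t = eval S e' t"
proof (induction t)
  case (Fn f ts)
  then have "map (eval S e) ts = map (eval S e') ts" by auto
  then show ?case by (metis eval.simps(3))
qed auto

lemma sat_cong: "(\<And>i. i \<in> fv \<phi> \<Longrightarrow> e i = e' i) \<Longrightarrow> sat S e \<phi> \<longleftrightarrow> sat S e' \<phi>"
proof (induction \<phi> arbitrary: e e')
  case (Eq s t)
  have "eval S e s = eval S e' s" "eval S e t = eval S e' t"
    by (rule eval_cong, rule Eq.prems, simp)+
  then show ?case by (simp only: sat.simps)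
next
  case (Rel R ts)
  have "map (eval S e) ts = map (eval S e') ts"
    by (intro map_cong refl eval_cong Rel.prems) auto
  then show ?case by (simp only: sat.simps)
next
  case (Neg \<phi>)
  have "sat S e \<phi> \<longleftrightarrow> sat S e' \<phi>"
    by (rule Neg.IH, rule Neg.prems, simp)
  then show ?case by (simp only: sat.simps)
next
  case (And \<phi> \<psi>)
  have "sat S e \<phi> \<longleftrightarrow> sat S e' \<phi>"
    by (rule And.IH, rule And.prems, simp)
  moreover have "sat S e \<psi> \<longleftrightarrow> sat S e' \<psi>"
    by (rule And.IH, rule And.prems, simp)
  ultimately show ?case by (simp only: sat.simps)
next
  case (Ex i \<phi>)
  have "sat S (e(i := d)) \<phi> \<longleftrightarrow> sat S (e'(i := d)) \<phi>" for d
  proof (rule Ex.IH)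
    fix j assume "j \<in> fv \<phi>"
    then show "(e(i := d)) j = (e'(i := d)) j"
      using Ex.prems[of j] by (cases "j = i") simp_all
  qed
  then show ?case by (simp only: sat.simps)
qed

lemma eval_trm_subst:
  "eval S e (trm_subst \<theta> \<tau> t) = eval S (\<lambda>i. eval S e (\<theta> i)) (trm_map (\<lambda>c. eval S e (\<tau> c)) t)"
proof (induction t)
  case (Fn f ts)
  then show ?case by (simp add: o_def cong: map_cong)
qed auto

lemma tvars_trm_map [simp]: "tvars (trm_map g t) = tvars t"
  by (induction t) auto

lemma fv_fm_map [simp]: "fv (fm_map g \<phi>) = fv \<phi>"
  by (induction \<phi>) auto

lemma wf_trm_map [simp]: "wf_trm L (trm_map g t) = wf_trm L t"
  by (induction t) (auto simp: list_all_iff)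

lemma wf_fm_map [simp]: "wf_fm L (fm_map g \<phi>) = wf_fm L \<phi>"
  by (induction \<phi>) (auto simp: list_all_iff)

lemma fpars_fm_map [simp]: "fpars (fm_map g \<phi>) = g ` fpars \<phi>"
  by (rule fm.set_map)

text \<open>Parameters denote themselves, so substituting a term for one amounts to renaming it to
  the value of that term. The bounds by \<open>k\<close> ensure that assigning the fresh bound
  variable \<open>k\<close> leaves these values unchanged.\<close>

lemma sat_fm_subst:
  assumes "\<And>i. i \<in> fv \<phi> \<Longrightarrow> tvars (\<theta> i) \<subseteq> {..<k}"
    and "\<And>c. c \<in> fpars \<phi> \<Longrightarrow> tvars (\<tau> c) \<subseteq> {..<k}"
  shows "sat S e (fm_subst \<theta> \<tau> k \<phi>) \<longleftrightarrow>
    sat S (\<lambda>i. eval S e (\<theta> i)) (fm_map (\<lambda>c. eval S e (\<tau> c)) \<phi>)"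
  using assms
proof (induction \<phi> arbitrary: \<theta> k e)
  case (Ex i \<phi>)
  have "sat S (e(k := d)) (fm_subst (\<theta>(i := Var k)) \<tau> (Suc k) \<phi>) \<longleftrightarrow>
    sat S ((\<lambda>j. eval S e (\<theta> j))(i := d)) (fm_map (\<lambda>c. eval S e (\<tau> c)) \<phi>)" for d
  proof -
    have 1: "eval S (e(k := d)) (\<theta> j) = eval S e (\<theta> j)" if "j \<in> fv \<phi>" "j \<noteq> i" for j
      using Ex.prems(1)[of j] that by (intro eval_cong) auto
    have 2: "eval S (e(k := d)) (\<tau> c) = eval S e (\<tau> c)" if "c \<in> fpars \<phi>" for c
      using Ex.prems(2)[of c] that by (intro eval_cong) auto
    have "sat S (e(k := d)) (fm_subst (\<theta>(i := Var k)) \<tau> (Suc k) \<phi>) \<longleftrightarrow>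
      sat S (\<lambda>j. eval S (e(k := d)) ((\<theta>(i := Var k)) j))
        (fm_map (\<lambda>c. eval S (e(k := d)) (\<tau> c)) \<phi>)"
    proof (rule Ex.IH)
      show "tvars ((\<theta>(i := Var k)) j) \<subseteq> {..<Suc k}" if "j \<in> fv \<phi>" for j
        using Ex.prems(1)[of j] that by (cases "j = i") (simp_all add: lessThan_Suc subset_insertI2)
      show "tvars (\<tau> c) \<subseteq> {..<Suc k}" if "c \<in> fpars \<phi>" for c
        using Ex.prems(2)[of c] that by (simp add: lessThan_Suc subset_insertI2)
    qed
    also have "fm_map (\<lambda>c. eval S (e(k := d)) (\<tau> c)) \<phi> = fm_map (\<lambda>c. eval S e (\<tau> c)) \<phi>"
      by (intro fm.map_cong) (auto simp: 2)
    also have "sat S (\<lambda>j. eval S (e(k := d)) ((\<theta>(i := Var k)) j))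
        (fm_map (\<lambda>c. eval S e (\<tau> c)) \<phi>) \<longleftrightarrow>
      sat S ((\<lambda>j. eval S e (\<theta> j))(i := d)) (fm_map (\<lambda>c. eval S e (\<tau> c)) \<phi>)"
      by (intro sat_cong) (auto simp: 1)
    finally show ?thesis .
  qed
  then show ?case by simp
qed (auto simp: eval_trm_subst o_def)

definition trms :: "('f, 'r) language \<Rightarrow> 'u set \<Rightarrow> nat \<Rightarrow> ('f, 'u) trm set" where
  "trms L A k = {t. wf_trm L t \<and> tpars t \<subseteq> A \<and> tvars t \<subseteq> {..<k}}"

lemma Var_trms [simp]: "Var i \<in> trms L A k \<longleftrightarrow> i < k"
  and Par_trms [simp]: "Par c \<in> trms L A k \<longleftrightarrow> c \<in> A"
  by (auto simp: trms_def)

lemma trm_subst_trms: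
  assumes "wf_trm L t" "\<And>i. i \<in> tvars t \<Longrightarrow> \<theta> i \<in> trms L A k" "\<And>c. c \<in> tpars t \<Longrightarrow> \<tau> c \<in> trms L A k"
  shows "trm_subst \<theta> \<tau> t \<in> trms L A k"
  using assms
proof (induction t)
  case (Fn f ts)
  have "trm_subst \<theta> \<tau> t \<in> trms L A k" if "t \<in> set ts" for t
    using Fn.prems that by (intro Fn.IH) (auto simp: list_all_iff)
  then show ?case using Fn.prems(1)
    by (fastforce simp: trms_def list_all_iff)
qed auto

lemma fm_subst_Form:
  assumes "wf_fm L \<phi>" "\<And>i. i \<in> fv \<phi> \<Longrightarrow> \<theta> i \<in> trms L A k"
    "\<And>c. c \<in> fpars \<phi> \<Longrightarrow> \<tau> c \<in> trms L A k"
  shows "fm_subst \<theta> \<tau> k \<phi> \<in> Form L A k"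
  using assms
proof (induction \<phi> arbitrary: \<theta> k)
  case (Eq s t)
  then show ?case using trm_subst_trms[of L s \<theta> A k \<tau>] trm_subst_trms[of L t \<theta> A k \<tau>]
    by (auto simp: Form_def trms_def)
next
  case (Rel R ts)
  have "trm_subst \<theta> \<tau> t \<in> trms L A k" if "t \<in> set ts" for t
    using Rel.prems that by (intro trm_subst_trms) (auto simp: list_all_iff)
  then show ?case using Rel.prems(1)
    by (fastforce simp: Form_def trms_def list_all_iff)
next
  case (Neg \<phi>)
  then show ?case using Neg.IH[of \<theta> k] by (auto simp: Form_def)
next
  case (And \<phi> \<psi>)
  then show ?case using And.IH(1)[of \<theta> k] And.IH(2)[of \<theta> k] by (auto simp: Form_def)
next
  case (Ex i \<phi>)
  have mono: "trms L A k \<subseteq> trms L A (Suc k)"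
    by (fastforce simp: trms_def)
  have "fm_subst (\<theta>(i := Var k)) \<tau> (Suc k) \<phi> \<in> Form L A (Suc k)"
  proof (rule Ex.IH)
    fix j assume "j \<in> fv \<phi>"
    then show "(\<theta>(i := Var k)) j \<in> trms L A (Suc k)"
      using Ex.prems(2)[of j] mono by (cases "j = i") auto
  next
    fix c assume "c \<in> fpars \<phi>"
    then show "\<tau> c \<in> trms L A (Suc k)"
      using Ex.prems(3)[of c] mono by auto
  qed (use Ex.prems in auto)
  then show ?case by (auto simp: Form_def less_Suc_eq)
qed

section \<open>Blocks of quantifiers and extraction of parameters\<close>

lemma Neg_Form [simp]: "Neg \<phi> \<in> Form L A n \<longleftrightarrow> \<phi> \<in> Form L A n"
  and And_Form [simp]: "And \<phi> \<psi> \<in> Form L A n \<longleftrightarrow> \<phi> \<in> Form L A n \<and> \<psi> \<in> Form L A n"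
  by (auto simp: Form_def)

lemma holds_Neg [simp]: "holds S (Neg \<phi>) a \<longleftrightarrow> \<not> holds S \<phi> a"
  and holds_And [simp]: "holds S (And \<phi> \<psi>) a \<longleftrightarrow> holds S \<phi> a \<and> holds S \<psi> a"
  by (simp_all add: holds_def)

lemma Form_mono: "\<phi> \<in> Form L A n \<Longrightarrow> A \<subseteq> B \<Longrightarrow> \<phi> \<in> Form L B n"
  by (auto simp: Form_def)

primrec Exs :: "nat \<Rightarrow> nat \<Rightarrow> ('f, 'r, 'u) fm \<Rightarrow> ('f, 'r, 'u) fm" where
  "Exs n 0 \<phi> = \<phi>"
| "Exs n (Suc m) \<phi> = Ex n (Exs (Suc n) m \<phi>)"

lemma Exs_Form: "\<phi> \<in> Form L A (n + m) \<Longrightarrow> Exs n m \<phi> \<in> Form L A n"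
proof (induction m arbitrary: n)
  case (Suc m)
  then have "Exs (Suc n) m \<phi> \<in> Form L A (Suc n)" by simp
  then show ?case by (auto simp: Form_def less_Suc_eq)
qed simp

lemma tuples_0 [simp]: "tuples A 0 = {[]}"
  by (auto simp: tuples_def)

lemma append_tuples [intro]: "a \<in> tuples A n \<Longrightarrow> b \<in> tuples A m \<Longrightarrow> a @ b \<in> tuples A (n + m)"
  by (auto simp: tuples_def)

lemma tuples_mono: "a \<in> tuples A n \<Longrightarrow> A \<subseteq> B \<Longrightarrow> a \<in> tuples B n"
  by (auto simp: tuples_def)

lemma holds_Exs:
  assumes "\<phi> \<in> Form L A (n + m)" "length a = n"
  shows "holds S (Exs n m \<phi>) a \<longleftrightarrow> (\<exists>b\<in>tuples (carr S) m. holds S \<phi> (a @ b))"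
  using assms
proof (induction m arbitrary: n a)
  case (Suc m)
  have F: "Exs (Suc n) m \<phi> \<in> Form L A (Suc n)"
    using Suc.prems Exs_Form[of \<phi> L A "Suc n" m] by simp
  have "holds S (Exs n (Suc m) \<phi>) a \<longleftrightarrow> (\<exists>d\<in>carr S. sat S ((\<lambda>i. a ! i)(n := d)) (Exs (Suc n) m \<phi>))"
    by (simp add: holds_def)
  also have "\<dots> \<longleftrightarrow> (\<exists>d\<in>carr S. holds S (Exs (Suc n) m \<phi>) (a @ [d]))"
  proof (intro bex_cong refl)
    fix d
    show "sat S ((\<lambda>i. a ! i)(n := d)) (Exs (Suc n) m \<phi>) \<longleftrightarrow> holds S (Exs (Suc n) m \<phi>) (a @ [d])"
      unfolding holds_def using F Suc.prems(2)
      by (intro sat_cong) (auto simp: Form_def nth_append less_Suc_eq)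
  qed
  also have "\<dots> \<longleftrightarrow> (\<exists>d\<in>carr S. \<exists>b\<in>tuples (carr S) m. holds S \<phi> (a @ d # b))"
    using Suc.IH[of "Suc n" "a @ [d]" for d] Suc.prems by simp
  also have "\<dots> \<longleftrightarrow> (\<exists>b\<in>tuples (carr S) (Suc m). holds S \<phi> (a @ b))"
    (is "?l \<longleftrightarrow> ?r")
  proof
    assume ?l
    then obtain d b where "d \<in> carr S" "b \<in> tuples (carr S) m" "holds S \<phi> (a @ d # b)" by blast
    then show ?r by (intro bexI[of _ "d # b"]) (auto simp: tuples_def)
  next
    assume ?r
    then obtain b where b: "b \<in> tuples (carr S) (Suc m)" "holds S \<phi> (a @ b)" by blast
    then obtain d b' where "b = d # b'" by (cases b) (auto simp: tuples_def)
    then show ?l using b by (auto simp: tuples_def)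
  qed
  finally show ?case .
qed simp

text \<open>The map \<sigma> is left arbitrary because one parameter-free formula has to serve both
  a formula and its image under an automorphism; the latter then only moves the leading block of
  arguments.\<close>

lemma Form_params:
  fixes \<phi> :: "('f, 'r, 'u) fm"
  assumes "\<phi> \<in> Form L A n"
  obtains m b and \<phi>\<^sub>0 :: "('f, 'r, 'u) fm" where
    "b \<in> tuples A m" "\<phi>\<^sub>0 \<in> Form L {} (m + n)"
    "\<And>S (\<sigma> :: 'u \<Rightarrow> 'u) a. length a = n \<Longrightarrow> holds S (fm_map \<sigma> \<phi>) a \<longleftrightarrow> holds S \<phi>\<^sub>0 (map \<sigma> b @ a)"
proof -
  obtain b where b: "set b = fpars \<phi>" using finite_list[OF finite_fpars[of \<phi>]] by blast
  define m where "m = length b"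
  \<comment> \<open>The list \<open>b\<close> may contain a parameter several times; this fixes one
    of its positions.\<close>
  define idx where "idx c = (SOME i. i < m \<and> b ! i = c)" for c
  have idx: "idx c < m \<and> b ! (idx c) = c" if "c \<in> fpars \<phi>" for c
    unfolding idx_def using that b m_def by (intro someI_ex[of "\<lambda>i. i < m \<and> b ! i = c"]) (metis in_set_conv_nth)
  define \<phi>\<^sub>0 :: "('f, 'r, 'u) fm" where "\<phi>\<^sub>0 = fm_subst (\<lambda>i. Var (m + i)) (\<lambda>c. Var (idx c)) (m + n) \<phi>"
  have 1: "\<phi>\<^sub>0 \<in> Form L {} (m + n)"
    unfolding \<phi>\<^sub>0_def using assms by (intro fm_subst_Form) (auto simp: Form_def dest: idx)
  have 2: "b \<in> tuples A m"
    using b assms by (auto simp: tuples_def m_def Form_def)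
  have 3: "holds S (fm_map \<sigma> \<phi>) a \<longleftrightarrow> holds S \<phi>\<^sub>0 (map \<sigma> b @ a)" if "length a = n" for S and \<sigma> :: "'u \<Rightarrow> 'u" and a
  proof -
    have "holds S \<phi>\<^sub>0 (map \<sigma> b @ a) \<longleftrightarrow> sat S (\<lambda>i. (map \<sigma> b @ a) ! (m + i))
      (fm_map (\<lambda>c. (map \<sigma> b @ a) ! idx c) \<phi>)"
      unfolding \<phi>\<^sub>0_def holds_def using assms
      by (subst sat_fm_subst) (auto simp: Form_def dest!: idx)
    also have "fm_map (\<lambda>c. (map \<sigma> b @ a) ! idx c) \<phi> = fm_map \<sigma> \<phi>"
    proof (rule fm.map_cong)
      fix c assume "c \<in> fpars \<phi>"
      then show "(map \<sigma> b @ a) ! idx c = \<sigma> c"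
        using idx[of c] by (auto simp: nth_append m_def)
    qed simp
    also have "sat S (\<lambda>i. (map \<sigma> b @ a) ! (m + i)) (fm_map \<sigma> \<phi>) \<longleftrightarrow> sat S (\<lambda>i. a ! i) (fm_map \<sigma> \<phi>)"
      by (intro sat_cong) (auto simp: m_def nth_append)
    finally show ?thesis by (simp add: holds_def)
  qed
  show thesis by (rule that[OF 2 1 3])
qed

section \<open>Definable predicates\<close>

text \<open>Predicates up to agreement on tuples of \<open>U\<close> replace formulas, so that
  syntactic work is confined to a few closure lemmas. Values on other lists are
  unconstrained.\<close>

definition dfn ::
  "('f, 'r) language \<Rightarrow> ('f, 'r, 'u) struct \<Rightarrow> 'u set \<Rightarrow> nat \<Rightarrow> ('u list \<Rightarrow> bool) \<Rightarrow> bool" where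
  "dfn L U A n P \<longleftrightarrow> A \<subseteq> carr U \<and>
     (\<exists>\<phi>\<in>Form L A n. \<forall>a\<in>tuples (carr U) n. P a \<longleftrightarrow> holds U \<phi> a)"

lemma dfn_sub: "dfn L U A n P \<Longrightarrow> A \<subseteq> carr U"
  by (simp add: dfn_def)

lemma dfn_holds: "\<phi> \<in> Form L A n \<Longrightarrow> A \<subseteq> carr U \<Longrightarrow> dfn L U A n (holds U \<phi>)"
  by (auto simp: dfn_def)

lemma dfn_cong:
  "(\<And>a. a \<in> tuples (carr U) n \<Longrightarrow> P a \<longleftrightarrow> Q a) \<Longrightarrow> dfn L U A n P \<longleftrightarrow> dfn L U A n Q"
  unfolding dfn_def by auto

lemma dfn_cong_imp:
  "dfn L U A n P \<Longrightarrow> (\<And>a. a \<in> tuples (carr U) n \<Longrightarrow> P a \<longleftrightarrow> Q a) \<Longrightarrow> dfn L U A n Q"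
  using dfn_cong[of U n P Q L A] by blast

lemma dfn_mono: "dfn L U A n P \<Longrightarrow> A \<subseteq> B \<Longrightarrow> B \<subseteq> carr U \<Longrightarrow> dfn L U B n P"
  unfolding dfn_def using Form_mono by blast

lemma dfn_not: "dfn L U A n P \<Longrightarrow> dfn L U A n (\<lambda>a. \<not> P a)"
  unfolding dfn_def by (metis Neg_Form holds_Neg)

lemma dfn_conj: "dfn L U A n P \<Longrightarrow> dfn L U A n Q \<Longrightarrow> dfn L U A n (\<lambda>a. P a \<and> Q a)"
  unfolding dfn_def by (metis And_Form holds_And)

lemma dfn_disj: "dfn L U A n P \<Longrightarrow> dfn L U A n Q \<Longrightarrow> dfn L U A n (\<lambda>a. P a \<or> Q a)"
  using dfn_not[OF dfn_conj[OF dfn_not dfn_not], of L U A n P Q] by simp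

lemma dfn_const:
  fixes L :: "('f, 'r) language" and U :: "('f, 'r, 'u) struct"
  shows "A \<subseteq> carr U \<Longrightarrow> dfn L U A n (\<lambda>a. b)"
proof -
  assume A: "A \<subseteq> carr U"
  \<comment> \<open>The syntax has no truth constants. This sentence has the same truth value at all
    tuples, and its negation supplies the other value.\<close>
  define \<phi> :: "('f, 'r, 'u) fm" where "\<phi> = Ex 0 (Eq (Var 0) (Var 0))"
  have T: "\<phi> \<in> Form L A n" "Neg \<phi> \<in> Form L A n" by (auto simp: Form_def \<phi>_def)
  have "carr U = {} \<or> (\<forall>a. holds U \<phi> a)"  by (auto simp: holds_def \<phi>_def)
  then consider "\<forall>a. holds U \<phi> a" | "\<forall>a. \<not> holds U \<phi> a"
    by (auto simp: holds_def \<phi>_def)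
  then show ?thesis
    using T A unfolding dfn_def by (metis holds_Neg)
qed

lemma dfn_imp_const: "A \<subseteq> carr U \<Longrightarrow> dfn L U A n P \<Longrightarrow> dfn L U A n (\<lambda>a. b \<longrightarrow> P a)"
  using dfn_const[of A U L n True] by (cases b) auto

lemma dfn_iff_const: "dfn L U A n P \<Longrightarrow> dfn L U A n (\<lambda>a. P a \<longleftrightarrow> b)"
  using dfn_not[of L U A n P] by (cases b) auto

lemma dfn_ball:
  "finite I \<Longrightarrow> A \<subseteq> carr U \<Longrightarrow> (\<And>i. i \<in> I \<Longrightarrow> dfn L U A n (P i)) \<Longrightarrow> dfn L U A n (\<lambda>a. \<forall>i\<in>I. P i a)"
  by (induction I rule: finite_induct) (auto simp: dfn_const dfn_conj)

lemma dfn_bex: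
  "finite I \<Longrightarrow> A \<subseteq> carr U \<Longrightarrow> (\<And>i. i \<in> I \<Longrightarrow> dfn L U A n (P i)) \<Longrightarrow> dfn L U A n (\<lambda>a. \<exists>i\<in>I. P i a)"
  by (induction I rule: finite_induct) (auto simp: dfn_const dfn_disj)

lemma dfn_ex:
  assumes "dfn L U A (n + m) P"
  shows "dfn L U A n (\<lambda>a. \<exists>b\<in>tuples (carr U) m. P (a @ b))"
proof -
  obtain \<phi> where \<phi>: "\<phi> \<in> Form L A (n + m)" "\<And>a. a \<in> tuples (carr U) (n + m) \<Longrightarrow> P a \<longleftrightarrow> holds U \<phi> a"
    using assms by (auto simp: dfn_def)
  have "(\<exists>b\<in>tuples (carr U) m. P (a @ b)) \<longleftrightarrow> holds U (Exs n m \<phi>) a" if "a \<in> tuples (carr U) n" for a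
  proof -
    have "length a = n" using that by (simp add: tuples_def)
    then show ?thesis using \<phi> that holds_Exs[OF \<phi>(1), of a U] append_tuples by blast
  qed
  then show ?thesis
    using Exs_Form[OF \<phi>(1)] assms unfolding dfn_def by blast
qed

text \<open>Swapping blocks, inserting parameters and projecting to blocks are all instances with a
  suitable list \<open>ts\<close>, which spares them the handling of bound variables.\<close>

lemma dfn_subst:
  assumes "dfn L U A n P" "A \<subseteq> B" "B \<subseteq> carr U" "length ts = n"
    and ts: "\<And>t. t \<in> set ts \<Longrightarrow> (\<exists>i<k. t = Var i) \<or> (\<exists>c\<in>B. t = Par c)"
  shows "dfn L U B k (\<lambda>a. P (map (eval U ((!) a)) ts))"
proof -
  obtain \<phi> where \<phi>: "\<phi> \<in> Form L A n" "\<And>a. a \<in> tuples (carr U) n \<Longrightarrow> P a \<longleftrightarrow> holds U \<phi> a"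
    using assms by (auto simp: dfn_def)
  define \<theta> where "\<theta> i = ts ! i" for i
  have \<theta>: "\<theta> i \<in> trms L B k" if "i < n" for i
    using ts[of "ts ! i"] that assms(4) by (auto simp: \<theta>_def)
  have "P (map (eval U ((!) a)) ts) \<longleftrightarrow> holds U (fm_subst \<theta> Par k \<phi>) a" if a: "a \<in> tuples (carr U) k" for a
  proof -
    have "eval U ((!) a) t \<in> carr U" if "t \<in> set ts" for t
    proof -
      consider i where "i < k" "t = Var i" | c where "c \<in> B" "t = Par c" using ts[OF \<open>t \<in> set ts\<close>] by blast
      then show ?thesis
        by cases (use a assms(3) in \<open>auto simp: tuples_def\<close>)
    qed
    then have "map (eval U ((!) a)) ts \<in> tuples (carr U) n"
      using assms(4) by (auto simp: tuples_def)
    then have "P (map (eval U ((!) a)) ts) \<longleftrightarrow> holds U \<phi> (map (eval U ((!) a)) ts)"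
      by (rule \<phi>(2))
    also have "\<dots> \<longleftrightarrow> sat U (\<lambda>i. eval U ((!) a) (\<theta> i)) \<phi>"
      unfolding holds_def using \<phi>(1) assms(4)
      by (intro sat_cong) (auto simp: \<theta>_def Form_def)
    also have "\<phi> = fm_map (\<lambda>c. eval U ((!) a) (Par c)) \<phi>"
      by (simp add: fm.map_ident)
    also have "sat U (\<lambda>i. eval U ((!) a) (\<theta> i)) (fm_map (\<lambda>c. eval U ((!) a) (Par c)) \<phi>) \<longleftrightarrow>
      sat U ((!) a) (fm_subst \<theta> Par k \<phi>)"
      using \<phi>(1) \<theta> by (intro sat_fm_subst[symmetric]) (fastforce simp: Form_def trms_def)+
    finally show ?thesis by (simp add: holds_def)
  qed
  moreover have "fm_subst \<theta> Par k \<phi> \<in> Form L B k"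
    using \<phi>(1) \<theta> assms(2) by (intro fm_subst_Form) (auto simp: Form_def)
  ultimately show ?thesis using assms(3) unfolding dfn_def by blast
qed

lemma map_eval_Var_upt: "j \<le> length a \<Longrightarrow> map (eval U ((!) a)) (map Var [i..<j]) = drop i (take j a)"
  by (auto simp: list_eq_iff_nth_eq)

lemma map_eval_Par: "map (eval U e) (map Par b) = b"
  by (simp add: o_def)

lemma dfn_swap:
  assumes "dfn L U A (m + n) P"
  shows "dfn L U A (n + m) (\<lambda>a. P (drop n a @ take n a))"
proof -
  have "dfn L U A (n + m) (\<lambda>a. P (map (eval U ((!) a)) (map Var [n..<n+m] @ map Var [0..<n])))"
    using assms dfn_sub[OF assms] by (intro dfn_subst) auto
  then show ?thesis
    by (rule dfn_cong_imp) (simp del: map_map add: map_eval_Var_upt tuples_def)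
qed

lemma dfn_plug_left:
  assumes "dfn L U A (m + n) P" "b \<in> tuples B m" "A \<subseteq> B" "B \<subseteq> carr U"
  shows "dfn L U B n (\<lambda>a. P (b @ a))"
proof -
  have "dfn L U B n (\<lambda>a. P (map (eval U ((!) a)) (map Par b @ map Var [0..<n])))"
    using assms by (intro dfn_subst) (auto simp: tuples_def)
  then show ?thesis
    by (rule dfn_cong_imp) (simp del: map_map add: map_eval_Var_upt map_eval_Par tuples_def)
qed

lemma dfn_plug_right:
  assumes "dfn L U A (n + m) P" "b \<in> tuples B m" "A \<subseteq> B" "B \<subseteq> carr U"
  shows "dfn L U B n (\<lambda>a. P (a @ b))"
proof -
  have "dfn L U B n (\<lambda>a. P (map (eval U ((!) a)) (map Var [0..<n] @ map Par b)))"
    using assms by (intro dfn_subst) (auto simp: tuples_def)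
  then show ?thesis
    by (rule dfn_cong_imp) (simp del: map_map add: map_eval_Var_upt map_eval_Par tuples_def)
qed

text \<open>The parameters go last, so that they can be absorbed into the second block of a
  partitioned predicate.\<close>

lemma dfn_params:
  fixes L :: "('f, 'r) language" and U :: "('f, 'r, 'u) struct"
  assumes "dfn L U A n P"
  obtains m b Q where "b \<in> tuples A m" "dfn L U {} (n + m) Q"
    "\<And>a. a \<in> tuples (carr U) n \<Longrightarrow> P a \<longleftrightarrow> Q (a @ b)"
proof -
  obtain \<phi> where \<phi>: "\<phi> \<in> Form L A n" "\<And>a. a \<in> tuples (carr U) n \<Longrightarrow> P a \<longleftrightarrow> holds U \<phi> a"
    using assms by (auto simp: dfn_def)
  obtain b m and \<phi>\<^sub>0 :: "('f, 'r, 'u) fm" where m: "b \<in> tuples A m" "\<phi>\<^sub>0 \<in> Form L {} (m + n)"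
    "\<And>S (\<sigma> :: 'u \<Rightarrow> 'u) a. length a = n \<Longrightarrow> holds S (fm_map \<sigma> \<phi>) a \<longleftrightarrow> holds S \<phi>\<^sub>0 (map \<sigma> b @ a)"
    by (rule Form_params[OF \<phi>(1)]) (rule that)
  have 1: "dfn L U {} (n + m) (\<lambda>a. holds U \<phi>\<^sub>0 (drop n a @ take n a))"
    using dfn_holds[OF m(2)] by (intro dfn_swap) auto
  have 2: "P a \<longleftrightarrow> holds U \<phi>\<^sub>0 (drop n (a @ b) @ take n (a @ b))" if "a \<in> tuples (carr U) n" for a
    using m(3)[of a U id] \<phi>(2) that by (simp add: tuples_def fm.map_id)
  show thesis by (rule that[OF m(1) 1 2])
qed

section \<open>Ultrafilters\<close>

definition ultra :: "'i filter \<Rightarrow> bool" where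
  "ultra D \<longleftrightarrow> D \<noteq> bot \<and> (\<forall>P. eventually P D \<or> eventually (\<lambda>x. \<not> P x) D)"

lemma ultra_not: "ultra D \<Longrightarrow> eventually (\<lambda>x. \<not> P x) D \<longleftrightarrow> \<not> eventually P D"
  unfolding ultra_def using eventually_conj[of P D "\<lambda>x. \<not> P x"]
  by (auto simp: trivial_limit_def)

lemma ultra_ex: "ultra D \<Longrightarrow> eventually P D \<Longrightarrow> \<exists>x. P x"
  unfolding ultra_def by (metis eventually_happens')

text \<open>Zorn's lemma for the reversed order gives a minimal proper filter. It decides every
  \<open>P\<close>: if its restriction to \<open>P\<close> is proper, then by minimality the
  restriction changes nothing.\<close>

lemma ultra_exists:
  fixes F :: "'i filter"
  assumes "F \<noteq> bot"
  obtains D where "ultra D" "D \<le> F"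
proof -
  have "\<exists>D\<in>{G. G \<noteq> bot \<and> G \<le> F}. \<forall>G\<in>{G. G \<noteq> bot \<and> G \<le> F}. G \<le> D \<longrightarrow> G = D"
  proof (rule predicate_Zorn)
    show "partial_order_on {G. G \<noteq> bot \<and> G \<le> F} (relation_of (\<lambda>G H. H \<le> G) {G. G \<noteq> bot \<and> G \<le> F})"
      by (rule partial_order_on_relation_ofI) auto
  next
    fix C assume C: "C \<in> Chains (relation_of (\<lambda>G H. H \<le> G) {G. G \<noteq> bot \<and> G \<le> F})"
    then have sub: "C \<subseteq> {G. G \<noteq> bot \<and> G \<le> F}"
      and lin: "\<And>G H. G \<in> C \<Longrightarrow> H \<in> C \<Longrightarrow> G \<le> H \<or> H \<le> G"
      by (auto simp: Chains_def relation_of_def)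
    show "\<exists>u\<in>{G. G \<noteq> bot \<and> G \<le> F}. \<forall>a\<in>C. u \<le> a"
    proof (cases "C = {}")
      case True
      then show ?thesis using assms by auto
    next
      case False
      have "eventually P (Inf C) \<longleftrightarrow> (\<exists>G\<in>C. eventually P G)" for P
      proof (rule eventually_Inf_base)
        fix G H assume "G \<in> C" "H \<in> C"
        then show "\<exists>x\<in>C. x \<le> inf G H"
          using lin[of G H] by (auto intro: bexI[of _ G] bexI[of _ H])
      qed (rule False)
      then have "Inf C \<noteq> bot"
        using sub by (auto simp: trivial_limit_def)
      moreover obtain G where "G \<in> C" using False by blast
      moreover from this have "Inf C \<le> F" using sub by (auto intro: Inf_lower2)
      ultimately show ?thesis by (auto intro: Inf_lower)
    qed
  qed
  then obtain D where D: "D \<noteq> bot" "D \<le> F"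
    and max: "\<And>G. G \<noteq> bot \<Longrightarrow> G \<le> F \<Longrightarrow> G \<le> D \<Longrightarrow> G = D" by auto
  have "eventually P D \<or> eventually (\<lambda>x. \<not> P x) D" for P
  proof (cases "inf D (principal {x. P x}) = bot")
    case True
    then have "eventually (\<lambda>x. False) (inf D (principal {x. P x}))" by simp
    then show ?thesis by (auto simp: eventually_inf_principal)
  next
    case False
    then have "inf D (principal {x. P x}) = D"
      using D by (intro max) (auto intro: le_infI1)
    moreover have "eventually P (inf D (principal {x. P x}))"
      by (simp add: eventually_inf_principal)
    ultimately show ?thesis by simp
  qed
  then have "ultra D" using D by (simp add: ultra_def)
  then show thesis using D(2) by (rule that)
qed

lemma ultra_fip:
  assumes "\<And>\<F>. finite \<F> \<Longrightarrow> \<F> \<subseteq> \<G> \<Longrightarrow> \<exists>x. \<forall>P\<in>\<F>. P x"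
  obtains D where "ultra D" "\<And>P. P \<in> \<G> \<Longrightarrow> eventually P D"
proof -
  define F where "F = (INF P\<in>\<G>. principal {x. P x})"
  have "\<not> eventually (\<lambda>x. False) F"
  proof
    assume "eventually (\<lambda>x. False) F"
    then have "\<exists>\<F>\<subseteq>\<G>. finite \<F> \<and> eventually (\<lambda>x. False) (INF P\<in>\<F>. principal {x. P x})"
      unfolding F_def by (rule eventually_INF[THEN iffD1])
    then obtain \<F> where \<F>: "\<F> \<subseteq> \<G>" "finite \<F>"
      "eventually (\<lambda>x. False) (INF P\<in>\<F>. principal {x. P x})"
      by blast
    then show False
      using assms[OF \<F>(2,1)] by (auto simp: INF_principal_finite eventually_principal)
  qed
  then have "F \<noteq> bot" by (auto simp: trivial_limit_def)
  then obtain D where D: "ultra D" "D \<le> F" by (rule ultra_exists)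
  have "eventually P D" if "P \<in> \<G>" for P
  proof (rule filter_leD[OF D(2)])
    show "eventually P F"
      unfolding F_def using that by (rule eventually_INF1) (simp add: eventually_principal)
  qed
  with D(1) show thesis by (rule that)
qed

text \<open>Completions of finitely consistent families, limits of sequences in \<open>M\<close> and
  coheirs are all obtained as limits of tuples along an ultrafilter, and this is what makes them
  complete types.\<close>

lemma ctypes_ultra:
  assumes "ultra D" "eventually (\<lambda>i. g i \<in> tuples (carr U) n) D"
  shows "{\<phi>\<in>Form L A n. eventually (\<lambda>i. holds U \<phi> (g i)) D} \<in> ctypes L U A n" (is "?p \<in> _")
proof -
  have "\<exists>a\<in>tuples (carr U) n. \<forall>\<phi>\<in>F. holds U \<phi> a" if F: "finite F" "F \<subseteq> ?p" for F
  proof -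
    have "eventually (\<lambda>i. \<forall>\<phi>\<in>F. holds U \<phi> (g i)) D"
      using F by (intro eventually_ball_finite) auto
    then have "eventually (\<lambda>i. g i \<in> tuples (carr U) n \<and> (\<forall>\<phi>\<in>F. holds U \<phi> (g i))) D"
      using assms(2) eventually_conj by blast
    then show ?thesis using ultra_ex[OF assms(1)] by blast
  qed
  then show ?thesis
    using assms(1) by (auto simp: ctypes_def ultra_not)
qed

section \<open>Types as ultrafilters of definable predicates\<close>

text \<open>Membership of a predicate in a type, independent of the choice of a defining formula.\<close>

definition in_type ::
  "('f, 'r, 'u) struct \<Rightarrow> nat \<Rightarrow> ('f, 'r, 'u) fm set \<Rightarrow> ('u list \<Rightarrow> bool) \<Rightarrow> bool" where
  "in_type U n p P \<longleftrightarrow> (\<exists>\<phi>\<in>p. \<forall>a\<in>tuples (carr U) n. holds U \<phi> a \<longrightarrow> P a)"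

lemma in_type_mono:
  "in_type U n p P \<Longrightarrow> (\<And>a. a \<in> tuples (carr U) n \<Longrightarrow> P a \<Longrightarrow> Q a) \<Longrightarrow> in_type U n p Q"
  unfolding in_type_def by blast

lemma in_type_cong:
  "(\<And>a. a \<in> tuples (carr U) n \<Longrightarrow> P a \<longleftrightarrow> Q a) \<Longrightarrow> in_type U n p P \<longleftrightarrow> in_type U n p Q"
  unfolding in_type_def by auto

locale complete_type =
  fixes L :: "('f, 'r) language" and U :: "('f, 'r, 'u) struct" and A :: "'u set" and n :: nat
    and p :: "('f, 'r, 'u) fm set"
  assumes ctype: "p \<in> ctypes L U A n"
begin

lemma in_Form: "\<phi> \<in> p \<Longrightarrow> \<phi> \<in> Form L A n"
  using ctype by (auto simp: ctypes_def)

lemma fin_sat: "finite F \<Longrightarrow> F \<subseteq> p \<Longrightarrow> \<exists>a\<in>tuples (carr U) n. \<forall>\<phi>\<in>F. holds U \<phi> a"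
  using ctype unfolding ctypes_def by blast

lemma complete: "\<phi> \<in> Form L A n \<Longrightarrow> \<phi> \<in> p \<or> Neg \<phi> \<in> p"
  using ctype by (auto simp: ctypes_def)

lemma in_type_ex: "in_type U n p P \<Longrightarrow> \<exists>a\<in>tuples (carr U) n. P a"
proof -
  assume "in_type U n p P"
  then obtain \<phi> where "\<phi> \<in> p" "\<forall>a\<in>tuples (carr U) n. holds U \<phi> a \<longrightarrow> P a"
    by (auto simp: in_type_def)
  then show ?thesis using fin_sat[of "{\<phi>}"] by auto
qed

lemma in_type_conj: "in_type U n p (\<lambda>a. P a \<and> Q a) \<longleftrightarrow> in_type U n p P \<and> in_type U n p Q"
proof
  assume "in_type U n p P \<and> in_type U n p Q"
  then obtain \<phi> \<psi> where \<phi>: "\<phi> \<in> p" "\<forall>a\<in>tuples (carr U) n. holds U \<phi> a \<longrightarrow> P a"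
    and \<psi>: "\<psi> \<in> p" "\<forall>a\<in>tuples (carr U) n. holds U \<psi> a \<longrightarrow> Q a"
    by (auto simp: in_type_def)
  have "Neg (And \<phi> \<psi>) \<notin> p"
    using fin_sat[of "{Neg (And \<phi> \<psi>), \<phi>, \<psi>}"] \<phi> \<psi> by auto
  then have "And \<phi> \<psi> \<in> p"
    using complete[of "And \<phi> \<psi>"] in_Form[OF \<phi>(1)] in_Form[OF \<psi>(1)] by simp
  then show "in_type U n p (\<lambda>a. P a \<and> Q a)"
    unfolding in_type_def using \<phi> \<psi> by (intro bexI[of _ "And \<phi> \<psi>"]) auto
qed (auto intro: in_type_mono)

lemma in_type_not:
  assumes "dfn L U A n P"
  shows "in_type U n p (\<lambda>a. \<not> P a) \<longleftrightarrow> \<not> in_type U n p P"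
proof
  assume "in_type U n p (\<lambda>a. \<not> P a)"
  then show "\<not> in_type U n p P"
    using in_type_conj[of P "\<lambda>a. \<not> P a"] in_type_ex by blast
next
  assume n: "\<not> in_type U n p P"
  obtain \<phi> where \<phi>: "\<phi> \<in> Form L A n" "\<And>a. a \<in> tuples (carr U) n \<Longrightarrow> P a \<longleftrightarrow> holds U \<phi> a"
    using assms by (auto simp: dfn_def)
  then have "\<phi> \<notin> p" using n by (auto simp: in_type_def)
  then have "Neg \<phi> \<in> p" using complete \<phi>(1) by blast
  then show "in_type U n p (\<lambda>a. \<not> P a)"
    unfolding in_type_def using \<phi>(2) by (intro bexI[of _ "Neg \<phi>"]) auto
qed

lemma in_type_holds:
  assumes "\<phi> \<in> Form L A n" "A \<subseteq> carr U"
  shows "in_type U n p (holds U \<phi>) \<longleftrightarrow> \<phi> \<in> p"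
proof
  assume "in_type U n p (holds U \<phi>)"
  moreover have "in_type U n p (\<lambda>a. \<not> holds U \<phi> a)" if "Neg \<phi> \<in> p"
    unfolding in_type_def using that by (intro bexI[of _ "Neg \<phi>"]) auto
  ultimately show "\<phi> \<in> p"
    using complete[OF assms(1)] in_type_not[OF dfn_holds[OF assms]] by blast
qed (auto simp: in_type_def)

lemma in_type_True: "A \<subseteq> carr U \<Longrightarrow> (\<And>a. a \<in> tuples (carr U) n \<Longrightarrow> P a) \<Longrightarrow> in_type U n p P"
proof (rule ccontr)
  assume *: "A \<subseteq> carr U" "\<And>a. a \<in> tuples (carr U) n \<Longrightarrow> P a" "\<not> in_type U n p P"
  have "dfn L U A n P" using dfn_cong_imp[OF dfn_const[OF *(1), of L n True], of P] *(2) by blast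
  then show False using in_type_not[of P] * in_type_ex by blast
qed

lemma in_type_ball:
  assumes "A \<subseteq> carr U" "finite I"
  shows "in_type U n p (\<lambda>a. \<forall>i\<in>I. P i a) \<longleftrightarrow> (\<forall>i\<in>I. in_type U n p (P i))"
  using assms(2) by (induction I rule: finite_induct) (auto simp: in_type_conj in_type_True[OF assms(1)])

lemma in_type_restrict:
  assumes "A \<subseteq> B" "B \<subseteq> carr U" "q \<in> ctypes L U B n" "p \<subseteq> q" "dfn L U A n P"
  shows "in_type U n p P \<longleftrightarrow> in_type U n q P"
proof -
  interpret q: complete_type L U B n q by unfold_locales fact
  have "in_type U n q Q" if "in_type U n p Q" for Q
    using that assms(4) by (auto simp: in_type_def)
  moreover have "dfn L U B n P" using assms dfn_mono by blast
  ultimately show ?thesis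
    using in_type_not[OF assms(5)] q.in_type_not[of P] by blast
qed

end

section \<open>Small models in a monster model\<close>

locale small_submodel =
  fixes L :: "('f, 'r) language" and T :: "('f, 'r, 'u) fm set"
    and U M :: "('f, 'r, 'u) struct" and \<kappa> :: "'k rel"
  assumes monster: "monster L T \<kappa> U"
    and elem: "elementary_sub L M U"
    and M_small: "|carr M| <o \<kappa>"
begin

abbreviation "UU \<equiv> carr U"
abbreviation "MM \<equiv> carr M"
abbreviation "df A n P \<equiv> dfn L U A n P"

definition small :: "'u set \<Rightarrow> bool" where
  "small A \<longleftrightarrow> A \<subseteq> UU \<and> |A| <o \<kappa>"

lemma U_struct: "is_struct L U"
  using monster by (simp add: monster_def is_model_def)

lemma UU_nonempty: "UU \<noteq> {}"
  using U_struct by (simp add: is_struct_def)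

lemma MM_sub: "MM \<subseteq> UU"
  using elem by (simp add: elementary_sub_def)

lemma small_MM: "small MM"
  using M_small MM_sub by (simp add: small_def)

lemma kappa: "Card_order \<kappa>" "infinite (Field \<kappa>)" "natLeq <o \<kappa>"
proof -
  show 1: "Card_order \<kappa>" "natLeq <o \<kappa>" using monster by (simp_all add: monster_def)
  then have "cinfinite \<kappa>"
    using cinfinite_mono[OF ordLess_imp_ordLeq natLeq_cinfinite] by blast
  then show "infinite (Field \<kappa>)" by (simp add: cinfinite_def)
qed

lemma small_Un: "small A \<Longrightarrow> small B \<Longrightarrow> small (A \<union> B)"
  unfolding small_def using card_of_Un_ordLess_infinite_Field[OF kappa(2,1)] by blast

lemma small_countable: "B \<subseteq> UU \<Longrightarrow> |B| \<le>o natLeq \<Longrightarrow> small B"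
  unfolding small_def using ordLeq_ordLess_trans kappa(3) by blast

lemma small_finite: "B \<subseteq> UU \<Longrightarrow> finite B \<Longrightarrow> small B"
  by (rule small_countable) (auto intro: ordLess_imp_ordLeq simp: finite_iff_ordLess_natLeq)

lemma small_UN: "(\<And>j :: nat. set (a j) \<subseteq> UU) \<Longrightarrow> small (\<Union>j\<in>J. set (a j))"
proof (rule small_countable)
  show "|\<Union>j\<in>J. set (a j)| \<le>o natLeq"
  proof (rule UNION_Cinfinite_bound)
    show "|J| \<le>o natLeq"
      by (rule ordLeq_transitive[OF card_of_mono1[of J UNIV]]) (simp_all add: card_of_nat ordIso_imp_ordLeq)
    show "\<forall>i\<in>J. |set (a i)| \<le>o natLeq"
      by (auto intro: ordLess_imp_ordLeq simp: finite_iff_ordLess_natLeq[symmetric])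
    show "Cinfinite natLeq" by (simp add: natLeq_Cinfinite)
  qed
qed auto

lemma small_sub: "small A \<Longrightarrow> A \<subseteq> UU"
  by (simp add: small_def)

text \<open>Saturation is assumed for complete types only. The family, together with the condition
  of being a tuple of \<open>U\<close>, is therefore extended to an ultrafilter, and the limit type
  over \<open>A\<close> is realized.\<close>

lemma saturation:
  assumes "small A" "\<And>P. P \<in> \<G> \<Longrightarrow> df A n P"
    and "\<And>\<F>. finite \<F> \<Longrightarrow> \<F> \<subseteq> \<G> \<Longrightarrow> \<exists>a\<in>tuples UU n. \<forall>P\<in>\<F>. P a"
  obtains a where "a \<in> tuples UU n" "\<And>P. P \<in> \<G> \<Longrightarrow> P a"
proof -
  have fip: "\<exists>x. \<forall>P\<in>\<F>. P x" if \<F>: "finite \<F>" "\<F> \<subseteq> insert (\<lambda>a. a \<in> tuples UU n) \<G>" for \<F>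
  proof -
    have "\<F> - {\<lambda>a. a \<in> tuples UU n} \<subseteq> \<G>" using \<F> by auto
    then obtain a where "a \<in> tuples UU n" "\<forall>P\<in>\<F> - {\<lambda>a. a \<in> tuples UU n}. P a"
      using assms(3) \<F>(1) by (metis finite_Diff)
    then have "\<forall>P\<in>\<F>. P a" by auto
    then show ?thesis ..
  qed
  obtain D where D: "ultra D" "\<And>P. P \<in> insert (\<lambda>a. a \<in> tuples UU n) \<G> \<Longrightarrow> eventually P D"
    by (rule ultra_fip[OF fip]) (assumption+, rule that)
  define p where "p = {\<phi>\<in>Form L A n. eventually (\<lambda>a. holds U \<phi> a) D}"
  have "p \<in> ctypes L U A n"
    unfolding p_def by (rule ctypes_ultra) (use D in auto)
  then obtain a where a: "realizes U n a p"
    using monster assms(1) unfolding monster_def saturated_def small_def by blast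
  have "P a" if P: "P \<in> \<G>" for P
  proof -
    obtain \<phi> where \<phi>: "\<phi> \<in> Form L A n" "\<And>a. a \<in> tuples UU n \<Longrightarrow> P a \<longleftrightarrow> holds U \<phi> a"
      using assms(2)[OF P] by (auto simp: dfn_def)
    have "eventually (\<lambda>a. a \<in> tuples UU n \<and> P a) D"
      using D(2) P by (intro eventually_conj) auto
    then have "eventually (\<lambda>a. holds U \<phi> a) D"
      by (rule eventually_mono) (use \<phi> in auto)
    then have "\<phi> \<in> p" using \<phi>(1) by (simp add: p_def)
    then show ?thesis using a \<phi>(2) by (auto simp: realizes_def)
  qed
  with a show thesis by (intro that[of a]) (auto simp: realizes_def)
qed

section \<open>Elementarity and the Tarski-Vaught test\<close>

lemma elem_holds: "\<phi> \<in> Form L {} n \<Longrightarrow> a \<in> tuples MM n \<Longrightarrow> holds M \<phi> a \<longleftrightarrow> holds U \<phi> a"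
  using elem unfolding elementary_sub_def by blast

text \<open>With its parameters turned into variables, the existential closure is a formula over the
  empty set evaluated at a tuple of \<open>M\<close>, to which elementarity applies.\<close>

lemma tarski_vaught:
  assumes "df MM n P" "a \<in> tuples UU n" "P a"
  obtains c where "c \<in> tuples MM n" "P c"
proof -
  obtain \<phi> where \<phi>: "\<phi> \<in> Form L MM n" "\<And>a. a \<in> tuples UU n \<Longrightarrow> P a \<longleftrightarrow> holds U \<phi> a"
    using assms(1) by (auto simp: dfn_def)
  obtain b m and \<psi> :: "('f, 'r, 'u) fm" where b: "b \<in> tuples MM m" and \<psi>: "\<psi> \<in> Form L {} (m + n)"
    and *: "\<And>S (\<sigma> :: 'u \<Rightarrow> 'u) a. length a = n \<Longrightarrow> holds S (fm_map \<sigma> \<phi>) a \<longleftrightarrow> holds S \<psi> (map \<sigma> b @ a)"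
    by (rule Form_params[OF \<phi>(1)]) (rule that)
  have eq: "P a \<longleftrightarrow> holds U \<psi> (b @ a)" if "a \<in> tuples UU n" for a
    using *[of a U id] \<phi>(2)[OF that] that by (simp add: tuples_def fm.map_id)
  have lb: "length b = m" using b by (simp add: tuples_def)
  have "holds U (Exs m n \<psi>) b"
    using holds_Exs[OF \<psi> lb, of U] assms eq by auto
  then have "holds M (Exs m n \<psi>) b"
    using elem_holds[OF Exs_Form[OF \<psi>] b] by simp
  then obtain c where c: "c \<in> tuples MM n" "holds M \<psi> (b @ c)"
    using holds_Exs[OF \<psi> lb, of M] by auto
  then have "holds U \<psi> (b @ c)"
    using elem_holds[OF \<psi>, of "b @ c"] b by auto
  then show thesis
    using that[OF c(1)] eq[of c] tuples_mono[OF c(1) MM_sub] by blast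
qed

section \<open>Automorphisms and homogeneity\<close>

lemma eval_carr:
  "wf_trm L t \<Longrightarrow> tpars t \<subseteq> UU \<Longrightarrow> (\<And>i. e i \<in> UU) \<Longrightarrow> eval U e t \<in> UU"
proof (induction t)
  case (Fn f ts)
  have "eval U e t \<in> UU" if "t \<in> set ts" for t
    by (rule Fn.IH) (use Fn.prems that in \<open>auto simp: list_all_iff\<close>)
  then have "map (eval U e) ts \<in> tuples UU (far L f)"
    using Fn.prems(1) by (auto simp: tuples_def)
  then show ?case using Fn.prems(1) U_struct by (simp add: is_struct_def)
qed auto

lemma eval_automorphism:
  assumes "automorphism L U \<sigma>"
  shows "wf_trm L t \<Longrightarrow> tpars t \<subseteq> UU \<Longrightarrow> (\<And>i. e i \<in> UU) \<Longrightarrow>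
    eval U (\<lambda>i. \<sigma> (e i)) (trm_map \<sigma> t) = \<sigma> (eval U e t)"
proof (induction t)
  case (Fn f ts)
  have "map (eval U e) ts \<in> tuples UU (far L f)"
    using Fn.prems by (auto simp: tuples_def list_all_iff intro!: eval_carr)
  moreover have "map (eval U (\<lambda>i. \<sigma> (e i))) (map (trm_map \<sigma>) ts) = map \<sigma> (map (eval U e) ts)"
    using Fn by (auto simp: list_all_iff)
  ultimately show ?case
    using assms Fn.prems(1) unfolding automorphism_def by (simp del: map_map)
qed auto

lemma sat_automorphism:
  assumes "automorphism L U \<sigma>"
  shows "wf_fm L \<phi> \<Longrightarrow> fpars \<phi> \<subseteq> UU \<Longrightarrow> (\<And>i. e i \<in> UU) \<Longrightarrow>
    sat U (\<lambda>i. \<sigma> (e i)) (fm_map \<sigma> \<phi>) \<longleftrightarrow> sat U e \<phi>"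
proof (induction \<phi> arbitrary: e)
  case (Eq s t)
  have "inj_on \<sigma> UU" using assms by (auto simp: automorphism_def bij_betw_def)
  moreover have "eval U e s \<in> UU" "eval U e t \<in> UU"
    using Eq by (auto intro!: eval_carr)
  moreover have "eval U (\<lambda>i. \<sigma> (e i)) (trm_map \<sigma> s) = \<sigma> (eval U e s)"
    "eval U (\<lambda>i. \<sigma> (e i)) (trm_map \<sigma> t) = \<sigma> (eval U e t)"
    using Eq by (auto intro!: eval_automorphism[OF assms])
  ultimately show ?case by (auto dest: inj_onD)
next
  case (Rel R ts)
  have "map (eval U e) ts \<in> tuples UU (rar L R)"
    using Rel.prems by (auto simp: tuples_def list_all_iff intro!: eval_carr)
  moreover have "map (eval U (\<lambda>i. \<sigma> (e i))) (map (trm_map \<sigma>) ts) = map \<sigma> (map (eval U e) ts)"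
    using Rel.prems by (auto simp: list_all_iff intro!: eval_automorphism[OF assms])
  ultimately show ?case
    using assms Rel.prems(1) unfolding automorphism_def by (simp del: map_map)
next
  case (Ex i \<phi>)
  have surj: "\<sigma> ` UU = UU" using assms by (auto simp: automorphism_def bij_betw_def)
  have "sat U ((\<lambda>i. \<sigma> (e i))(i := \<sigma> d)) (fm_map \<sigma> \<phi>) \<longleftrightarrow> sat U (e(i := d)) \<phi>" if "d \<in> UU" for d
  proof -
    have "(\<lambda>i. \<sigma> (e i))(i := \<sigma> d) = (\<lambda>j. \<sigma> ((e(i := d)) j))" by auto
    moreover have "sat U (\<lambda>j. \<sigma> ((e(i := d)) j)) (fm_map \<sigma> \<phi>) \<longleftrightarrow> sat U (e(i := d)) \<phi>"
      by (rule Ex.IH) (use Ex.prems that in auto)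
    ultimately show ?thesis by (simp only:)
  qed
  then have "(\<exists>d\<in>UU. sat U ((\<lambda>i. \<sigma> (e i))(i := \<sigma> d)) (fm_map \<sigma> \<phi>)) \<longleftrightarrow> (\<exists>d\<in>UU. sat U (e(i := d)) \<phi>)"
    by blast
  moreover have "(\<exists>d\<in>UU. sat U ((\<lambda>i. \<sigma> (e i))(i := \<sigma> d)) (fm_map \<sigma> \<phi>)) \<longleftrightarrow>
    (\<exists>d\<in>\<sigma> ` UU. sat U ((\<lambda>i. \<sigma> (e i))(i := d)) (fm_map \<sigma> \<phi>))" by blast
  ultimately show ?case by (simp add: surj del: fun_upd_apply)
qed auto

lemma holds_automorphism:
  assumes \<sigma>: "automorphism L U \<sigma>" and \<phi>: "\<phi> \<in> Form L UU n" and a: "a \<in> tuples UU n"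
  shows "holds U (fm_map \<sigma> \<phi>) (map \<sigma> a) \<longleftrightarrow> holds U \<phi> a"
proof -
  obtain u where u: "u \<in> UU" using UU_nonempty by blast
  \<comment> \<open>Beyond the length of \<open>a\<close> the value \<open>a ! i\<close> is
    unspecified and may lie outside \<open>U\<close>, where nothing is known about \<sigma>. A fixed
    element of \<open>U\<close> fills these positions, which do not affect the formula.\<close>
  define e where "e i = (if i < n then a ! i else u)" for i
  have e: "e i \<in> UU" for i using a u by (auto simp: e_def tuples_def)
  have "holds U (fm_map \<sigma> \<phi>) (map \<sigma> a) \<longleftrightarrow> sat U (\<lambda>i. \<sigma> (e i)) (fm_map \<sigma> \<phi>)"
    unfolding holds_def using \<phi> a by (intro sat_cong) (auto simp: Form_def e_def tuples_def)
  also have "\<dots> \<longleftrightarrow> sat U e \<phi>"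
    using \<phi> e by (intro sat_automorphism[OF \<sigma>]) (auto simp: Form_def)
  also have "\<dots> \<longleftrightarrow> holds U \<phi> a"
    unfolding holds_def using \<phi> a by (intro sat_cong) (auto simp: Form_def e_def tuples_def)
  finally show ?thesis .
qed

lemma map_automorphism: "automorphism L U \<sigma> \<Longrightarrow> a \<in> tuples UU n \<Longrightarrow> map \<sigma> a \<in> tuples UU n"
  by (auto simp: automorphism_def bij_betw_def tuples_def)

lemma df_automorphism:
  assumes "automorphism L U \<sigma>" "\<forall>a\<in>A. \<sigma> a = a" "df A n P" "a \<in> tuples UU n"
  shows "P (map \<sigma> a) \<longleftrightarrow> P a"
proof -
  obtain \<phi> where \<phi>: "\<phi> \<in> Form L A n" "\<And>a. a \<in> tuples UU n \<Longrightarrow> P a \<longleftrightarrow> holds U \<phi> a"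
    using assms by (auto simp: dfn_def)
  have "fm_map \<sigma> \<phi> = fm_map id \<phi>"
    using \<phi>(1) assms(2) by (intro fm.map_cong) (auto simp: Form_def)
  then have "fm_map \<sigma> \<phi> = \<phi>" by (simp add: fm.map_id)
  then show ?thesis
    using holds_automorphism[OF assms(1) Form_mono[OF \<phi>(1) dfn_sub[OF assms(3)]] assms(4)]
      \<phi>(2) map_automorphism[OF assms(1,4)] assms(4) by simp
qed

text \<open>Equality of types over \<open>A\<close> makes the map that fixes \<open>A\<close> and
  sends \<open>b\<close> to \<open>b'\<close> partial elementary. Repetitions in \<open>b\<close>
  and entries lying in \<open>A\<close> cause no conflict, because the type also contains
  equalities.\<close>

lemma homogeneity:
  assumes A: "small A" and b: "b \<in> tuples UU m" "b' \<in> tuples UU m"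
    and same: "\<And>Q. df A m Q \<Longrightarrow> Q b \<longleftrightarrow> Q b'"
  obtains \<sigma> where "automorphism L U \<sigma>" "\<forall>a\<in>A. \<sigma> a = a" "map \<sigma> b = b'"
proof -
  define idx where "idx c = (SOME i. i < m \<and> b ! i = c)" for c
  have idx: "idx c < m \<and> b ! idx c = c" if "c \<in> set b" for c
    unfolding idx_def using that b(1)
    by (intro someI_ex[of "\<lambda>i. i < m \<and> b ! i = c"]) (auto simp: in_set_conv_nth tuples_def)
  define h where "h c = (if c \<in> set b then b' ! idx c else c)" for c
  have AU: "A \<subseteq> UU" using A by (rule small_sub)
  have len: "length b = m" "length b' = m" using b by (auto simp: tuples_def)
  have elt: "holds U \<phi> a \<longleftrightarrow> holds U \<phi> (map h a)"
    if \<phi>: "\<phi> \<in> Form L {} k" and a: "a \<in> tuples (A \<union> set b) k" for \<phi> a k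
  proof -
    define ts :: "('f, 'u) trm list" where
      "ts = map (\<lambda>c. if c \<in> set b then Var (idx c) else Par c) a"
    have "df A m (\<lambda>y. holds U \<phi> (map (eval U ((!) y)) ts))"
    proof (rule dfn_subst[OF dfn_holds[OF \<phi>]])
      fix t assume "t \<in> set ts"
      then show "(\<exists>i<m. t = Var i) \<or> (\<exists>c\<in>A. t = Par c)"
        using a by (auto simp: ts_def tuples_def dest: idx)
    qed (use a AU in \<open>auto simp: ts_def tuples_def\<close>)
    from same[OF this] have "holds U \<phi> (map (eval U ((!) b)) ts) \<longleftrightarrow> holds U \<phi> (map (eval U ((!) b')) ts)" .
    moreover have "map (eval U ((!) b)) ts = a"
      by (auto simp: ts_def map_idI idx)
    moreover have "map (eval U ((!) b')) ts = map h a"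
      by (auto simp: ts_def h_def)
    ultimately show ?thesis by simp
  qed
  have hb: "h (b ! i) = b' ! i" if i: "i < m" for i
  proof -
    have bi: "b ! i \<in> set b" using i len by simp
    define \<phi> :: "('f, 'r, 'u) fm" where "\<phi> = Eq (Var (idx (b ! i))) (Var i)"
    have "df A m (holds U \<phi>)"
      using AU i idx[OF bi] by (intro dfn_holds) (auto simp: Form_def \<phi>_def)
    from same[OF this] show ?thesis
      using idx[OF bi] bi by (simp add: \<phi>_def holds_def h_def)
  qed
  have hA: "h c = c" if c: "c \<in> A" for c
  proof (cases "c \<in> set b")
    case True
    define \<phi> :: "('f, 'r, 'u) fm" where "\<phi> = Eq (Var (idx c)) (Par c)"
    have "df A m (holds U \<phi>)"
      using AU c idx[OF True] by (intro dfn_holds) (auto simp: Form_def \<phi>_def)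
    from same[OF this] show ?thesis
      using idx[OF True] True by (simp add: \<phi>_def holds_def h_def)
  qed (simp add: h_def)
  have sm: "small (A \<union> set b)"
    using A small_finite[of "set b"] b by (intro small_Un) (auto simp: tuples_def)
  have "h ` (A \<union> set b) \<subseteq> UU"
  proof -
    have "h c \<in> UU" if "c \<in> set b" for c
      using idx[OF that] that b by (auto simp: h_def tuples_def)
    then show ?thesis using hA AU by auto
  qed
  then have "partial_elementary L U (A \<union> set b) h"
    using elt small_sub[OF sm] by (auto simp: partial_elementary_def)
  then obtain \<sigma> where \<sigma>: "automorphism L U \<sigma>" "\<forall>a\<in>A \<union> set b. \<sigma> a = h a"
    using monster sm unfolding monster_def strongly_homogeneous_def small_def by blast
  have "map \<sigma> b = b'"
    using \<sigma>(2) hb len by (auto simp: list_eq_iff_nth_eq)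
  with \<sigma> hA show thesis by (intro that[of \<sigma>]) auto
qed

end

section \<open>Morley sequences\<close>

text \<open>Dependent choice in which a step may consult all earlier values: the recursion builds
  the list of these values, and the sequence is read off from it.\<close>

lemma history_choice:
  assumes "\<And>h :: 'a list. \<exists>x. Q h x"
  obtains f :: "nat \<Rightarrow> 'a" where "\<And>k. Q (map f [0..<k]) (f k)"
proof -
  obtain F where F: "\<And>h. Q h (F h)" using assms by metis
  define H where "H k = rec_nat [] (\<lambda>_ h. h @ [F h]) k" for k
  have H: "H 0 = []" "H (Suc k) = H k @ [F (H k)]" for k
    by (simp_all add: H_def)
  have "H k = map (\<lambda>k. F (H k)) [0..<k]" for k
    by (induction k) (simp_all add: H)
  then have "Q (map (\<lambda>k. F (H k)) [0..<k]) (F (H k))" for k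
    using F[of "H k"] by metis
  then show thesis by (rule that)
qed

lemma concat_tuples: "(\<And>a. a \<in> set as \<Longrightarrow> a \<in> tuples A n) \<Longrightarrow> concat as \<in> tuples A (length as * n)"
  by (induction as) (auto simp: tuples_def)

text \<open>Frees the parameters from \<open>e\<close> while those from \<open>A\<close> stay in
  place, so that \<open>e\<close> can later be replaced by another tuple.\<close>

lemma dfn_split:
  assumes "dfn L U (A \<union> set e) n P" "e \<in> tuples (carr U) m"
  obtains Q where "dfn L U A (m + n) Q" "\<And>a. a \<in> tuples (carr U) n \<Longrightarrow> P a \<longleftrightarrow> Q (e @ a)"
proof -
  obtain l c Q where c: "c \<in> tuples (A \<union> set e) l" and Q: "dfn L U {} (n + l) Q"
    "\<And>a. a \<in> tuples (carr U) n \<Longrightarrow> P a \<longleftrightarrow> Q (a @ c)"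
    by (rule dfn_params[OF assms(1)]) (rule that)
  define idx where "idx c = (SOME i. i < m \<and> e ! i = c)" for c
  have idx: "idx c < m \<and> e ! idx c = c" if "c \<in> set e" for c
    unfolding idx_def using that assms(2)
    by (intro someI_ex[of "\<lambda>i. i < m \<and> e ! i = c"]) (auto simp: in_set_conv_nth tuples_def)
  define ts :: "('a, 'c) trm list" where
    "ts = map (\<lambda>c. if c \<in> set e then Var (idx c) else Par c) c"
  have A: "A \<subseteq> carr U" using dfn_sub[OF assms(1)] by simp
  have "dfn L U A (m + n) (\<lambda>z. Q (map (eval U ((!) z)) (map Var [m..<m+n] @ ts)))"
  proof (rule dfn_subst[OF Q(1)])
    fix t assume "t \<in> set (map Var [m..<m+n] @ ts)"
    then show "(\<exists>i<m + n. t = Var i) \<or> (\<exists>c\<in>A. t = Par c)"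
      using c idx by (fastforce simp: ts_def tuples_def)
  qed (use c A in \<open>auto simp: ts_def tuples_def\<close>)
  moreover have "P a \<longleftrightarrow> Q (map (eval U ((!) (e @ a))) (map Var [m..<m+n] @ ts))"
    if a: "a \<in> tuples (carr U) n" for a
  proof -
    have "map (eval U ((!) (e @ a))) (map Var [m..<m+n]) = a"
      using a assms(2) by (subst map_eval_Var_upt) (auto simp: tuples_def)
    moreover have "map (eval U ((!) (e @ a))) ts = c"
      using assms(2) idx by (auto simp: ts_def map_idI nth_append tuples_def)
    ultimately show ?thesis using Q(2)[OF a] by simp
  qed
  ultimately show thesis by (rule that)
qed

locale global_type = small_submodel L T U M \<kappa>
  for L :: "('f, 'r) language" and T :: "('f, 'r, 'u) fm set"
    and U M :: "('f, 'r, 'u) struct" and \<kappa> :: "'k rel" +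
  fixes n :: nat and p :: "('f, 'r, 'u) fm set"
  assumes global: "p \<in> ctypes L U (carr U) n"
begin

sublocale complete_type L U "carr U" n p
  by unfold_locales (rule global)

abbreviation "inp P \<equiv> in_type U n p P"

lemma dfU: "df A m P \<Longrightarrow> df UU m P"
  using dfn_mono[of L U A m P UU] dfn_sub by blast

definition gen :: "'u set \<Rightarrow> 'u list \<Rightarrow> bool" where
  "gen A a \<longleftrightarrow> a \<in> tuples UU n \<and> (\<forall>P. df A n P \<longrightarrow> inp P \<longrightarrow> P a)"

lemma gen_iff: "gen A a \<Longrightarrow> df A n P \<Longrightarrow> P a \<longleftrightarrow> inp P"
  unfolding gen_def using dfn_not[of L U A n P] in_type_not[OF dfU, of A P] by blast

lemma gen_tuples: "gen A a \<Longrightarrow> a \<in> tuples UU n"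
  and gen_set: "gen A a \<Longrightarrow> set a \<subseteq> UU"
  by (auto simp: gen_def tuples_def)

lemma gen_mono: "gen B a \<Longrightarrow> A \<subseteq> B \<Longrightarrow> B \<subseteq> UU \<Longrightarrow> gen A a"
  unfolding gen_def using dfn_mono by blast

lemma gen_exists:
  assumes "small A"
  obtains a where "gen A a"
proof -
  have "\<exists>a\<in>tuples UU n. \<forall>P\<in>\<F>. P a" if "finite \<F>" "\<F> \<subseteq> {P. df A n P \<and> inp P}" for \<F>
  proof -
    have "inp (\<lambda>a. \<forall>P\<in>\<F>. P a)" using that in_type_ball[of \<F> "\<lambda>P. P"] by auto
    then show ?thesis by (rule in_type_ex)
  qed
  then obtain a where "a \<in> tuples UU n" "\<And>P. P \<in> {P. df A n P \<and> inp P} \<Longrightarrow> P a"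
    using saturation[OF assms, of "{P. df A n P \<and> inp P}" n] by auto
  then show thesis by (intro that[of a]) (auto simp: gen_def)
qed

lemma gen_realizes:
  assumes "A \<subseteq> UU"
  shows "realizes U n a (restrict_type p A) \<longleftrightarrow> gen A a"
proof
  assume r: "realizes U n a (restrict_type p A)"
  have "P a" if P: "df A n P" "inp P" for P
  proof -
    obtain \<phi> where \<phi>: "\<phi> \<in> Form L A n" "\<And>a. a \<in> tuples UU n \<Longrightarrow> P a \<longleftrightarrow> holds U \<phi> a"
      using P(1) by (auto simp: dfn_def)
    have "inp (holds U \<phi>)" using P(2) \<phi>(2) in_type_mono by blast
    then have "\<phi> \<in> p" using in_type_holds[OF Form_mono[OF \<phi>(1) assms]] by simp
    then have "\<phi> \<in> restrict_type p A" using \<phi>(1) by (auto simp: restrict_type_def Form_def)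
    then show ?thesis using r \<phi>(2) by (auto simp: realizes_def)
  qed
  then show "gen A a" using r by (auto simp: gen_def realizes_def)
next
  assume g: "gen A a"
  have "holds U \<phi> a" if "\<phi> \<in> restrict_type p A" for \<phi>
  proof -
    have \<phi>: "\<phi> \<in> p" "\<phi> \<in> Form L A n"
      using that in_Form by (auto simp: restrict_type_def Form_def)
    then have "df A n (holds U \<phi>)" "inp (holds U \<phi>)"
      using assms dfn_holds by (auto simp: in_type_def)
    then show ?thesis using g unfolding gen_def by blast
  qed
  then show "realizes U n a (restrict_type p A)"
    using gen_tuples[OF g] by (auto simp: realizes_def)
qed

text \<open>Finite Morley sequences. The base set grows with the head of the list, so inductions
  have to generalize over it.\<close>

primrec mor :: "'u set \<Rightarrow> 'u list list \<Rightarrow> bool" where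
  "mor A [] \<longleftrightarrow> True"
| "mor A (a # as) \<longleftrightarrow> gen A a \<and> mor (A \<union> set a) as"

lemma mor_tuples: "mor A as \<Longrightarrow> a \<in> set as \<Longrightarrow> a \<in> tuples UU n"
  by (induction as arbitrary: A) (auto dest: gen_tuples)

lemma mor_append: "mor A (as @ bs) \<longleftrightarrow> mor A as \<and> mor (A \<union> \<Union> (set ` set as)) bs"
  by (induction as arbitrary: A) (auto simp: Un_assoc)

lemma mor_mono: "mor B as \<Longrightarrow> A \<subseteq> B \<Longrightarrow> B \<subseteq> UU \<Longrightarrow> mor A as"
proof (induction as arbitrary: A B)
  case (Cons a as)
  then have "gen B a" "mor (B \<union> set a) as" by auto
  moreover have "mor (A \<union> set a) as"
    by (rule Cons.IH[of "B \<union> set a"]) (use calculation Cons.prems gen_set in auto)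
  ultimately show ?case using Cons.prems gen_mono by auto
qed simp

lemma mor_concat: "mor A as \<Longrightarrow> concat as \<in> tuples UU (length as * n)"
  by (rule concat_tuples) (rule mor_tuples)

definition mseq :: "'u set \<Rightarrow> (nat \<Rightarrow> 'u list) \<Rightarrow> bool" where
  "mseq A a \<longleftrightarrow> (\<forall>i. gen (A \<union> (\<Union>j<i. set (a j))) (a i))"

lemma mseq_set: "mseq A a \<Longrightarrow> set (a j) \<subseteq> UU"
  using gen_set by (auto simp: mseq_def)

lemma Morley_sequence_mseq:
  assumes "A \<subseteq> UU"
  shows "Morley_sequence U A n p a \<longleftrightarrow> mseq A a"
proof
  assume M: "Morley_sequence U A n p a"
  then have "set (a j) \<subseteq> UU" for j
    by (auto simp: Morley_sequence_def realizes_def tuples_def)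
  then have "A \<union> (\<Union>j<i. set (a j)) \<subseteq> UU" for i
    using assms by auto
  then show "mseq A a"
    using M unfolding Morley_sequence_def mseq_def by (simp add: gen_realizes)
next
  assume M: "mseq A a"
  then have "A \<union> (\<Union>j<i. set (a j)) \<subseteq> UU" for i
    using assms mseq_set by blast
  then show "Morley_sequence U A n p a"
    using M unfolding Morley_sequence_def mseq_def by (simp add: gen_realizes)
qed

lemma mseq_exists:
  assumes "small A"
  obtains a where "mseq A a"
proof -
  \<comment> \<open>The premise makes the choice total: a history with entries outside
    \<open>U\<close> need not have a continuation.\<close>
  have "\<exists>x. (\<forall>y\<in>set h. set y \<subseteq> UU) \<longrightarrow> gen (A \<union> \<Union> (set ` set h)) x" for h
  proof (cases "\<forall>y\<in>set h. set y \<subseteq> UU")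
    case True
    then have "small (A \<union> \<Union> (set ` set h))"
      by (intro small_Un assms small_finite) auto
    then show ?thesis using gen_exists by blast
  qed blast
  then obtain f where f: "\<And>k. (\<forall>y\<in>set (map f [0..<k]). set y \<subseteq> UU) \<longrightarrow>
      gen (A \<union> \<Union> (set ` set (map f [0..<k]))) (f k)"
    by (rule history_choice) (rule that)
  have g: "gen (A \<union> (\<Union>j<k. set (f j))) (f k)" for k
  proof (induction k rule: less_induct)
    case (less k)
    have "set ` set (map f [0..<k]) = (\<lambda>j. set (f j)) ` {..<k}"
      by (auto simp: image_image)
    moreover have "\<forall>y\<in>set (map f [0..<k]). set y \<subseteq> UU"
      using gen_set[OF less] by auto
    ultimately show ?case using f[of k] by simp
  qed
  then show thesis by (intro that[of f]) (simp add: mseq_def)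
qed

text \<open>A term is generic over \<open>A\<close> and all earlier terms, hence over any smaller
  set, so indices may be skipped. The variables \<open>k\<close> and \<open>B\<close> let the base
  absorb the terms already used.\<close>

lemma mseq_mor:
  assumes "mseq A a" "A \<subseteq> UU"
  shows "sorted_wrt (<) js \<Longrightarrow> (\<And>j. j \<in> set js \<Longrightarrow> k \<le> j) \<Longrightarrow> B \<subseteq> A \<union> (\<Union>j<k. set (a j)) \<Longrightarrow>
    mor B (map a js)"
proof (induction js arbitrary: B k)
  case (Cons j js)
  have kj: "k \<le> j" using Cons.prems by simp
  then have sub: "B \<subseteq> A \<union> (\<Union>i<j. set (a i))"
    using Cons.prems(3) by fastforce
  have "gen B (a j)"
  proof (rule gen_mono[OF _ sub])
    show "gen (A \<union> (\<Union>i<j. set (a i))) (a j)" using assms(1) by (simp add: mseq_def)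
    show "A \<union> (\<Union>i<j. set (a i)) \<subseteq> UU" using assms(2) mseq_set[OF assms(1)] by blast
  qed
  moreover have "mor (B \<union> set (a j)) (map a js)"
  proof (rule Cons.IH[of "Suc j"])
    show "B \<union> set (a j) \<subseteq> A \<union> (\<Union>i<Suc j. set (a i))"
      using sub by (auto simp: less_Suc_eq)
  qed (use Cons.prems in auto)
  ultimately show ?case by simp
qed simp

subsection \<open>Invariance\<close>

text \<open>Invariance without automorphisms: whether an instance belongs to \<open>p\<close>
  depends only on the type of its parameters over \<open>M\<close>.\<close>

definition type_invariant :: bool where
  "type_invariant \<longleftrightarrow> (\<forall>m P b b'. df MM (m + n) P \<longrightarrow> b \<in> tuples UU m \<longrightarrow> b' \<in> tuples UU m \<longrightarrow>
     (\<forall>Q. df MM m Q \<longrightarrow> (Q b \<longleftrightarrow> Q b')) \<longrightarrow> (inp (\<lambda>a. P (b @ a)) \<longleftrightarrow> inp (\<lambda>a. P (b' @ a))))"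

text \<open>Since the last term is generic over \<open>M\<close> and its predecessors, truth at it
  is membership of an instance in \<open>p\<close>. By invariance this depends only on the type of
  the predecessors, which the induction compares.\<close>

lemma mor_same_type:
  assumes "type_invariant"
  shows "mor MM as \<Longrightarrow> mor MM as' \<Longrightarrow> length as = k \<Longrightarrow> length as' = k \<Longrightarrow>
    df MM (k * n) P \<Longrightarrow> P (concat as) \<longleftrightarrow> P (concat as')"
proof (induction k arbitrary: as as' P)
  case (Suc k)
  obtain xs x where as: "as = xs @ [x]" using Suc.prems(3) by (cases as rule: rev_cases) auto
  obtain ys y where as': "as' = ys @ [y]" using Suc.prems(4) by (cases as' rule: rev_cases) auto
  have P: "df MM (k * n + n) P" using Suc.prems(5) by (simp add: add.commute)
  have xs: "mor MM xs" "length xs = k" "mor MM ys" "length ys = k"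
    using Suc.prems as as' by (auto simp: mor_append)
  have same: "Q (concat xs) \<longleftrightarrow> Q (concat ys)" if "df MM (k * n) Q" for Q
    using Suc.IH[of xs ys Q] xs that by simp
  have *: "P (concat zs @ z) \<longleftrightarrow> inp (\<lambda>a. P (concat zs @ a))"
    if z: "mor MM (zs @ [z])" "length zs = k" for zs z
  proof (rule gen_iff)
    show "gen (MM \<union> \<Union> (set ` set zs)) z" using z by (simp add: mor_append)
    have "mor MM zs" using z by (simp add: mor_append)
    then have "concat zs \<in> tuples UU (k * n)" using mor_concat z(2) by blast
    then show "df (MM \<union> \<Union> (set ` set zs)) n (\<lambda>a. P (concat zs @ a))"
      using MM_sub by (intro dfn_plug_left[OF P]) (auto simp: tuples_def)
  qed
  have "inp (\<lambda>a. P (concat xs @ a)) \<longleftrightarrow> inp (\<lambda>a. P (concat ys @ a))"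
    using assms[unfolded type_invariant_def, rule_format, OF P, of "concat xs" "concat ys"]
      same mor_concat[OF xs(1)] mor_concat[OF xs(3)] xs(2,4) by simp
  then show ?case
    using *[of xs x] *[of ys y] xs as as' Suc.prems(1,2) by simp
qed simp

subsection \<open>Definability\<close>

definition definable :: bool where
  "definable \<longleftrightarrow> (\<forall>m P. df MM (m + n) P \<longrightarrow> df MM m (\<lambda>b. inp (\<lambda>a. P (b @ a))))"

definition finitely_satisfiable :: bool where
  "finitely_satisfiable \<longleftrightarrow> (\<forall>P. df UU n P \<longrightarrow> inp P \<longrightarrow> (\<exists>c\<in>tuples MM n. P c))"

lemma definable_over:
  assumes "definable" "MM \<subseteq> A" "df A (m + n) P"
  shows "df A m (\<lambda>b. inp (\<lambda>a. P (b @ a)))"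
proof -
  obtain l c Q where c: "c \<in> tuples A l" and Q: "df {} (m + n + l) Q"
    "\<And>a. a \<in> tuples UU (m + n) \<Longrightarrow> P a \<longleftrightarrow> Q (a @ c)"
    by (rule dfn_params[OF assms(3)]) (rule that)
  define Q' where "Q' z = Q (drop l z @ take l z)" for z
  have "df {} (l + (m + n)) Q'"
    unfolding Q'_def using Q(1) by (rule dfn_swap)
  from dfn_mono[OF this empty_subsetI MM_sub] have "df MM (l + m + n) Q'"
    by (simp add: add.assoc)
  then have "df MM (l + m) (\<lambda>b. inp (\<lambda>a. Q' (b @ a)))"
    using assms(1) unfolding definable_def by blast
  then have "df A m (\<lambda>b. inp (\<lambda>a. Q' ((c @ b) @ a)))"
    by (rule dfn_plug_left[OF _ c assms(2) dfn_sub[OF assms(3)]])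
  then show ?thesis
  proof (rule dfn_cong_imp)
    fix b assume b: "b \<in> tuples UU m"
    show "inp (\<lambda>a. Q' ((c @ b) @ a)) \<longleftrightarrow> inp (\<lambda>a. P (b @ a))"
    proof (rule in_type_cong)
      fix a assume a: "a \<in> tuples UU n"
      have "P (b @ a) \<longleftrightarrow> Q ((b @ a) @ c)" using Q(2) a b by blast
      then show "Q' ((c @ b) @ a) \<longleftrightarrow> P (b @ a)"
        using c by (simp add: Q'_def tuples_def)
    qed
  qed
qed

lemma definable_over':
  assumes "definable" "MM \<subseteq> A" "df A (n + m) P"
  shows "df A m (\<lambda>b. inp (\<lambda>a. P (a @ b)))"
proof -
  have "df A (m + n) (\<lambda>z. P (drop m z @ take m z))"
    using assms(3) by (rule dfn_swap)
  from definable_over[OF assms(1,2) this] show ?thesis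
    by (rule dfn_cong_imp) (auto simp: tuples_def)
qed

text \<open>\<open>iter k P\<close>: for generic \<open>x\<^sub>1\<close>, for \<open>x\<^sub>2\<close> generic over it, and so on up to \<open>x\<^sub>k\<close>, the predicate
  \<open>P\<close> holds at \<open>x\<^sub>1, \<dots>, x\<^sub>k\<close>.\<close>

primrec iter :: "nat \<Rightarrow> ('u list \<Rightarrow> bool) \<Rightarrow> bool" where
  "iter 0 P \<longleftrightarrow> P []"
| "iter (Suc k) P \<longleftrightarrow> inp (\<lambda>a. iter k (\<lambda>z. P (a @ z)))"

lemma iter_dfn:
  assumes "definable" "MM \<subseteq> A"
  shows "df A (r + k * n) P \<Longrightarrow> df A r (\<lambda>b. iter k (\<lambda>z. P (b @ z)))"
proof (induction k arbitrary: r)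
  case (Suc k)
  then have "df A (r + n) (\<lambda>b. iter k (\<lambda>z. P (b @ z)))"
    by (intro Suc.IH) (simp add: add.assoc)
  from definable_over[OF assms this] show ?case by simp
qed simp

text \<open>Genericity of each term over its predecessors turns evaluation into membership in
  \<open>p\<close>; definability keeps the condition on the remaining terms definable over the same
  set, so the next step applies. Hence truth at one Morley sequence carries over to all.\<close>

lemma iter_mor:
  assumes "definable"
  shows "MM \<subseteq> A \<Longrightarrow> mor A as \<Longrightarrow> df A (length as * n) P \<Longrightarrow> P (concat as) \<longleftrightarrow> iter (length as) P"
proof (induction as arbitrary: A P)
  case (Cons a as)
  have a: "gen A a" "mor (A \<union> set a) as" using Cons.prems by auto
  have P: "df A (n + length as * n) P" using Cons.prems by simp
  have "df A n (\<lambda>a. iter (length as) (\<lambda>z. P (a @ z)))"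
    using iter_dfn[OF assms Cons.prems(1) P] .
  from gen_iff[OF a(1) this]
  have "iter (length (a # as)) P \<longleftrightarrow> iter (length as) (\<lambda>z. P (a @ z))" by simp
  moreover have "P (a @ concat as) \<longleftrightarrow> iter (length as) (\<lambda>z. P (a @ z))"
  proof (rule Cons.IH[of "A \<union> set a"])
    show "df (A \<union> set a) (length as * n) (\<lambda>z. P (a @ z))"
      using gen_tuples[OF a(1)] dfn_sub[OF P] by (intro dfn_plug_left[OF P]) (auto simp: tuples_def)
  qed (use a Cons.prems in auto)
  ultimately show ?case by simp
qed simp

text \<open>Suppose \<open>Q(e, x)\<close> is in \<open>p\<close> but fails at \<open>a\<close>. By
  definability, that \<open>Q(y, x)\<close> is in \<open>p\<close> while \<open>Q(y, a)\<close>
  fails is a condition on \<open>y\<close> over \<open>A\<close> and \<open>a\<close>. It holds at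
  the generic \<open>e\<close>, hence lies in \<open>p\<close> and has a solution \<open>c\<close>
  in \<open>M\<close>. But \<open>a\<close> satisfies all of \<open>p\<close> over \<open>A\<close>,
  including \<open>Q(c, x)\<close>.\<close>

lemma gen_commute:
  assumes "definable" "finitely_satisfiable" "MM \<subseteq> A" "A \<subseteq> UU" "gen A a" "gen (A \<union> set a) e"
  shows "gen (A \<union> set e) a"
proof -
  have "P a" if P: "df (A \<union> set e) n P" "inp P" for P
  proof (rule ccontr)
    assume nP: "\<not> P a"
    have a: "a \<in> tuples UU n" and e: "e \<in> tuples UU n"
      using assms gen_tuples by auto
    obtain Q where Q: "df A (n + n) Q" "\<And>a. a \<in> tuples UU n \<Longrightarrow> P a \<longleftrightarrow> Q (e @ a)"
      by (rule dfn_split[OF P(1) e]) (rule that)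
    define D where "D y \<longleftrightarrow> inp (\<lambda>x. Q (y @ x))" for y
    have "df A n D"
      unfolding D_def using definable_over[OF assms(1,3) Q(1)] .
    then have "df (A \<union> set a) n (\<lambda>y. D y \<and> \<not> Q (y @ a))"
      using a assms(4)
      by (intro dfn_conj dfn_not dfn_plug_right[OF Q(1)]) (auto simp: tuples_def intro: dfn_mono)
    moreover have "D e"
      unfolding D_def using P(2) Q(2) in_type_cong[of U n P "\<lambda>x. Q (e @ x)" p] by blast
    moreover have "\<not> Q (e @ a)" using nP Q(2) a by simp
    ultimately have "inp (\<lambda>y. D y \<and> \<not> Q (y @ a))"
      using gen_iff[OF assms(6), of "\<lambda>y. D y \<and> \<not> Q (y @ a)"] by blast
    moreover have "df UU n (\<lambda>y. D y \<and> \<not> Q (y @ a))"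
      by (rule dfU) fact
    ultimately obtain c where c: "c \<in> tuples MM n" "D c" "\<not> Q (c @ a)"
      using assms(2) unfolding finitely_satisfiable_def by blast
    have "df A n (\<lambda>x. Q (c @ x))"
      using dfn_plug_left[OF Q(1) _ _ assms(4)] tuples_mono[OF c(1) assms(3)] by blast
    then have "Q (c @ a)"
      using assms(5) c(2) unfolding D_def gen_def by blast
    then show False using c(3) by simp
  qed
  then show ?thesis using assms gen_tuples by (auto simp: gen_def)
qed

text \<open>Moves \<open>e\<close> from the end of a Morley sequence to its front by commuting it
  with one term after another.\<close>

lemma mor_insert:
  assumes "definable" "finitely_satisfiable"
  shows "MM \<subseteq> A \<Longrightarrow> A \<subseteq> UU \<Longrightarrow> mor A as \<Longrightarrow> gen (A \<union> \<Union> (set ` set as)) e \<Longrightarrow> mor (A \<union> set e) as"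
proof (induction as arbitrary: A)
  case (Cons a as)
  have a: "gen A a" "mor (A \<union> set a) as" using Cons.prems by auto
  have "set b \<subseteq> UU" if "b \<in> set (a # as)" for b
    using mor_tuples[OF Cons.prems(3) that] by (simp add: tuples_def)
  then have sub: "A \<union> \<Union> (set ` set (a # as)) \<subseteq> UU"
    using Cons.prems(2) by blast
  have "gen (A \<union> set a) e"
    by (rule gen_mono[OF Cons.prems(4) _ sub]) auto
  then have "gen (A \<union> set e) a"
    using gen_commute[OF assms] Cons.prems a by blast
  moreover have "mor (A \<union> set a \<union> set e) as"
    by (rule Cons.IH) (use Cons.prems a gen_set[OF a(1)] in \<open>auto simp: Un_assoc\<close>)
  ultimately show ?case by (simp add: Un_ac)
qed simp

text \<open>At an entry \<open>True\<close> a new realization is taken at the end of the remaining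
  failures and moved in front of them; at an entry \<open>False\<close> the next failure is
  consumed. So only the number of available failures matters.\<close>

lemma mor_interleave:
  assumes "definable" "finitely_satisfiable" "small B" "df B n R" "inp R"
  shows "MM \<subseteq> A \<Longrightarrow> small A \<Longrightarrow> mor A as \<Longrightarrow> (\<And>a. a \<in> set as \<Longrightarrow> \<not> R a) \<Longrightarrow>
    length (filter Not bs) \<le> length as \<Longrightarrow> \<exists>ds. mor A ds \<and> list_all2 (\<lambda>d t. R d \<longleftrightarrow> t) ds bs"
proof (induction bs arbitrary: A as)
  case (Cons t bs)
  show ?case
  proof (cases t)
    case True
    have sm: "small (A \<union> \<Union> (set ` set as))"
      using mor_tuples[OF Cons.prems(3)]
      by (intro small_Un Cons.prems small_finite) (auto simp: tuples_def)
    \<comment> \<open>Genericity over \<open>B\<close> makes \<open>R\<close> true at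
      \<open>e\<close>; genericity over the failures in \<open>as\<close> allows \<open>e\<close> to
      be moved in front of them.\<close>
    then obtain e where e: "gen (A \<union> \<Union> (set ` set as) \<union> B) e"
      using gen_exists small_Un assms(3) by blast
    have sub: "A \<union> \<Union> (set ` set as) \<union> B \<subseteq> UU"
      using small_sub[OF small_Un[OF sm assms(3)]] .
    have "gen B e" using gen_mono[OF e _ sub] by blast
    then have Re: "R e" using assms(4,5) unfolding gen_def by blast
    have eA: "gen A e" "gen (A \<union> \<Union> (set ` set as)) e" using gen_mono[OF e _ sub] by auto
    have "mor (A \<union> set e) as"
      using mor_insert[OF assms(1,2)] Cons.prems eA small_sub by blast
    then obtain ds where "mor (A \<union> set e) ds" "list_all2 (\<lambda>d t. R d \<longleftrightarrow> t) ds bs"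
      using Cons.IH[of "A \<union> set e" as] Cons.prems True small_Un small_finite gen_set[OF e]
      by (metis filter.simps(2) finite_set le_supI1)
    then show ?thesis using Re eA True by (intro exI[of _ "e # ds"]) simp
  next
    case False
    then obtain a as' where as: "as = a # as'" using Cons.prems(5) by (cases as) auto
    then have a: "gen A a" "mor (A \<union> set a) as'" "\<not> R a" using Cons.prems by auto
    have "small (A \<union> set a)" using Cons.prems(2) gen_set[OF a(1)] small_Un small_finite by blast
    then obtain ds where "mor (A \<union> set a) ds" "list_all2 (\<lambda>d t. R d \<longleftrightarrow> t) ds bs"
      using Cons.IH[of "A \<union> set a" as'] Cons.prems False as a by auto
    then show ?thesis using a False by (intro exI[of _ "a # ds"]) simp
  qed
qed simp

text \<open>A property of Morley sequences reflects to a sequence of tuples of \<open>M\<close>. To choose the next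
  tuple only finitely many conditions can be met, hence the restriction \<open>N \<le> min js\<close>, which is
  harmless for subsequences.\<close>

lemma reflect_sequence:
  fixes g :: "'i \<Rightarrow> 'u list" and adm :: "'i list \<Rightarrow> 'i \<Rightarrow> bool"
  assumes "definable" "\<And>i. g i \<in> tuples MM n"
    and \<Theta>: "\<And>N. df MM (N * n) (\<Theta> N)" "\<And>N. iter N (\<Theta> N)"
    and adm: "\<And>h P. df MM n P \<Longrightarrow> inp P \<Longrightarrow> \<exists>i. adm h i \<and> P (g i)"
  obtains f :: "nat \<Rightarrow> 'i" where "\<And>k. adm (map f [0..<k]) (f k)"
    "\<And>js. sorted_wrt (<) js \<Longrightarrow> (\<And>j. j \<in> set js \<Longrightarrow> length js \<le> j) \<Longrightarrow>
       \<Theta> (length js) (concat (map (\<lambda>j. g (f j)) js))"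
proof -
  \<comment> \<open>The tuples in \<open>cs\<close> count as good for \<open>N\<close> if completing
    them to length \<open>N\<close> by generic tuples yields the property.\<close>
  define cond where "cond N cs \<longleftrightarrow> iter (N - length cs) (\<lambda>z. \<Theta> N (concat cs @ z))" for N cs
  \<comment> \<open>The partial choices to be extended by tuple number \<open>k\<close>. The bound
    \<open>N \<le> k\<close> makes them finite in number, so one definable condition in the type
    handles them all.\<close>
  define J where "J k = {(N, js). N \<le> k \<and> length js < N \<and> set js \<subseteq> {..<k}}" for k :: nat
  have finJ: "finite (J k)" for k
  proof (rule finite_subset)
    show "J k \<subseteq> {..k} \<times> {js. set js \<subseteq> {..<k} \<and> length js \<le> k}"
      by (auto simp: J_def)
    show "finite ({..k} \<times> {js. set js \<subseteq> {..<k} \<and> length js \<le> k})"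
      by (intro finite_cartesian_product finite_lists_length_le) auto
  qed
  have "\<exists>i. adm h i \<and> (\<forall>(N, js)\<in>J (length h). cond N (map (\<lambda>j. g (h ! j)) js) \<longrightarrow>
    cond N (map (\<lambda>j. g (h ! j)) js @ [g i]))" for h
  proof -
    define G where "G x a \<longleftrightarrow> (case x of (N, js) \<Rightarrow> cond N (map (\<lambda>j. g (h ! j)) js) \<longrightarrow>
      cond N (map (\<lambda>j. g (h ! j)) js @ [a]))" for x a
    have G: "df MM n (G x) \<and> inp (G x)" if x: "x \<in> J (length h)" for x
    proof -
      obtain N js where Njs: "x = (N, js)" by (cases x)
      define cs where "cs = map (\<lambda>j. g (h ! j)) js"
      have len: "length cs = length js" "length js < N" using x Njs by (auto simp: J_def cs_def)
      define k where "k = N - Suc (length cs)"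
      have N: "N - length cs = Suc k" using len by (simp add: k_def)
      have tot: "N * n = length cs * n + (n + k * n)"
        using N len by (metis add_mult_distrib le_add_diff_inverse less_imp_le mult_Suc)
      have "concat cs \<in> tuples MM (length cs * n)"
        by (rule concat_tuples) (auto simp: cs_def assms(2))
      then have "df MM (n + k * n) (\<lambda>z. \<Theta> N (concat cs @ z))"
        using \<Theta>(1)[of N] unfolding tot by (rule_tac dfn_plug_left) (use MM_sub in auto)
      then have 1: "df MM n (\<lambda>a. iter k (\<lambda>z. \<Theta> N (concat cs @ a @ z)))"
        by (rule iter_dfn[OF assms(1) order_refl])
      have c: "cond N cs \<longleftrightarrow> inp (\<lambda>a. cond N (cs @ [a]))"
        "\<And>a. cond N (cs @ [a]) \<longleftrightarrow> iter k (\<lambda>z. \<Theta> N (concat cs @ a @ z))"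
        using N by (simp_all add: cond_def k_def)
      have d: "df MM n (\<lambda>a. cond N (cs @ [a]))" using 1 c(2) by simp
      have GG: "G x = (\<lambda>a. cond N cs \<longrightarrow> cond N (cs @ [a]))"
        unfolding G_def Njs cs_def by auto
      have "inp (\<lambda>a. cond N cs \<longrightarrow> cond N (cs @ [a]))"
        using c(1) in_type_True[of "\<lambda>a. cond N cs \<longrightarrow> cond N (cs @ [a])"] by (cases "cond N cs") auto
      then show ?thesis unfolding GG using dfn_imp_const[OF MM_sub d] by blast
    qed
    have "df MM n (\<lambda>a. \<forall>x\<in>J (length h). G x a)"
      using G by (intro dfn_ball finJ MM_sub) auto
    moreover have "inp (\<lambda>a. \<forall>x\<in>J (length h). G x a)"
      using G in_type_ball[OF order_refl finJ] by auto
    ultimately obtain i where "adm h i" "\<forall>x\<in>J (length h). G x (g i)"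
      using adm by blast
    then show ?thesis by (intro exI[of _ i]) (auto simp: G_def)
  qed
  then obtain f where f: "\<And>k. adm (map f [0..<k]) (f k) \<and>
    (\<forall>(N, js)\<in>J (length (map f [0..<k])). cond N (map (\<lambda>j. g (map f [0..<k] ! j)) js) \<longrightarrow>
    cond N (map (\<lambda>j. g (map f [0..<k] ! j)) js @ [g (f k)]))"
    by (rule history_choice) (rule that)
  have step: "cond N (map (\<lambda>j. g (f j)) (js @ [k]))"
    if "cond N (map (\<lambda>j. g (f j)) js)" "N \<le> k" "length js < N" "set js \<subseteq> {..<k}" for N js k
  proof -
    have "(N, js) \<in> J (length (map f [0..<k]))" using that by (simp add: J_def)
    from bspec[OF conjunct2[OF f[of k]] this]
    have *: "cond N (map (\<lambda>j. g (map f [0..<k] ! j)) js) \<longrightarrow>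
      cond N (map (\<lambda>j. g (map f [0..<k] ! j)) js @ [g (f k)])" by simp
    have "map (\<lambda>j. g (map f [0..<k] ! j)) js = map (\<lambda>j. g (f j)) js"
      using that(4) by (intro map_cong) auto
    with * that(1) show ?thesis by simp
  qed
  \<comment> \<open>All indices are at least \<open>N\<close>, so every extension was provided for
    when its last tuple was chosen.\<close>
  have main: "cond N (map (\<lambda>j. g (f j)) js)"
    if "sorted_wrt (<) js" "\<And>j. j \<in> set js \<Longrightarrow> N \<le> j" "length js \<le> N" for N js
    using that
  proof (induction js rule: rev_induct)
    case Nil
    then show ?case using \<Theta>(2)[of N] by (simp add: cond_def)
  next
    case (snoc k js)
    show ?case
    proof (rule step)
      show "cond N (map (\<lambda>j. g (f j)) js)" using snoc by (simp add: sorted_wrt_append)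
      show "set js \<subseteq> {..<k}" using snoc.prems(1) by (auto simp: sorted_wrt_append)
    qed (use snoc.prems in auto)
  qed
  show thesis
  proof (rule that[of f])
    fix k show "adm (map f [0..<k]) (f k)" using f by blast
  next
    fix js :: "nat list"
    assume "sorted_wrt (<) js" "\<And>j. j \<in> set js \<Longrightarrow> length js \<le> j"
    from main[OF this order_refl] show "\<Theta> (length js) (concat (map (\<lambda>j. g (f j)) js))"
      by (simp add: cond_def)
  qed
qed

end

section \<open>Truth patterns\<close>

lemma dfn_drop:
  assumes "dfn L U A m P"
  shows "dfn L U A (n + m) (\<lambda>w. P (drop n w))"
proof -
  have "dfn L U A (n + m) (\<lambda>w. P (map (eval U ((!) w)) (map Var [n..<n+m])))"
    using assms dfn_sub[OF assms] by (intro dfn_subst) auto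
  then show ?thesis
    by (rule dfn_cong_imp) (simp del: map_map add: map_eval_Var_upt tuples_def)
qed

text \<open>The list \<open>z\<close> is the concatenation of \<open>N\<close> blocks of length
  \<open>n\<close>: definable predicates take a single flat tuple.\<close>

definition pattern ::
  "('f, 'r, 'u) struct \<Rightarrow> nat \<Rightarrow> nat \<Rightarrow> ('u list \<Rightarrow> bool) \<Rightarrow> nat \<Rightarrow> (nat \<Rightarrow> bool) \<Rightarrow> 'u list \<Rightarrow> bool"
  where
  "pattern U n m P N t z \<longleftrightarrow>
     (\<exists>y\<in>tuples (carr U) m. \<forall>j<N. P (take n (drop (j * n) z) @ y) \<longleftrightarrow> t j)"

lemma block_concat:
  "(\<And>a. a \<in> set as \<Longrightarrow> length a = n) \<Longrightarrow> j < length as \<Longrightarrow> take n (drop (j * n) (concat as)) = as ! j"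
proof (induction as arbitrary: j)
  case (Cons a as)
  then show ?case by (cases j) auto
qed simp

lemma pattern_concat:
  assumes "\<And>a. a \<in> set as \<Longrightarrow> length a = n" "length as = N"
  shows "pattern U n m P N t (concat as) \<longleftrightarrow>
    (\<exists>y\<in>tuples (carr U) m. \<forall>j<N. P (as ! j @ y) \<longleftrightarrow> t j)"
  unfolding pattern_def using block_concat[of as n] assms by simp

lemma block_less: "j < N \<Longrightarrow> j * n + n \<le> N * (n :: nat)"
  using mult_le_mono1[of "Suc j" N n] by simp

lemma dfn_pattern:
  assumes "dfn L U A (n + m) P"
  shows "dfn L U A (N * n) (pattern U n m P N t)"
proof -
  have "dfn L U A (N * n + m) (\<lambda>w. \<forall>j\<in>{..<N}. P (take n (drop (j * n) w) @ drop (N * n) w) \<longleftrightarrow> t j)"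
  proof (intro dfn_ball dfn_iff_const)
    fix j assume "j \<in> {..<N}"
    then have j: "j * n + n \<le> N * n" by (simp add: block_less)
    have "dfn L U A (N * n + m) (\<lambda>w. P (map (eval U ((!) w))
        (map Var [j * n..<j * n + n] @ map Var [N * n..<N * n + m])))"
      using assms dfn_sub[OF assms] j by (intro dfn_subst) auto
    then show "dfn L U A (N * n + m) (\<lambda>w. P (take n (drop (j * n) w) @ drop (N * n) w))"
    proof (rule dfn_cong_imp)
      fix w assume "w \<in> tuples (carr U) (N * n + m)"
      then have w: "length w = N * n + m" by (simp add: tuples_def)
      have "map (eval U ((!) w)) (map Var [j * n..<j * n + n]) = take n (drop (j * n) w)"
        using w j by (subst map_eval_Var_upt) (auto simp: take_drop add.commute)
      moreover have "map (eval U ((!) w)) (map Var [N * n..<N * n + m]) = drop (N * n) w"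
        using w by (subst map_eval_Var_upt) auto
      ultimately show "P (map (eval U ((!) w)) (map Var [j * n..<j * n + n] @ map Var [N * n..<N * n + m]))
        \<longleftrightarrow> P (take n (drop (j * n) w) @ drop (N * n) w)" by simp
    qed
  qed (use dfn_sub[OF assms] in auto)
  then have "dfn L U A (N * n) (\<lambda>z. \<exists>y\<in>tuples (carr U) m.
      \<forall>j\<in>{..<N}. P (take n (drop (j * n) (z @ y)) @ drop (N * n) (z @ y)) \<longleftrightarrow> t j)"
    by (rule dfn_ex)
  then show ?thesis
  proof (rule dfn_cong_imp)
    fix z assume "z \<in> tuples (carr U) (N * n)"
    then have z: "length z = N * n" by (simp add: tuples_def)
    have "take n (drop (j * n) (z @ y)) @ drop (N * n) (z @ y) = take n (drop (j * n) z) @ y"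
      if "j < N" for j y
      using block_less[OF that, of n] z by simp
    then have "(\<forall>j\<in>{..<N}. P (take n (drop (j * n) (z @ y)) @ drop (N * n) (z @ y)) \<longleftrightarrow> t j) \<longleftrightarrow>
      (\<forall>j<N. P (take n (drop (j * n) z) @ y) \<longleftrightarrow> t j)" for y
      by (metis (no_types, lifting) lessThan_iff)
    then show "(\<exists>y\<in>tuples (carr U) m.
      \<forall>j\<in>{..<N}. P (take n (drop (j * n) (z @ y)) @ drop (N * n) (z @ y)) \<longleftrightarrow> t j) \<longleftrightarrow> pattern U n m P N t z"
      unfolding pattern_def by (simp only:)
  qed
qed

section \<open>Definability over the model from invariance\<close>

context small_submodel
begin

text \<open>If \<open>X\<close> is not definable over \<open>M\<close>, finitely many
  \<open>M\<close>-definable subsets of \<open>X\<close> never cover it, and saturation gives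
  \<open>b\<close> in \<open>X\<close> outside all of them. No \<open>M\<close>-definable set around
  \<open>b\<close> is then contained in \<open>X\<close>, so saturation also gives some
  \<open>b'\<close> outside \<open>X\<close> with the type of \<open>b\<close> over
  \<open>M\<close>.\<close>

lemma invariant_dfn:
  assumes A: "small A" and X: "df A m X"
    and inv: "\<And>b b'. b \<in> tuples UU m \<Longrightarrow> b' \<in> tuples UU m \<Longrightarrow>
      (\<And>Q. df MM m Q \<Longrightarrow> Q b \<longleftrightarrow> Q b') \<Longrightarrow> X b \<Longrightarrow> X b'"
  shows "df MM m X"
proof (rule ccontr)
  assume nX: "\<not> df MM m X"
  have sm: "small (MM \<union> A)" using A small_MM small_Un by blast
  have mono: "df (MM \<union> A) m Q" if "df MM m Q" for Q
    using dfn_mono[OF that _ small_sub[OF sm]] by blast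
  have XA: "df (MM \<union> A) m X" using dfn_mono[OF X _ small_sub[OF sm]] by blast
  \<comment> \<open>The complements of the \<open>M\<close>-definable subsets of
    \<open>X\<close>.\<close>
  define \<C> where "\<C> = {Q. df MM m Q \<and> (\<forall>y\<in>tuples UU m. \<not> Q y \<longrightarrow> X y)}"
  obtain b where b: "b \<in> tuples UU m" "\<And>Q. Q \<in> insert X \<C> \<Longrightarrow> Q b"
  proof (rule saturation[OF sm, of "insert X \<C>" m])
    fix \<F> assume \<F>: "finite \<F>" "\<F> \<subseteq> insert X \<C>"
    define Q where "Q y \<longleftrightarrow> (\<forall>R\<in>\<F> - {X}. R y)" for y
    have Q: "df MM m Q"
      unfolding Q_def using \<F> by (intro dfn_ball MM_sub) (auto simp: \<C>_def)
    \<comment> \<open>If no point of \<open>X\<close> satisfied \<open>Q\<close>, then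
      \<open>X\<close> would be the complement of \<open>Q\<close> and thus definable over
      \<open>M\<close>.\<close>
    have "X y" if "y \<in> tuples UU m" "\<not> Q y" for y
      using that \<F> by (auto simp: Q_def \<C>_def)
    then have "\<exists>y\<in>tuples UU m. X y \<and> Q y"
      using nX dfn_cong[of U m X "\<lambda>y. \<not> Q y" L MM] dfn_not[OF Q] by blast
    then show "\<exists>a\<in>tuples UU m. \<forall>P\<in>\<F>. P a" by (auto simp: Q_def)
  qed (use XA mono in \<open>auto simp: \<C>_def\<close>)
  define \<G> where "\<G> = {Q. df MM m Q \<and> Q b}"
  obtain b' where b'0: "b' \<in> tuples UU m" "\<And>Q. Q \<in> insert (\<lambda>y. \<not> X y) \<G> \<Longrightarrow> Q b'"
  proof (rule saturation[OF sm, of "insert (\<lambda>y. \<not> X y) \<G>" m])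
    fix \<F> assume \<F>: "finite \<F>" "\<F> \<subseteq> insert (\<lambda>y. \<not> X y) \<G>"
    define Q where "Q y \<longleftrightarrow> (\<forall>R\<in>\<F> - {\<lambda>y. \<not> X y}. R y)" for y
    have "df MM m Q"
      unfolding Q_def using \<F> by (intro dfn_ball MM_sub) (auto simp: \<G>_def)
    moreover have "Q b" using \<F> by (auto simp: Q_def \<G>_def)
    ultimately have "(\<lambda>y. \<not> Q y) \<notin> \<C>" "df MM m (\<lambda>y. \<not> Q y)"
      using b(2)[of "\<lambda>y. \<not> Q y"] dfn_not by blast+
    then obtain y where "y \<in> tuples UU m" "Q y" "\<not> X y" by (auto simp: \<C>_def)
    then show "\<exists>a\<in>tuples UU m. \<forall>P\<in>\<F>. P a" by (auto simp: Q_def)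
  qed (use dfn_not[OF XA] mono in \<open>auto simp: \<G>_def\<close>)
  have b': "b' \<in> tuples UU m" "\<not> X b'" "\<And>Q. df MM m Q \<Longrightarrow> Q b \<Longrightarrow> Q b'"
    using b'0(1) b'0(2)[of "\<lambda>y. \<not> X y"] b'0(2) by (auto simp: \<G>_def)
  have "Q b \<longleftrightarrow> Q b'" if "df MM m Q" for Q
    using b'(3)[OF that] b'(3)[OF dfn_not[OF that]] by blast
  then show False using inv[OF b(1) b'(1)] b(2)[of X] b'(2) by simp
qed

end

section \<open>Generically stable types are definable and finitely satisfiable\<close>

context global_type
begin

lemma mor_exists:
  assumes "small A"
  obtains as where "mor A as" "length as = k"
proof -
  obtain a where "mseq A a" using mseq_exists[OF assms] .
  then have "mor A (map a [0..<k])"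
    by (rule mseq_mor[OF _ small_sub[OF assms], of _ _ 0]) auto
  then show thesis by (intro that[of "map a [0..<k]"]) auto
qed

lemma mor_gen: "mor A as \<Longrightarrow> A \<subseteq> UU \<Longrightarrow> a \<in> set as \<Longrightarrow> gen A a"
proof (induction as arbitrary: A)
  case (Cons x as)
  have x: "gen A x" "mor (A \<union> set x) as" using Cons.prems by auto
  have sub: "A \<union> set x \<subseteq> UU" using Cons.prems gen_set[OF x(1)] by auto
  show ?case
    using x Cons.IH[OF x(2) sub] gen_mono[OF _ Un_upper1 sub, of a] Cons.prems by auto
qed simp

lemma mor_filter: "mor A as \<Longrightarrow> A \<subseteq> UU \<Longrightarrow> mor A (filter R as)"
proof (induction as arbitrary: A)
  case (Cons x as)
  have x: "gen A x" "mor (A \<union> set x) as" using Cons.prems by auto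
  have sub: "A \<union> set x \<subseteq> UU" using Cons.prems gen_set[OF x(1)] by auto
  have "mor (A \<union> set x) (filter R as)" using Cons.IH x sub by blast
  moreover from mor_mono[OF this Un_upper1 sub] have "mor A (filter R as)" .
  ultimately show ?case using x by simp
qed simp

lemma mor_length: "mor A as \<Longrightarrow> a \<in> set as \<Longrightarrow> length a = n"
  using mor_tuples by (auto simp: tuples_def)

definition morley_convergent :: bool where
  "morley_convergent \<longleftrightarrow> (\<forall>a P. mseq MM a \<longrightarrow> df UU n P \<longrightarrow> inp P \<longrightarrow> (\<exists>i\<^sub>0. \<forall>i\<ge>i\<^sub>0. P (a i)))"

lemma generically_stable_convergent:
  assumes "generically_stable L U MM n p"
  shows "morley_convergent"
  unfolding morley_convergent_def
proof (intro allI impI)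
  fix a P assume a: "mseq MM a" and P: "df UU n P" "inp P"
  obtain \<phi> where \<phi>: "\<phi> \<in> Form L UU n" "\<And>a. a \<in> tuples UU n \<Longrightarrow> P a \<longleftrightarrow> holds U \<phi> a"
    using P(1) by (auto simp: dfn_def)
  have "\<phi> \<in> p"
    using in_type_holds[OF \<phi>(1) order_refl] in_type_cong[of U n P "holds U \<phi>" p] \<phi>(2) P(2) by blast
  moreover have "Morley_sequence U MM n p a" using Morley_sequence_mseq[OF MM_sub] a by simp
  ultimately obtain i\<^sub>0 where "\<forall>i\<ge>i\<^sub>0. holds U \<phi> (a i)"
    using assms \<phi>(1) unfolding generically_stable_def lim_type_def by blast
  moreover have "a i \<in> tuples UU n" for i using a gen_tuples by (auto simp: mseq_def)
  ultimately show "\<exists>i\<^sub>0. \<forall>i\<ge>i\<^sub>0. P (a i)" using \<phi>(2) by blast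
qed

text \<open>By homogeneity an automorphism over \<open>M\<close> takes \<open>b\<close> to
  \<open>b'\<close>. It carries a formula defining the instance at \<open>b\<close> to one defining
  the instance at \<open>b'\<close>.\<close>

lemma invariant_type_invariant:
  assumes "invariant_type L U MM n p"
  shows "type_invariant"
  unfolding type_invariant_def
proof (intro allI impI)
  fix m P b b'
  assume P: "df MM (m + n) P" and b: "b \<in> tuples UU m" "b' \<in> tuples UU m"
    and same: "\<forall>Q. df MM m Q \<longrightarrow> (Q b \<longleftrightarrow> Q b')"
  obtain \<sigma> where \<sigma>: "automorphism L U \<sigma>" "\<forall>a\<in>MM. \<sigma> a = a" "map \<sigma> b = b'"
    using homogeneity[OF small_MM b] same by blast
  have "df UU n (\<lambda>a. P (b @ a))"
    using dfn_plug_left[OF P b(1) MM_sub order_refl] .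
  then obtain \<psi> where \<psi>: "\<psi> \<in> Form L UU n" "\<And>a. a \<in> tuples UU n \<Longrightarrow> P (b @ a) \<longleftrightarrow> holds U \<psi> a"
    by (auto simp: dfn_def)
  have bij: "bij_betw \<sigma> UU UU" using \<sigma>(1) by (simp add: automorphism_def)
  have \<sigma>\<psi>: "fm_map \<sigma> \<psi> \<in> Form L UU n"
    using \<psi>(1) bij by (auto simp: Form_def bij_betw_def)
  have "P (b' @ a) \<longleftrightarrow> holds U (fm_map \<sigma> \<psi>) a" if a: "a \<in> tuples UU n" for a
  proof -
    define c where "c = map (inv_into UU \<sigma>) a"
    have c: "c \<in> tuples UU n" "map \<sigma> c = a"
      using a bij bij_betw_inv_into_right[OF bij] bij_betwE[OF bij_betw_inv_into[OF bij]]
      by (auto simp: c_def tuples_def map_idI subset_iff)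
    have "P (b' @ a) \<longleftrightarrow> P (map \<sigma> (b @ c))" using c \<sigma>(3) by simp
    also have "\<dots> \<longleftrightarrow> P (b @ c)"
      using df_automorphism[OF \<sigma>(1,2) P] b c by blast
    also have "\<dots> \<longleftrightarrow> holds U (fm_map \<sigma> \<psi>) (map \<sigma> c)"
      using holds_automorphism[OF \<sigma>(1) \<psi>(1) c(1)] \<psi>(2)[OF c(1)] by simp
    finally show ?thesis using c by simp
  qed
  then have "inp (\<lambda>a. P (b' @ a)) \<longleftrightarrow> fm_map \<sigma> \<psi> \<in> p"
    using in_type_cong[of U n "\<lambda>a. P (b' @ a)" "holds U (fm_map \<sigma> \<psi>)" p]
      in_type_holds[OF \<sigma>\<psi> order_refl] by simp
  also have "\<dots> \<longleftrightarrow> \<psi> \<in> p"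
    using assms \<sigma>(1,2) \<psi>(1) unfolding invariant_type_def by blast
  also have "\<dots> \<longleftrightarrow> inp (\<lambda>a. P (b @ a))"
    using in_type_cong[of U n "\<lambda>a. P (b @ a)" "holds U \<psi>" p] \<psi>(2)
      in_type_holds[OF \<psi>(1) order_refl] by simp
  finally show "inp (\<lambda>a. P (b @ a)) \<longleftrightarrow> inp (\<lambda>a. P (b' @ a))" by simp
qed

text \<open>Otherwise, by compactness, some \<open>b\<close> splits a Morley sequence of order type \<open>\<omega> + \<omega>\<close> into its
  halves. Both halves are Morley sequences over \<open>M\<close>, so both converge to \<open>p\<close>.\<close>

lemma step_pattern_bound:
  assumes inv: "type_invariant" and conv: "morley_convergent" and P: "df MM (n + m) P"
  obtains N where "\<And>as. mor MM as \<Longrightarrow> length as = N + N \<Longrightarrow>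
    \<not> pattern U n m P (N + N) (\<lambda>j. N \<le> j) (concat as)"
proof (rule ccontr)
  assume not: "\<not> thesis"
  have ex: "\<exists>as. mor MM as \<and> length as = N + N \<and> pattern U n m P (N + N) (\<lambda>j. N \<le> j) (concat as)" for N
    using not that[of N] by blast
  obtain a where a: "mseq MM a" using mseq_exists[OF small_MM] .
  define B where "B = MM \<union> (\<Union>j\<in>UNIV. set (a j))"
  have B: "small B" unfolding B_def using mseq_set[OF a] by (intro small_Un small_MM small_UN)
  obtain e where e: "mseq B e" using mseq_exists[OF B] .
  define C where "C = B \<union> (\<Union>j\<in>UNIV. set (e j))"
  have C: "small C" unfolding C_def using mseq_set[OF e] by (intro small_Un B small_UN)
  have at: "a j \<in> tuples UU n" "e j \<in> tuples UU n" for j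
    using a e gen_tuples by (auto simp: mseq_def)
  have atC: "a j \<in> tuples C n" "e j \<in> tuples C n" for j
    using at by (auto simp: tuples_def C_def B_def)
  \<comment> \<open>The parameter \<open>b\<close> is to make every term of the first half false and
    every term of the second half true; finite parts of this are the assumed step patterns.\<close>
  define h where "h j = (\<lambda>y. \<not> P (a j @ y) \<and> P (e j @ y))" for j
  obtain b where b: "b \<in> tuples UU m" "\<And>Q. Q \<in> range h \<Longrightarrow> Q b"
  proof (rule saturation[OF C, of "range h" m])
    fix Q assume "Q \<in> range h"
    then obtain j where "Q = (\<lambda>y. \<not> P (a j @ y) \<and> P (e j @ y))" by (auto simp: h_def)
    then show "df C m Q"
      using small_sub[OF C] atC by (auto simp: B_def C_def intro!: dfn_conj dfn_not dfn_plug_left[OF P])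
  next
    fix \<F> assume \<F>: "finite \<F>" "\<F> \<subseteq> range h"
    then obtain I where I: "finite I" "\<F> = h ` I" using finite_subset_image by metis
    then obtain K where K: "I \<subseteq> {..<K}" using finite_nat_iff_bounded by blast
    define ds where "ds = map a [0..<K] @ map e [0..<K]"
    have "mor MM (map a [0..<K])"
      by (rule mseq_mor[OF a MM_sub, of _ 0]) auto
    moreover have "mor (MM \<union> \<Union> (set ` set (map a [0..<K]))) (map e [0..<K])"
      by (rule mseq_mor[OF e small_sub[OF B], of _ 0]) (auto simp: B_def)
    ultimately have ds: "mor MM ds" "length ds = K + K"
      by (simp_all add: ds_def mor_append)
    obtain as where as: "mor MM as" "length as = K + K" "pattern U n m P (K + K) (\<lambda>j. K \<le> j) (concat as)"
      using ex by blast
    \<comment> \<open>Whether the pattern occurs is a condition over \<open>M\<close>, so by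
      invariance it does not depend on the Morley sequence.\<close>
    have "pattern U n m P (K + K) (\<lambda>j. K \<le> j) (concat ds)"
      using mor_same_type[OF inv as(1) ds(1) as(2) ds(2) dfn_pattern[OF P]] as(3) by simp
    then obtain y where y: "y \<in> tuples UU m" "\<And>j. j < K + K \<Longrightarrow> P (ds ! j @ y) \<longleftrightarrow> K \<le> j"
      using pattern_concat[OF mor_length[OF ds(1)] ds(2)] by blast
    have "h j y" if "j < K" for j
    proof -
      have "ds ! j = a j" "ds ! (K + j) = e j" using that by (simp_all add: ds_def nth_append)
      then show ?thesis using y(2)[of j] y(2)[of "K + j"] that by (simp add: h_def)
    qed
    then show "\<exists>y\<in>tuples UU m. \<forall>Q\<in>\<F>. Q y" using I K y(1) by blast
  qed (rule that)
  have hb: "\<not> P (a j @ b)" "P (e j @ b)" for j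
    using b(2)[of "h j"] by (auto simp: h_def)
  have Pb: "df UU n (\<lambda>x. P (x @ b))"
    using dfn_plug_right[OF P b(1) MM_sub order_refl] .
  have "mseq MM e"
    unfolding mseq_def
  proof
    fix i
    have "B \<union> (\<Union>j<i. set (e j)) \<subseteq> UU" using small_sub[OF B] mseq_set[OF e] by blast
    moreover have "MM \<union> (\<Union>j<i. set (e j)) \<subseteq> B \<union> (\<Union>j<i. set (e j))" by (auto simp: B_def)
    moreover have "gen (B \<union> (\<Union>j<i. set (e j))) (e i)" using e by (simp add: mseq_def)
    ultimately show "gen (MM \<union> (\<Union>j<i. set (e j))) (e i)" using gen_mono by blast
  qed
  show False
  proof (cases "inp (\<lambda>x. P (x @ b))")
    case True
    then show False using conv a Pb hb(1) unfolding morley_convergent_def by blast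
  next
    case False
    then have "inp (\<lambda>x. \<not> P (x @ b))" using in_type_not[OF Pb] by simp
    then obtain i\<^sub>0 where "\<forall>i\<ge>i\<^sub>0. \<not> P (e i @ b)"
      using conv \<open>mseq MM e\<close> dfn_not[OF Pb] unfolding morley_convergent_def by blast
    then show False using hb(2) by blast
  qed
qed

text \<open>The exceptions along a Morley sequence again form a Morley sequence. \<open>N\<close> of
  them, continued by \<open>N\<close> terms that are Morley over these and \<open>b\<close>, would
  show the excluded pattern at \<open>b\<close>.\<close>

lemma few_exceptions:
  assumes inv: "type_invariant" and conv: "morley_convergent" and P: "df MM (n + m) P"
  obtains N where "\<And>as b. mor MM as \<Longrightarrow> b \<in> tuples UU m \<Longrightarrow> inp (\<lambda>x. P (x @ b)) \<Longrightarrow>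
    length (filter (\<lambda>a. \<not> P (a @ b)) as) < N"
proof -
  obtain N where N: "\<And>as. mor MM as \<Longrightarrow> length as = N + N \<Longrightarrow>
    \<not> pattern U n m P (N + N) (\<lambda>j. N \<le> j) (concat as)"
    by (rule step_pattern_bound[OF assms]) (rule that)
  have "length (filter (\<lambda>a. \<not> P (a @ b)) as) < N"
    if as: "mor MM as" and b: "b \<in> tuples UU m" and i: "inp (\<lambda>x. P (x @ b))" for as b
  proof (rule ccontr)
    assume many: "\<not> length (filter (\<lambda>a. \<not> P (a @ b)) as) < N"
    define fs where "fs = take N (filter (\<lambda>a. \<not> P (a @ b)) as)"
    have fl: "length fs = N" using many by (simp add: fs_def)
    have ff: "\<not> P (a @ b)" if "a \<in> set fs" for a
      using set_take_subset[of N "filter (\<lambda>a. \<not> P (a @ b)) as"] that by (auto simp: fs_def)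
    have "mor MM (filter (\<lambda>a. \<not> P (a @ b)) as)" using mor_filter[OF as MM_sub] .
    then have fm: "mor MM fs"
      unfolding fs_def by (metis append_take_drop_id mor_append)
    define A where "A = MM \<union> \<Union> (set ` set fs)"
    have A: "small A"
      unfolding A_def using mor_tuples[OF fm] by (intro small_Un small_MM small_finite) (auto simp: tuples_def)
    have Ab: "small (A \<union> set b)" using b by (intro small_Un A small_finite) (auto simp: tuples_def)
    obtain es where es: "mor (A \<union> set b) es" "length es = N" using mor_exists[OF Ab] .
    have ee: "P (x @ b)" if "x \<in> set es" for x
    proof -
      have "df (A \<union> set b) n (\<lambda>x. P (x @ b))"
        using b small_sub[OF Ab] by (intro dfn_plug_right[OF P]) (auto simp: tuples_def A_def)
      then show ?thesis
        using gen_iff[OF mor_gen[OF es(1) small_sub[OF Ab] that], of "\<lambda>x. P (x @ b)"] i by simp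
    qed
    have m: "mor MM (fs @ es)"
      using fm mor_mono[OF es(1) _ small_sub[OF Ab], of A] by (simp add: mor_append A_def)
    have l: "length (fs @ es) = N + N" using fl es(2) by simp
    have "P ((fs @ es) ! j @ b) \<longleftrightarrow> N \<le> j" if "j < N + N" for j
      using that fl es(2) ff[of "fs ! j"] ee[of "es ! (j - N)"] by (auto simp: nth_append)
    then have "pattern U n m P (N + N) (\<lambda>j. N \<le> j) (concat (fs @ es))"
      using pattern_concat[OF mor_length[OF m] l] b by blast
    then show False using N[OF m l] by simp
  qed
  then show thesis by (rule that)
qed

lemma dfn_count:
  assumes "df A (n + m) P" "A \<subseteq> B" "B \<subseteq> UU"
  shows "(\<And>a. a \<in> set as \<Longrightarrow> a \<in> tuples B n) \<Longrightarrow> df B m (\<lambda>b. c \<le> length (filter (\<lambda>a. P (a @ b)) as))"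
proof (induction as arbitrary: c)
  case Nil
  then show ?case using dfn_const[OF assms(3)] by simp
next
  case (Cons a as)
  have a: "df B m (\<lambda>b. P (a @ b))" using dfn_plug_left[OF assms(1) _ assms(2,3)] Cons.prems by simp
  \<comment> \<open>If \<open>P (a @ b)\<close> holds, the tail must supply \<open>c - 1\<close>.
    Truncated subtraction is right at \<open>c = 0\<close>, where nothing is required.\<close>
  have "df B m (\<lambda>b. (P (a @ b) \<and> c - 1 \<le> length (filter (\<lambda>a. P (a @ b)) as)) \<or>
    (\<not> P (a @ b) \<and> c \<le> length (filter (\<lambda>a. P (a @ b)) as)))"
    using Cons by (intro dfn_disj dfn_conj dfn_not a) auto
  then show ?case by (rule dfn_cong_imp) auto
qed

text \<open>On a Morley sequence of length \<open>N + N'\<close>, fewer than \<open>N\<close> terms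
  fail if the instance is in \<open>p\<close>, and fewer than \<open>N'\<close> hold if it is not.
  So the threshold \<open>N'\<close> decides membership, over \<open>M\<close> and the sequence;
  invariance removes the sequence from the parameters.\<close>

lemma convergent_definable:
  assumes inv: "type_invariant" and conv: "morley_convergent"
  shows "definable"
  unfolding definable_def
proof (intro allI impI)
  fix m P0 assume P0: "df MM (m + n) P0"
  define P where "P z = P0 (drop n z @ take n z)" for z
  have P: "df MM (n + m) P" unfolding P_def using P0 by (rule dfn_swap)
  obtain N where N: "\<And>as b. mor MM as \<Longrightarrow> b \<in> tuples UU m \<Longrightarrow> inp (\<lambda>x. P (x @ b)) \<Longrightarrow>
    length (filter (\<lambda>a. \<not> P (a @ b)) as) < N"
    by (rule few_exceptions[OF inv conv P]) (rule that)
  obtain N' where N': "\<And>as b. mor MM as \<Longrightarrow> b \<in> tuples UU m \<Longrightarrow> inp (\<lambda>x. \<not> P (x @ b)) \<Longrightarrow>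
    length (filter (\<lambda>a. \<not> \<not> P (a @ b)) as) < N'"
    by (rule few_exceptions[OF inv conv dfn_not[OF P]]) (rule that)
  obtain as where as: "mor MM as" "length as = N + N'" using mor_exists[OF small_MM] .
  define B where "B = MM \<union> \<Union> (set ` set as)"
  have B: "small B"
    unfolding B_def using mor_tuples[OF as(1)] by (intro small_Un small_MM small_finite) (auto simp: tuples_def)
  have asB: "a \<in> tuples B n" if "a \<in> set as" for a
    using mor_length[OF as(1) that] that by (auto simp: tuples_def B_def)
  have eq: "inp (\<lambda>x. P (x @ b)) \<longleftrightarrow> N' \<le> length (filter (\<lambda>a. P (a @ b)) as)" if b: "b \<in> tuples UU m" for b
  proof
    assume "inp (\<lambda>x. P (x @ b))"
    then show "N' \<le> length (filter (\<lambda>a. P (a @ b)) as)"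
      using N[OF as(1) b] sum_length_filter_compl[of "\<lambda>a. P (a @ b)" as] as(2) by linarith
  next
    assume *: "N' \<le> length (filter (\<lambda>a. P (a @ b)) as)"
    have "df UU n (\<lambda>x. P (x @ b))"
      using dfn_plug_right[OF P b MM_sub order_refl] .
    then show "inp (\<lambda>x. P (x @ b))"
      using N'[OF as(1) b] * in_type_not[of "\<lambda>x. P (x @ b)"] by auto
  qed
  have PP: "inp (\<lambda>x. P (x @ b)) \<longleftrightarrow> inp (\<lambda>a. P0 (b @ a))" if b: "b \<in> tuples UU m" for b
    by (rule in_type_cong) (use b in \<open>auto simp: P_def tuples_def\<close>)
  have "df MM m (\<lambda>b. inp (\<lambda>x. P (x @ b)))"
  proof (rule invariant_dfn[OF B])
    have "df B m (\<lambda>b. N' \<le> length (filter (\<lambda>a. P (a @ b)) as))"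
      using small_sub[OF B] asB by (intro dfn_count[OF P]) (auto simp: B_def)
    then show "df B m (\<lambda>b. inp (\<lambda>x. P (x @ b)))" by (rule dfn_cong_imp) (simp add: eq)
  next
    fix b b' assume "b \<in> tuples UU m" "b' \<in> tuples UU m"
      "\<And>Q. df MM m Q \<Longrightarrow> Q b \<longleftrightarrow> Q b'" "inp (\<lambda>x. P (x @ b))"
    then show "inp (\<lambda>x. P (x @ b'))"
      using inv[unfolded type_invariant_def, rule_format, OF P0, of b b'] PP by simp
  qed
  then show "df MM m (\<lambda>b. inp (\<lambda>a. P0 (b @ a)))" by (rule dfn_cong_imp) (rule PP)
qed

text \<open>Among \<open>N\<close> Morley terms some term satisfies \<open>Q\<close> for every
  \<open>y\<close> whose instance is in \<open>p\<close>. As \<open>p\<close> is definable this is a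
  condition over \<open>M\<close> on the terms, so it also holds for \<open>N\<close> tuples of
  \<open>M\<close>, one of which works for \<open>b\<close>.\<close>

lemma convergent_finitely_satisfiable:
  assumes inv: "type_invariant" and conv: "morley_convergent"
  shows "finitely_satisfiable"
  unfolding finitely_satisfiable_def
proof (intro allI impI)
  fix P assume P: "df UU n P" "inp P"
  obtain m b Q where b: "b \<in> tuples UU m" and Q: "df {} (n + m) Q"
    "\<And>a. a \<in> tuples UU n \<Longrightarrow> P a \<longleftrightarrow> Q (a @ b)"
    by (rule dfn_params[OF P(1)]) (rule that)
  have QM: "df MM (n + m) Q" using dfn_mono[OF Q(1) empty_subsetI MM_sub] .
  define D where "D y \<longleftrightarrow> inp (\<lambda>a. Q (a @ y))" for y
  have D: "df MM m D"
    unfolding D_def using definable_over'[OF convergent_definable[OF inv conv] order_refl QM] .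
  \<comment> \<open>That all values of \<open>R\<close> are false says that the instance at
    \<open>y\<close> is in \<open>p\<close> although \<open>Q\<close> fails at every term.\<close>
  define R where "R w \<longleftrightarrow> Q w \<or> \<not> D (drop n w)" for w
  have R: "df MM (n + m) R"
    unfolding R_def by (intro dfn_disj dfn_not QM dfn_drop D)
  obtain N where N: "\<And>as b. mor MM as \<Longrightarrow> b \<in> tuples UU m \<Longrightarrow> inp (\<lambda>x. Q (x @ b)) \<Longrightarrow>
    length (filter (\<lambda>a. \<not> Q (a @ b)) as) < N"
    by (rule few_exceptions[OF inv conv QM]) (rule that)
  obtain as where as: "mor MM as" "length as = N" using mor_exists[OF small_MM] .
  have Db: "D b"
    unfolding D_def using P(2) by (rule in_type_mono) (use Q(2) in blast)
  have R_as: "R (a @ y) \<longleftrightarrow> Q (a @ y) \<or> \<not> D y" if "length a = n" for a y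
    unfolding R_def using that by simp
  have "\<not> pattern U n m R N (\<lambda>_. False) (concat as)"
  proof
    assume "pattern U n m R N (\<lambda>_. False) (concat as)"
    then have "\<exists>y\<in>tuples UU m. \<forall>j<N. R (as ! j @ y) \<longleftrightarrow> False"
      using pattern_concat[OF mor_length[OF as(1)] as(2), of U m R "\<lambda>_. False"] by simp
    then obtain y where y: "y \<in> tuples UU m" "\<And>j. j < N \<Longrightarrow> \<not> R (as ! j @ y)"
      by auto
    have QD: "\<not> Q (as ! j @ y) \<and> D y" if "j < N" for j
      using y(2)[OF that] R_as[of "as ! j" y] mor_length[OF as(1), of "as ! j"] as(2) that by simp
    \<comment> \<open>For \<open>N = 0\<close> the pattern would be vacuous and would not yield
      \<open>D y\<close>; the strict bound at \<open>b\<close> excludes this.\<close>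
    have "0 < N" using N[OF as(1) b] Db unfolding D_def by linarith
    then have "D y" using QD by blast
    moreover have "filter (\<lambda>a. \<not> Q (a @ y)) as = as"
      unfolding filter_id_conv using QD as(2) by (metis in_set_conv_nth)
    ultimately show False using N[OF as(1) y(1)] as(2) by (simp add: D_def)
  qed
  then obtain z where z: "z \<in> tuples MM (N * n)" "\<not> pattern U n m R N (\<lambda>_. False) z"
    by (rule tarski_vaught[OF dfn_not[OF dfn_pattern[OF R]], rotated]) (use mor_concat[OF as(1)] as(2) in auto)
  then obtain j where j: "j < N" "R (take n (drop (j * n) z) @ b)"
    using b by (auto simp: pattern_def)
  define c where "c = take n (drop (j * n) z)"
  have c: "c \<in> tuples MM n"
    using z(1) block_less[OF j(1), of n] set_take_subset[of n "drop (j * n) z"] set_drop_subset[of "j * n" z]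
    by (auto simp: tuples_def c_def)
  then have "Q (c @ b)" using j(2) R_as[of c b] Db by (simp add: c_def tuples_def)
  then show "\<exists>c\<in>tuples MM n. P c"
    using Q(2)[OF tuples_mono[OF c MM_sub]] c by blast
qed

end

section \<open>From generically stable extensions to eventual stability\<close>

context small_submodel
begin

text \<open>Gives a sequence in \<open>M\<close> an invariant, convergent limit. The extension
  agrees with the ultralimit on predicates over \<open>M\<close> only, which is why later arguments
  first make their conditions definable over \<open>M\<close>.\<close>

lemma limit_type:
  assumes stable: "\<And>n p. p \<in> ctypes L U MM n \<Longrightarrow>
      \<exists>p'\<in>ctypes L U UU n. p \<subseteq> p' \<and> generically_stable L U MM n p'"
    and D: "ultra D" and c: "\<And>i. c i \<in> tuples MM n"
  obtains p where "global_type L T U M \<kappa> n p"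
    "global_type.type_invariant L U M n p" "global_type.morley_convergent L U M n p"
    "\<And>P. df MM n P \<Longrightarrow> in_type U n p P \<longleftrightarrow> eventually (\<lambda>i. P (c i)) D"
proof -
  have cU: "c i \<in> tuples UU n" for i using c MM_sub by (rule tuples_mono)
  define q where "q = {\<phi>\<in>Form L MM n. eventually (\<lambda>i. holds U \<phi> (c i)) D}"
  have q: "q \<in> ctypes L U MM n"
    unfolding q_def by (rule ctypes_ultra[OF D]) (use cU in auto)
  then obtain p where p: "p \<in> ctypes L U UU n" "q \<subseteq> p" "generically_stable L U MM n p"
    using stable by blast
  interpret q: complete_type L U MM n q by unfold_locales (rule q)
  interpret p: global_type L T U M \<kappa> n p by unfold_locales (rule p)
  have "in_type U n p P \<longleftrightarrow> eventually (\<lambda>i. P (c i)) D" if P: "df MM n P" for P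
  proof -
    obtain \<phi> where \<phi>: "\<phi> \<in> Form L MM n" "\<And>a. a \<in> tuples UU n \<Longrightarrow> P a \<longleftrightarrow> holds U \<phi> a"
      using P by (auto simp: dfn_def)
    have "in_type U n p P \<longleftrightarrow> in_type U n q P"
      using q.in_type_restrict[OF MM_sub order_refl p(1,2) P] by simp
    also have "\<dots> \<longleftrightarrow> in_type U n q (holds U \<phi>)" by (rule in_type_cong) (rule \<phi>(2))
    also have "\<dots> \<longleftrightarrow> \<phi> \<in> q" by (rule q.in_type_holds[OF \<phi>(1) MM_sub])
    also have "\<dots> \<longleftrightarrow> eventually (\<lambda>i. P (c i)) D" using \<phi> cU by (simp add: q_def)
    finally show ?thesis .
  qed
  then show thesis
    using p.global_type_axioms p.invariant_type_invariant p.generically_stable_convergent p(3)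
    by (intro that[of p]) (auto simp: generically_stable_def)
qed

text \<open>For fixed \<open>j\<close> the formula fails at \<open>a i\<close> for large
  \<open>i\<close>; for fixed \<open>i\<close> it holds at \<open>b j\<close> for large
  \<open>j\<close>. So with \<open>y\<close> realizing \<open>q\<close> over \<open>M\<close>, both
  \<open>Dq x\<close> and failure at \<open>(x, y)\<close> belong to \<open>p\<close>. A solution
  \<open>c\<close> in \<open>M\<close> is contradictory: \<open>Dq c\<close> forces truth at
  \<open>(c, y)\<close>.\<close>

lemma stable_no_order:
  assumes stable: "\<And>n p. p \<in> ctypes L U MM n \<Longrightarrow>
      \<exists>p'\<in>ctypes L U UU n. p \<subseteq> p' \<and> generically_stable L U MM n p'"
  shows "no_order L M"
  unfolding no_order_def
proof
  assume "\<exists>n m. \<exists>\<phi>\<in>Form L {} (n + m). \<exists>a b :: nat \<Rightarrow> 'u list.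
     (\<forall>i. a i \<in> tuples MM n \<and> b i \<in> tuples MM m) \<and> (\<forall>i j. holds M \<phi> (a i @ b j) \<longleftrightarrow> i \<le> j)"
  then obtain n m \<phi> and a b :: "nat \<Rightarrow> 'u list" where \<phi>: "\<phi> \<in> Form L {} (n + m)"
    and H: "(\<forall>i. a i \<in> tuples MM n \<and> b i \<in> tuples MM m) \<and> (\<forall>i j. holds M \<phi> (a i @ b j) \<longleftrightarrow> i \<le> j)"
    by (elim exE bexE) (rule that)
  have ab: "a i \<in> tuples MM n" "b i \<in> tuples MM m" for i using H by auto
  have ord: "holds M \<phi> (a i @ b j) \<longleftrightarrow> i \<le> j" for i j using H by auto
  define P where "P = holds U \<phi>"
  have ordP: "P (a i @ b j) \<longleftrightarrow> i \<le> j" for i j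
    using ord elem_holds[OF \<phi> append_tuples[OF ab]] by (simp add: P_def)
  have "df MM (n + m) P"
    unfolding P_def using dfn_holds[OF Form_mono[OF \<phi>] MM_sub] by blast
  note P = this
  obtain D :: "nat filter" where D: "ultra D" "D \<le> sequentially"
    by (rule ultra_exists[OF trivial_limit_sequentially]) (rule that)
  obtain p where p: "global_type L T U M \<kappa> n p"
    "global_type.type_invariant L U M n p" "global_type.morley_convergent L U M n p"
    "\<And>P. df MM n P \<Longrightarrow> in_type U n p P \<longleftrightarrow> eventually (\<lambda>i. P (a i)) D"
    by (rule limit_type[OF stable D(1) ab(1)]) (assumption, rule that)
  obtain q where q: "global_type L T U M \<kappa> m q"
    "global_type.type_invariant L U M m q" "global_type.morley_convergent L U M m q"
    "\<And>P. df MM m P \<Longrightarrow> in_type U m q P \<longleftrightarrow> eventually (\<lambda>i. P (b i)) D"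
    by (rule limit_type[OF stable D(1) ab(2)]) (assumption, rule that)
  interpret p: global_type L T U M \<kappa> n p by (rule p)
  interpret q: global_type L T U M \<kappa> m q by (rule q)
  note p_def = p.convergent_definable[OF p(2,3)]
  note q_def = q.convergent_definable[OF q(2,3)]
  define Dq where "Dq x \<longleftrightarrow> in_type U m q (\<lambda>y. P (x @ y))" for x
  define Dp where "Dp y \<longleftrightarrow> in_type U n p (\<lambda>x. P (x @ y))" for y
  have Dq: "df MM n Dq" unfolding Dq_def by (rule q.definable_over[OF q_def order_refl P])
  have Dp: "df MM m Dp" unfolding Dp_def by (rule p.definable_over'[OF p_def order_refl P])
  have "\<not> Dp (b j)" for j
  proof -
    have "eventually (\<lambda>i. \<not> P (a i @ b j)) D"
      using filter_leD[OF D(2) eventually_gt_at_top[of j]] by (rule eventually_mono) (simp add: ordP)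
    moreover have "df MM n (\<lambda>x. P (x @ b j))" by (rule dfn_plug_right[OF P ab(2) order_refl MM_sub])
    ultimately show ?thesis using p(4) D(1) by (simp add: Dp_def ultra_not)
  qed
  then have nDp: "in_type U m q (\<lambda>y. \<not> Dp y)"
    using q(4)[OF dfn_not[OF Dp]] by simp
  have "Dq (a i)" for i
  proof -
    have "eventually (\<lambda>j. P (a i @ b j)) D"
      using filter_leD[OF D(2) eventually_ge_at_top[of i]] by (rule eventually_mono) (simp add: ordP)
    moreover have "df MM m (\<lambda>y. P (a i @ y))" by (rule dfn_plug_left[OF P ab(1) order_refl MM_sub])
    ultimately show ?thesis using q(4) by (simp add: Dq_def)
  qed
  then have iDq: "in_type U n p Dq" using p(4)[OF Dq] by simp
  obtain y where y: "q.gen MM y" using q.gen_exists[OF small_MM] .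
  have yU: "y \<in> tuples UU m" using q.gen_tuples[OF y] .
  have "\<not> Dp y" using q.gen_iff[OF y dfn_not[OF Dp]] nDp by simp
  moreover have Py: "df UU n (\<lambda>x. P (x @ y))" by (rule dfn_plug_right[OF P yU MM_sub order_refl])
  ultimately have "in_type U n p (\<lambda>x. \<not> P (x @ y))" using p.in_type_not by (simp add: Dp_def)
  then have "in_type U n p (\<lambda>x. Dq x \<and> \<not> P (x @ y))" using p.in_type_conj iDq by simp
  moreover have "df UU n (\<lambda>x. Dq x \<and> \<not> P (x @ y))"
    by (intro dfn_conj dfn_not Py p.dfU[OF Dq])
  ultimately obtain c where c: "c \<in> tuples MM n" "Dq c" "\<not> P (c @ y)"
    using p.convergent_finitely_satisfiable[OF p(2,3)] unfolding p.finitely_satisfiable_def by blast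
  have "df MM m (\<lambda>y. P (c @ y))" by (rule dfn_plug_left[OF P c(1) order_refl MM_sub])
  then show False using q.gen_iff[OF y, of "\<lambda>y. P (c @ y)"] c(2,3) by (simp add: Dq_def)
qed

text \<open>Parameters of the formula are added to the variables \<open>y\<close>: a pattern
  inconsistent for all values of them is inconsistent for the given ones.\<close>

lemma stable_eventually_NIP:
  assumes stable: "\<And>n p. p \<in> ctypes L U MM n \<Longrightarrow>
      \<exists>p'\<in>ctypes L U UU n. p \<subseteq> p' \<and> generically_stable L U MM n p'"
  shows "eventually_NIP L U M"
  unfolding eventually_NIP_def eventually_NIP_formula_def
proof (intro allI ballI impI)
  fix n m \<phi> and c :: "nat \<Rightarrow> 'u list"
  assume \<phi>: "\<phi> \<in> Form L UU (n + m)" and c: "\<forall>i. c i \<in> tuples MM n"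
  obtain l b Q where b: "b \<in> tuples UU l" and Q0: "df {} (n + m + l) Q"
    and Q: "\<And>a. a \<in> tuples UU (n + m) \<Longrightarrow> holds U \<phi> a \<longleftrightarrow> Q (a @ b)"
    by (rule dfn_params[OF dfn_holds[OF \<phi> order_refl]]) (rule that)
  have QM: "df MM (n + (m + l)) Q"
    using dfn_mono[OF Q0 empty_subsetI MM_sub] by (simp add: add.assoc)
  have cU: "c i \<in> tuples UU n" for i using c MM_sub tuples_mono by blast
  obtain D :: "nat filter" where D: "ultra D" "D \<le> sequentially"
    by (rule ultra_exists[OF trivial_limit_sequentially]) (rule that)
  obtain p where p: "global_type L T U M \<kappa> n p"
    "global_type.type_invariant L U M n p" "global_type.morley_convergent L U M n p"
    "\<And>P. df MM n P \<Longrightarrow> in_type U n p P \<longleftrightarrow> eventually (\<lambda>i. P (c i)) D"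
    by (rule limit_type[OF stable D(1) c[rule_format]]) (assumption, rule that)
  interpret p: global_type L T U M \<kappa> n p by (rule p)
  note p_def = p.convergent_definable[OF p(2,3)]
  obtain N where N: "\<And>as. p.mor MM as \<Longrightarrow> length as = N + N \<Longrightarrow>
    \<not> pattern U n (m + l) Q (N + N) (\<lambda>j. N \<le> j) (concat as)"
    by (rule p.step_pattern_bound[OF p(2,3) QM]) (rule that)
  define R where "R z \<longleftrightarrow> \<not> pattern U n (m + l) Q (N + N) (\<lambda>j. N \<le> j) z" for z
  have R: "df MM ((N + N) * n) R" unfolding R_def by (intro dfn_not dfn_pattern QM)
  obtain as where as: "p.mor MM as" "length as = N + N" using p.mor_exists[OF small_MM] .
  have iR: "p.iter (N + N) R"
    using p.iter_mor[OF p_def order_refl as(1), of R] R as(2) N[OF as] by (simp add: R_def)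
  have iT: "p.iter k (\<lambda>_. True)" for k
    by (induction k) (auto intro: p.in_type_True)
  \<comment> \<open>Reflection takes one property for each length; here only length
    \<open>N + N\<close> carries a condition.\<close>
  define \<Theta> where "\<Theta> k = (if k = N + N then R else (\<lambda>_. True))" for k
  \<comment> \<open>Makes the reflected indices increase, so that they form a subsequence of
    \<open>c\<close>. The ultrafilter refines \<open>sequentially\<close>, so large indices are
    always available.\<close>
  define adm where "adm h i \<longleftrightarrow> (\<forall>j\<in>set h. j < i)" for h :: "nat list" and i :: nat
  obtain f where f: "\<And>k. adm (map f [0..<k]) (f k)"
    "\<And>js. sorted_wrt (<) js \<Longrightarrow> (\<And>j. j \<in> set js \<Longrightarrow> length js \<le> j) \<Longrightarrow>
       \<Theta> (length js) (concat (map (\<lambda>j. c (f j)) js))"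
  proof (rule p.reflect_sequence[OF p_def, of c \<Theta> adm])
    show "df MM (k * n) (\<Theta> k)" for k
      using R by (auto simp: \<Theta>_def dfn_const MM_sub)
    show "p.iter k (\<Theta> k)" for k
      using iR iT by (auto simp: \<Theta>_def)
    fix h P assume "df MM n P" "in_type U n p P"
    then have "eventually (\<lambda>i. P (c i)) D" using p(4) by simp
    moreover have "eventually (\<lambda>i. adm h i) D"
      unfolding adm_def by (intro eventually_ball_finite ballI filter_leD[OF D(2) eventually_gt_at_top]) simp
    ultimately have "eventually (\<lambda>i. adm h i \<and> P (c i)) D" by (simp add: eventually_conj)
    then show "\<exists>i. adm h i \<and> P (c i)" by (rule ultra_ex[OF D(1)])
  qed (use c in auto)
  have mono: "strict_mono f" using f(1) by (auto simp: strict_mono_def adm_def)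
  \<comment> \<open>Reflection applies to indices no smaller than the number of terms, hence the
    shift by \<open>N + N\<close>.\<close>
  define r where "r k = f (k + (N + N))" for k
  have r: "strict_mono r" using mono by (simp add: strict_mono_def r_def)
  have none: "\<not> (\<exists>y\<in>tuples UU m. (\<forall>j\<in>{N + 1..N + N}. holds U \<phi> (c (r (s j)) @ y)) \<and>
      (\<forall>j\<in>{1..N + N} - {N + 1..N + N}. \<not> holds U \<phi> (c (r (s j)) @ y)))"
    if s: "strict_mono_on {1..N + N} s" for s :: "nat \<Rightarrow> nat"
  proof
    assume "\<exists>y\<in>tuples UU m. (\<forall>j\<in>{N + 1..N + N}. holds U \<phi> (c (r (s j)) @ y)) \<and>
      (\<forall>j\<in>{1..N + N} - {N + 1..N + N}. \<not> holds U \<phi> (c (r (s j)) @ y))"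
    then obtain y where y: "y \<in> tuples UU m" "\<And>j. j \<in> {N + 1..N + N} \<Longrightarrow> holds U \<phi> (c (r (s j)) @ y)"
      "\<And>j. j \<in> {1..N + N} - {N + 1..N + N} \<Longrightarrow> \<not> holds U \<phi> (c (r (s j)) @ y)" by blast
    \<comment> \<open>Positions are counted from 1 in eventual NIP and from 0 in lists; the true
      half of the pattern becomes \<open>{N + 1..N + N}\<close>.\<close>
    define js where "js = map (\<lambda>j. s (Suc j) + (N + N)) [0..<N + N]"
    have lj: "length js = N + N" by (simp add: js_def)
    have "sorted_wrt (<) js"
      using s by (auto simp: js_def sorted_wrt_iff_nth_less strict_mono_on_def)
    then have "\<Theta> (length js) (concat (map (\<lambda>j. c (f j)) js))"
      by (rule f(2)) (auto simp: js_def)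
    then have "\<not> pattern U n (m + l) Q (N + N) (\<lambda>j. N \<le> j) (concat (map (\<lambda>j. c (f j)) js))"
      by (simp add: lj \<Theta>_def R_def)
    moreover have "length x = n" if "x \<in> set (map (\<lambda>j. c (f j)) js)" for x
      using that cU by (auto simp: tuples_def)
    ultimately have "\<not> (\<exists>y\<in>tuples UU (m + l). \<forall>j<N + N. Q (map (\<lambda>j. c (f j)) js ! j @ y) \<longleftrightarrow> N \<le> j)"
      using pattern_concat[of "map (\<lambda>j. c (f j)) js" n "N + N" U "m + l" Q] lj by simp
    moreover have "Q (map (\<lambda>j. c (f j)) js ! j @ (y @ b)) \<longleftrightarrow> N \<le> j" if j: "j < N + N" for j
    proof -
      have "map (\<lambda>j. c (f j)) js ! j = c (r (s (Suc j)))"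
        using j by (simp add: js_def r_def)
      moreover have "Q ((c (r (s (Suc j))) @ y) @ b) \<longleftrightarrow> holds U \<phi> (c (r (s (Suc j))) @ y)"
        using Q[OF append_tuples[OF cU y(1)]] by simp
      ultimately show ?thesis using y(2)[of "Suc j"] y(3)[of "Suc j"] j by (cases "N \<le> j") auto
    qed
    ultimately show False using append_tuples[OF y(1) b] by blast
  qed
  show "\<exists>r :: nat \<Rightarrow> nat. strict_mono r \<and> (\<exists>N. \<exists>E\<subseteq>{1..N}. \<forall>s :: nat \<Rightarrow> nat. strict_mono_on {1..N} s \<longrightarrow>
      \<not> (\<exists>y\<in>tuples UU m. (\<forall>j\<in>E. holds U \<phi> (c (r (s j)) @ y)) \<and>
        (\<forall>j\<in>{1..N} - E. \<not> holds U \<phi> (c (r (s j)) @ y))))"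
    by (rule exI[of _ r], rule conjI[OF r], rule exI[of _ "N + N"], rule exI[of _ "{N + 1..N + N}"],
      intro conjI allI impI, simp, rule none)
qed

end

section \<open>Coheirs over models without order\<close>

text \<open>Ramsey's theorem colours unordered pairs, so the relation is read from the minimum to
  the maximum of each pair.\<close>

lemma infinite_increasing_homogeneous:
  fixes R :: "nat \<Rightarrow> nat \<Rightarrow> bool"
  obtains g :: "nat \<Rightarrow> nat" and v where "strict_mono g" "\<And>i j. i < j \<Longrightarrow> R (g i) (g j) \<longleftrightarrow> v"
proof -
  define F :: "nat set \<Rightarrow> nat" where "F S = (if R (Min S) (Max S) then 1 else 0)" for S
  have "\<forall>x\<in>UNIV. \<forall>y\<in>UNIV. x \<noteq> y \<longrightarrow> F {x, y} < 2" by (simp add: F_def)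
  from Ramsey2[OF infinite_UNIV_nat this] obtain Y t where
    Y: "infinite Y" "\<forall>x\<in>Y. \<forall>y\<in>Y. x \<noteq> y \<longrightarrow> F {x, y} = t" by (elim exE conjE) (rule that)
  have mono: "strict_mono (enumerate Y)" using strict_mono_enumerate[OF Y(1)] .
  have "R (enumerate Y i) (enumerate Y j) \<longleftrightarrow> t = 1" if "i < j" for i j
  proof -
    have lt: "enumerate Y i < enumerate Y j" using mono that by (simp add: strict_mono_less)
    then have "F {enumerate Y i, enumerate Y j} = t"
      using Y(2) enumerate_in_set[OF Y(1)] by simp
    then show ?thesis using lt by (auto simp: F_def split: if_splits)
  qed
  then show thesis using mono by (intro that[of "enumerate Y" "t = 1"]) auto
qed

context small_submodel
begin

lemma no_order_df:
  assumes "no_order L M" "df {} (n + m) P" "\<And>i. a i \<in> tuples MM n" "\<And>i :: nat. b i \<in> tuples MM m"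
    and ord: "\<And>i j. P (a i @ b j) \<longleftrightarrow> i \<le> j"
  shows False
proof -
  obtain \<phi> where \<phi>: "\<phi> \<in> Form L {} (n + m)" "\<And>a. a \<in> tuples UU (n + m) \<Longrightarrow> P a \<longleftrightarrow> holds U \<phi> a"
    using assms(2) by (auto simp: dfn_def)
  have "holds M \<phi> (a i @ b j) \<longleftrightarrow> i \<le> j" for i j
  proof -
    have ab: "a i @ b j \<in> tuples MM (n + m)" using assms(3,4) by blast
    show ?thesis
      using elem_holds[OF \<phi>(1) ab] \<phi>(2)[OF tuples_mono[OF ab MM_sub]] ord[of i j] by simp
  qed
  then have "\<exists>n m. \<exists>\<phi>\<in>Form L {} (n + m). \<exists>a b :: nat \<Rightarrow> 'u list.
     (\<forall>i. a i \<in> tuples MM n \<and> b i \<in> tuples MM m) \<and> (\<forall>i j. holds M \<phi> (a i @ b j) \<longleftrightarrow> i \<le> j)"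
    using assms(3,4)
    by (intro exI[of _ n] exI[of _ m] bexI[OF _ \<phi>(1)] exI[of _ a] exI[of _ b]) auto
  then show False using assms(1) by (simp add: no_order_def)
qed

text \<open>By Tarski-Vaught, every finite part of \<open>p\<close> has a solution in
  \<open>M\<close>. An ultrafilter containing \<open>p\<close> can thus be concentrated on tuples of
  \<open>M\<close>, and then so is every formula of its limit type.\<close>

lemma coheir_exists:
  assumes p: "p \<in> ctypes L U MM n"
  obtains p' where "global_type L T U M \<kappa> n p'" "p \<subseteq> p'"
    "global_type.finitely_satisfiable L U M n p'"
proof -
  interpret p: complete_type L U MM n p by unfold_locales (rule p)
  let ?T = "\<lambda>a. a \<in> tuples MM n"
  have fip: "\<exists>x. \<forall>P\<in>\<F>. P x" if \<F>: "finite \<F>" "\<F> \<subseteq> insert ?T (holds U ` p)" for \<F>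
  proof -
    have "finite (\<F> - {?T})" "\<F> - {?T} \<subseteq> holds U ` p" using \<F> by auto
    from finite_subset_image[OF this] obtain F where
      F: "F \<subseteq> p" "finite F" "\<F> - {?T} = holds U ` F" by auto
    obtain a where a: "a \<in> tuples UU n" "\<forall>\<phi>\<in>F. holds U \<phi> a"
      using p.fin_sat[OF F(2,1)] by auto
    have dF: "df MM n (\<lambda>a. \<forall>\<phi>\<in>F. holds U \<phi> a)"
      using F p.in_Form by (intro dfn_ball MM_sub dfn_holds) auto
    obtain c where c: "c \<in> tuples MM n" "\<forall>\<phi>\<in>F. holds U \<phi> c"
      using tarski_vaught[OF dF a] by blast
    have "P c" if "P \<in> \<F>" for P
    proof (cases "P = ?T")
      case False
      then have "P \<in> holds U ` F" using that F(3) by blast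
      then show ?thesis using c(2) by blast
    qed (use c(1) in simp)
    then show ?thesis by blast
  qed
  obtain D where D: "ultra D" "\<And>P. P \<in> insert ?T (holds U ` p) \<Longrightarrow> eventually P D"
    by (rule ultra_fip[OF fip]) (assumption+, rule that)
  have DM: "eventually ?T D" using D(2) by blast
  define p' where "p' = {\<phi>\<in>Form L UU n. eventually (\<lambda>a. holds U \<phi> a) D}"
  have "p' \<in> ctypes L U UU n"
    unfolding p'_def using MM_sub tuples_mono
    by (intro ctypes_ultra[OF D(1)] eventually_mono[OF DM]) blast
  then interpret p': global_type L T U M \<kappa> n p' by unfold_locales
  have "p \<subseteq> p'"
    using p.in_Form Form_mono[OF _ MM_sub] D(2) by (fastforce simp: p'_def)
  moreover have "p'.finitely_satisfiable"
    unfolding p'.finitely_satisfiable_def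
  proof (intro allI impI)
    fix P assume "in_type U n p' P"
    then obtain \<phi> where \<phi>: "\<phi> \<in> p'" "\<forall>a\<in>tuples UU n. holds U \<phi> a \<longrightarrow> P a"
      by (auto simp: in_type_def)
    have "eventually (\<lambda>a. a \<in> tuples MM n \<and> holds U \<phi> a) D"
      using \<phi>(1) DM by (intro eventually_conj) (auto simp: p'_def)
    then obtain c where "c \<in> tuples MM n" "holds U \<phi> c" using ultra_ex[OF D(1)] by blast
    then show "\<exists>c\<in>tuples MM n. P c" using \<phi>(2) tuples_mono[OF _ MM_sub] by blast
  qed
  ultimately show thesis using p'.global_type_axioms by (intro that[of p']) auto
qed

end

section \<open>Definability and generic stability of coheirs\<close>

context global_type
begin

lemma df_instance:
  "df A (n + m) P \<Longrightarrow> b \<in> tuples UU m \<Longrightarrow> df UU n (\<lambda>a. P (a @ b))"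
  using dfn_plug_right[of L U A n m P b UU] dfn_sub by blast

lemma finitely_satisfiableD:
  "finitely_satisfiable \<Longrightarrow> df UU n P \<Longrightarrow> inp P \<Longrightarrow> \<exists>c\<in>tuples MM n. P c"
  unfolding finitely_satisfiable_def by blast

text \<open>If no finite \<open>C\<close> suffices, choose pairs \<open>b k\<close>,
  \<open>b' k\<close> that agree on all earlier \<open>a i\<close> although only \<open>b k\<close>
  has its instance in the type, and then, by finite satisfiability, \<open>a k\<close> separating
  all pairs so far. Ramsey makes the values at pairs with \<open>i < j\<close> constant, and either
  constant yields an order.\<close>

lemma type_decided_by_instances:
  assumes fs: "finitely_satisfiable" and no: "no_order L M" and P: "df {} (n + m) P"
  obtains C where "finite C" "C \<subseteq> tuples MM n"
    "\<And>b b'. b \<in> tuples MM m \<Longrightarrow> b' \<in> tuples MM m \<Longrightarrow> (\<And>c. c \<in> C \<Longrightarrow> P (c @ b) \<longleftrightarrow> P (c @ b')) \<Longrightarrow>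
      inp (\<lambda>a. P (a @ b)) \<Longrightarrow> inp (\<lambda>a. P (a @ b'))"
proof (rule ccontr)
  assume not: "\<not> thesis"
  note witness = that
  define X where "X b \<longleftrightarrow> inp (\<lambda>a. P (a @ b))" for b
  have split: "\<exists>b\<in>tuples MM m. \<exists>b'\<in>tuples MM m. (\<forall>c\<in>C. P (c @ b) \<longleftrightarrow> P (c @ b')) \<and> X b \<and> \<not> X b'"
    if "finite C" "C \<subseteq> tuples MM n" for C
    using not witness[of C] that unfolding X_def by blast
  define ok where "ok x \<longleftrightarrow> (case x of (a, b, b') \<Rightarrow>
    a \<in> tuples MM n \<and> b \<in> tuples MM m \<and> b' \<in> tuples MM m \<and> X b \<and> \<not> X b')" for x
  define good where "good h x \<longleftrightarrow> ok x \<and> (\<forall>y\<in>set h. P (fst y @ fst (snd x)) \<longleftrightarrow> P (fst y @ snd (snd x)))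
    \<and> (\<forall>y\<in>insert x (set h). P (fst x @ fst (snd y)) \<and> \<not> P (fst x @ snd (snd y)))" for h x
  have "\<exists>x. (\<forall>y\<in>set h. ok y) \<longrightarrow> good h x" for h
  proof (cases "\<forall>y\<in>set h. ok y")
    case True
    then have "fst ` set h \<subseteq> tuples MM n" by (auto simp: ok_def)
    then obtain b b' where b: "b \<in> tuples MM m" "b' \<in> tuples MM m"
      "\<forall>c\<in>fst ` set h. P (c @ b) \<longleftrightarrow> P (c @ b')" "X b" "\<not> X b'"
      using split[of "fst ` set h"] by auto
    define V where "V = insert b (fst ` snd ` set h)"
    define V' where "V' = insert b' (snd ` snd ` set h)"
    have V: "v \<in> tuples UU m \<and> X v" if "v \<in> V" for v
      using that b True tuples_mono[OF _ MM_sub] by (fastforce simp: V_def ok_def)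
    have V': "v \<in> tuples UU m \<and> \<not> X v" if "v \<in> V'" for v
      using that b True tuples_mono[OF _ MM_sub] by (fastforce simp: V'_def ok_def)
    have fin: "finite V" "finite V'" by (simp_all add: V_def V'_def)
    have "inp (\<lambda>a. \<not> P (a @ v))" if "v \<in> V'" for v
      using V'[OF that] in_type_not[OF df_instance[OF P]] by (simp add: X_def)
    then have "inp (\<lambda>a. (\<forall>v\<in>V. P (a @ v)) \<and> (\<forall>v\<in>V'. \<not> P (a @ v)))"
      using V fin by (simp add: in_type_conj in_type_ball X_def)
    moreover have "df UU n (\<lambda>a. (\<forall>v\<in>V. P (a @ v)) \<and> (\<forall>v\<in>V'. \<not> P (a @ v)))"
      using V V' fin by (intro dfn_conj dfn_ball dfn_not df_instance[OF P]) auto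
    ultimately obtain a where a: "a \<in> tuples MM n" "\<forall>v\<in>V. P (a @ v)" "\<forall>v\<in>V'. \<not> P (a @ v)"
      using finitely_satisfiableD[OF fs] by blast
    have "good h (a, b, b')"
      using a b by (auto simp: good_def ok_def V_def V'_def)
    then show ?thesis by blast
  qed blast
  then obtain f where f: "\<And>k. (\<forall>y\<in>set (map f [0..<k]). ok y) \<longrightarrow> good (map f [0..<k]) (f k)"
    by (rule history_choice) (rule that)
  have good: "good (map f [0..<k]) (f k)" for k
  proof (induction k rule: less_induct)
    case (less k)
    then have "\<forall>y\<in>set (map f [0..<k]). ok y" by (auto simp: good_def)
    then show ?case using f[of k] by blast
  qed
  define a where "a k = fst (f k)" for k
  define b where "b k = fst (snd (f k))" for k
  define b' where "b' k = snd (snd (f k))" for k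
  have mem: "a k \<in> tuples MM n" "b k \<in> tuples MM m" "b' k \<in> tuples MM m" for k
    using good[of k] by (auto simp: good_def ok_def a_def b_def b'_def)
  have lower: "P (a i @ b j) \<and> \<not> P (a i @ b' j)" if "j \<le> i" for i j
    using good[of i] that by (cases "j = i") (auto simp: good_def a_def b_def b'_def)
  have upper: "P (a i @ b j) \<longleftrightarrow> P (a i @ b' j)" if "i < j" for i j
    using good[of j] that by (auto simp: good_def a_def b_def b'_def)
  obtain g :: "nat \<Rightarrow> nat" and v where g: "strict_mono g"
    "\<And>i j. i < j \<Longrightarrow> P (a (g i) @ b (g j)) \<longleftrightarrow> v"
    by (rule infinite_increasing_homogeneous[of "\<lambda>i j. P (a i @ b j)"]) (rule that)
  have le: "g i \<le> g j \<longleftrightarrow> i \<le> j" "g i < g j \<longleftrightarrow> i < j" for i j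
    using g(1) by (simp_all add: strict_mono_less_eq strict_mono_less)
  show False
  proof (cases v)
    case True
    \<comment> \<open>Truth holds exactly when the first index is smaller than the second; the
      successor turns \<open><\<close> into the \<open>\<le>\<close> of the order property.\<close>
    have "P (a (g i) @ b' (g (Suc j))) \<longleftrightarrow> i \<le> j" for i j
      using g(2)[of i "Suc j"] upper[of "g i" "g (Suc j)"] lower[of "g (Suc j)" "g i"] True le
      by (cases "i < Suc j") auto
    then show False
      using no_order_df[OF no P, of "\<lambda>i. a (g i)" "\<lambda>j. b' (g (Suc j))"] mem by simp
  next
    case False
    have "\<not> P (a (g i) @ b (g (Suc j))) \<longleftrightarrow> i \<le> j" for i j
      using g(2)[of i "Suc j"] lower[of "g (Suc j)" "g i"] False le
      by (cases "i < Suc j") auto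
    then show False
      using no_order_df[OF no dfn_not[OF P], of "\<lambda>i. a (g i)" "\<lambda>j. b (g (Suc j))"] mem by simp
  qed
qed

text \<open>Agreement on \<open>M\<close> does not by itself give agreement at \<open>b\<close>. If
  \<open>D b\<close> holds but the instance at \<open>b\<close> is not in the type, tuples
  \<open>a i\<close> and \<open>c j\<close> are chosen alternately in \<open>M\<close>:
  \<open>a i\<close> makes \<open>P\<close> false at \<open>b\<close> and true at all earlier
  \<open>c j\<close>, while \<open>c j\<close> imitates \<open>b\<close> on \<open>D\<close> and all
  \<open>a i\<close> so far. Then \<open>P\<close> fails exactly for
  \<open>i \<le> j\<close>.\<close>

lemma definition_transfers:
  assumes fs: "finitely_satisfiable" and no: "no_order L M" and P: "df {} (n + m) P"
    and D: "df MM m D" and imp: "\<And>y. y \<in> tuples MM m \<Longrightarrow> D y \<Longrightarrow> inp (\<lambda>a. P (a @ y))"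
    and b: "b \<in> tuples UU m" "D b"
  shows "inp (\<lambda>a. P (a @ b))"
proof (rule ccontr)
  assume "\<not> inp (\<lambda>a. P (a @ b))"
  then have nb: "inp (\<lambda>a. \<not> P (a @ b))" using in_type_not[OF df_instance[OF P b(1)]] by simp
  define ok where "ok x \<longleftrightarrow> fst x \<in> tuples MM n \<and> snd x \<in> tuples MM m \<and> \<not> P (fst x @ b) \<and> D (snd x)"
    for x
  define good where "good h x \<longleftrightarrow> ok x \<and> (\<forall>y\<in>set h. P (fst x @ snd y)) \<and>
    (\<forall>y\<in>insert x (set h). \<not> P (fst y @ snd x))" for h x
  have "\<exists>x. (\<forall>y\<in>set h. ok y) \<longrightarrow> good h x" for h
  proof (cases "\<forall>y\<in>set h. ok y")
    case True
    have V: "v \<in> tuples UU m \<and> inp (\<lambda>a. P (a @ v))" if "v \<in> snd ` set h" for v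
      using that True imp tuples_mono[OF _ MM_sub] by (auto simp: ok_def)
    then have "inp (\<lambda>a. \<not> P (a @ b) \<and> (\<forall>v\<in>snd ` set h. P (a @ v)))"
      using nb by (simp add: in_type_conj in_type_ball)
    moreover have "df UU n (\<lambda>a. \<not> P (a @ b) \<and> (\<forall>v\<in>snd ` set h. P (a @ v)))"
      using V b(1) by (intro dfn_conj dfn_ball dfn_not df_instance[OF P]) auto
    ultimately obtain a where a: "a \<in> tuples MM n" "\<not> P (a @ b)" "\<forall>v\<in>snd ` set h. P (a @ v)"
      using finitely_satisfiableD[OF fs] by blast
    have W: "w \<in> tuples MM n \<and> \<not> P (w @ b)" if "w \<in> insert a (fst ` set h)" for w
      using that True a by (auto simp: ok_def)
    have dW: "df MM m (\<lambda>y. D y \<and> (\<forall>w\<in>insert a (fst ` set h). \<not> P (w @ y)))"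
      using W by (intro dfn_conj D dfn_ball dfn_not dfn_plug_left[OF P _ empty_subsetI MM_sub] MM_sub) auto
    have Wb: "D b \<and> (\<forall>w\<in>insert a (fst ` set h). \<not> P (w @ b))"
      using W b(2) by blast
    obtain c where c: "c \<in> tuples MM m" "D c \<and> (\<forall>w\<in>insert a (fst ` set h). \<not> P (w @ c))"
      using tarski_vaught[OF dW b(1) Wb] by blast
    have "good h (a, c)" using a c by (auto simp: good_def ok_def)
    then show ?thesis by blast
  qed blast
  then obtain f where f: "\<And>k. (\<forall>y\<in>set (map f [0..<k]). ok y) \<longrightarrow> good (map f [0..<k]) (f k)"
    by (rule history_choice) (rule that)
  have good: "good (map f [0..<k]) (f k)" for k
  proof (induction k rule: less_induct)
    case (less k)
    then have "\<forall>y\<in>set (map f [0..<k]). ok y" by (auto simp: good_def)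
    then show ?case using f[of k] by blast
  qed
  have "fst (f k) \<in> tuples MM n" "snd (f k) \<in> tuples MM m" for k
    using good[of k] by (auto simp: good_def ok_def)
  moreover have "\<not> P (fst (f i) @ snd (f j)) \<longleftrightarrow> i \<le> j" for i j
    using good[of i] good[of j] by (cases "i = j"; cases "i < j") (auto simp: good_def)
  ultimately show False
    using no_order_df[OF no dfn_not[OF P], of "\<lambda>i. fst (f i)" "\<lambda>j. snd (f j)"] by simp
qed

text \<open>On \<open>M\<close> the type is decided by the trace of a parameter on a finite set
  \<open>C\<close>, so it is defined by the disjunction of the traces that occur. Transfer for
  \<open>P\<close> and for its negation extends this definition to \<open>U\<close>.\<close>

lemma coheir_definable:
  assumes fs: "finitely_satisfiable" and no: "no_order L M"
  shows "definable"
proof -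
  have main: "df MM m (\<lambda>y. inp (\<lambda>a. P (a @ y)))" if P: "df {} (n + m) P" for m P
  proof -
    obtain C where C: "finite C" "C \<subseteq> tuples MM n"
      "\<And>b b'. b \<in> tuples MM m \<Longrightarrow> b' \<in> tuples MM m \<Longrightarrow> (\<And>c. c \<in> C \<Longrightarrow> P (c @ b) \<longleftrightarrow> P (c @ b')) \<Longrightarrow>
        inp (\<lambda>a. P (a @ b)) \<Longrightarrow> inp (\<lambda>a. P (a @ b'))"
    proof (rule type_decided_by_instances[OF fs no P])
      fix C assume 1: "finite C" "C \<subseteq> tuples MM n"
        and 2: "\<And>b b'. b \<in> tuples MM m \<Longrightarrow> b' \<in> tuples MM m \<Longrightarrow>
          (\<And>c. c \<in> C \<Longrightarrow> P (c @ b) \<longleftrightarrow> P (c @ b')) \<Longrightarrow> inp (\<lambda>a. P (a @ b)) \<Longrightarrow> inp (\<lambda>a. P (a @ b'))"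
      show thesis by (rule that, fact 1, fact 1, fact 2)
    qed
    define \<S> where "\<S> = {{c\<in>C. P (c @ b)} | b. b \<in> tuples MM m \<and> inp (\<lambda>a. P (a @ b))}"
    define D where "D y \<longleftrightarrow> (\<exists>S\<in>\<S>. \<forall>c\<in>C. P (c @ y) \<longleftrightarrow> c \<in> S)" for y
    have "finite \<S>"
      by (rule finite_subset[of _ "Pow C"]) (use C(1) in \<open>auto simp: \<S>_def\<close>)
    then have D: "df MM m D"
      unfolding D_def using C(1,2)
      by (intro dfn_bex dfn_ball dfn_iff_const MM_sub dfn_plug_left[OF P _ empty_subsetI MM_sub]) auto
    have DM: "D y \<longleftrightarrow> inp (\<lambda>a. P (a @ y))" if y: "y \<in> tuples MM m" for y
    proof
      assume "D y"
      then obtain b where "b \<in> tuples MM m" "inp (\<lambda>a. P (a @ b))" "\<forall>c\<in>C. P (c @ y) \<longleftrightarrow> P (c @ b)"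
        by (auto simp: D_def \<S>_def)
      then show "inp (\<lambda>a. P (a @ y))" using C(3)[of b y] y by blast
    next
      assume "inp (\<lambda>a. P (a @ y))"
      then show "D y"
        unfolding D_def \<S>_def using y by (intro bexI[of _ "{c\<in>C. P (c @ y)}"]) auto
    qed
    show ?thesis
    proof (rule dfn_cong_imp[OF D])
      fix b assume b: "b \<in> tuples UU m"
      have "inp (\<lambda>a. \<not> P (a @ b))" if "\<not> D b"
      proof (rule definition_transfers[OF fs no dfn_not[OF P] dfn_not[OF D] _ b that])
        fix y assume "y \<in> tuples MM m" "\<not> D y"
        then show "inp (\<lambda>a. \<not> P (a @ y))"
          using DM in_type_not[OF df_instance[OF P]] tuples_mono[OF _ MM_sub] by blast
      qed
      moreover have "inp (\<lambda>a. P (a @ b))" if "D b"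
        by (rule definition_transfers[OF fs no P D _ b that]) (simp add: DM)
      ultimately show "D b \<longleftrightarrow> inp (\<lambda>a. P (a @ b))"
        using in_type_not[OF df_instance[OF P b]] by blast
    qed
  qed
  show ?thesis
    unfolding definable_def
  proof (intro allI impI)
    fix m P assume "df MM (m + n) P"
    then have "df MM (n + m) (\<lambda>z. P (drop n z @ take n z))" by (rule dfn_swap)
    then obtain l c Q where c: "c \<in> tuples MM l" and Q: "df {} (n + m + l) Q"
      "\<And>z. z \<in> tuples UU (n + m) \<Longrightarrow> P (drop n z @ take n z) \<longleftrightarrow> Q (z @ c)"
      by (rule dfn_params) (rule that)
    have "df MM (m + l) (\<lambda>y. inp (\<lambda>a. Q (a @ y)))"
      using Q(1) by (intro main) (simp add: add.assoc)
    then have "df MM m (\<lambda>b. inp (\<lambda>a. Q (a @ (b @ c))))"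
      by (rule dfn_plug_right[OF _ c order_refl MM_sub])
    then show "df MM m (\<lambda>b. inp (\<lambda>a. P (b @ a)))"
    proof (rule dfn_cong_imp)
      fix b assume b: "b \<in> tuples UU m"
      show "inp (\<lambda>a. Q (a @ (b @ c))) \<longleftrightarrow> inp (\<lambda>a. P (b @ a))"
      proof (rule in_type_cong)
        fix a assume a: "a \<in> tuples UU n"
        show "Q (a @ (b @ c)) \<longleftrightarrow> P (b @ a)"
          using Q(2)[OF append_tuples[OF a b]] a by (simp add: tuples_def)
      qed
    qed
  qed
qed

lemma definable_invariant_type:
  assumes "definable"
  shows "invariant_type L U MM n p"
  unfolding invariant_type_def
proof (intro allI impI ballI)
  fix \<sigma> \<phi> assume \<sigma>: "automorphism L U \<sigma> \<and> (\<forall>a\<in>MM. \<sigma> a = a)" and \<phi>: "\<phi> \<in> Form L UU n"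
  obtain b m and \<psi> :: "('f, 'r, 'u) fm" where b: "b \<in> tuples UU m" and \<psi>: "\<psi> \<in> Form L {} (m + n)"
    and *: "\<And>S (\<sigma> :: 'u \<Rightarrow> 'u) a. length a = n \<Longrightarrow> holds S (fm_map \<sigma> \<phi>) a \<longleftrightarrow> holds S \<psi> (map \<sigma> b @ a)"
    by (rule Form_params[OF \<phi>]) (rule that)
  have inp_map: "fm_map \<rho> \<phi> \<in> p \<longleftrightarrow> inp (\<lambda>a. holds U \<psi> (map \<rho> b @ a))" if "\<rho> ` UU \<subseteq> UU" for \<rho>
  proof -
    have "fm_map \<rho> \<phi> \<in> Form L UU n" using \<phi> that by (auto simp: Form_def)
    from in_type_holds[OF this order_refl] show ?thesis
      using in_type_cong[of U n "holds U (fm_map \<rho> \<phi>)" "\<lambda>a. holds U \<psi> (map \<rho> b @ a)" p] *[of _ U \<rho>]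
      by (simp add: tuples_def)
  qed
  have "df MM (m + n) (holds U \<psi>)"
    using dfn_holds[OF Form_mono[OF \<psi>] MM_sub] by blast
  then have "df MM m (\<lambda>y. inp (\<lambda>a. holds U \<psi> (y @ a)))"
    using assms unfolding definable_def by blast
  from df_automorphism[OF conjunct1[OF \<sigma>] conjunct2[OF \<sigma>] this b]
  show "\<phi> \<in> p \<longleftrightarrow> fm_map \<sigma> \<phi> \<in> p"
    using inp_map[of \<sigma>] inp_map[of id] \<sigma>
    by (simp add: fm.map_id automorphism_def bij_betw_def)
qed

text \<open>If a formula of \<open>p\<close> fails infinitely often along a Morley sequence, then by interleaving failures
  with generic realizations every truth pattern occurs on Morley sequences, hence also on a
  sequence in \<open>M\<close>.\<close>

lemma eventually_NIP_convergent:
  assumes df: "definable" and fs: "finitely_satisfiable" and nip: "eventually_NIP L U M"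
    and a: "mseq MM a" and P: "df UU n P" "inp P"
  shows "\<exists>i\<^sub>0. \<forall>i\<ge>i\<^sub>0. P (a i)"
proof (rule ccontr)
  assume "\<not> ?thesis"
  then have "\<forall>k. \<exists>i\<ge>k. \<not> P (a i)" by blast
  then have inf: "infinite {i. \<not> P (a i)}" by (auto simp: infinite_nat_iff_unbounded_le)
  obtain m b Q where b: "b \<in> tuples UU m" and Q: "df {} (n + m) Q"
    "\<And>x. x \<in> tuples UU n \<Longrightarrow> P x \<longleftrightarrow> Q (x @ b)"
    by (rule dfn_params[OF P(1)]) (rule that)
  obtain \<phi> where \<phi>: "\<phi> \<in> Form L {} (n + m)" "\<And>a. a \<in> tuples UU (n + m) \<Longrightarrow> Q a \<longleftrightarrow> holds U \<phi> a"
    using Q(1) by (auto simp: dfn_def)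
  have QM: "df MM (n + m) Q" using dfn_mono[OF Q(1) empty_subsetI MM_sub] .
  define R where "R x \<longleftrightarrow> Q (x @ b)" for x
  have sb: "small (set b)" using b by (intro small_finite) (auto simp: tuples_def)
  have R: "df (set b) n R"
    unfolding R_def using b small_sub[OF sb]
    by (intro dfn_plug_right[OF Q(1)]) (auto simp: tuples_def)
  have iR: "inp R" using P(2) by (rule in_type_mono) (simp add: R_def Q(2))
  have all_patterns: "iter N (pattern U n m Q N t)" for N t
  proof -
    \<comment> \<open>The subsequence of failures is itself a Morley sequence.\<close>
    define as where "as = map a (map (enumerate {i. \<not> P (a i)}) [0..<N])"
    have as: "mor MM as" "length as = N"
      unfolding as_def
      by (rule mseq_mor[OF a MM_sub, of _ 0])
        (auto simp: sorted_wrt_iff_nth_less enumerate_mono[OF _ inf])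
    have "\<not> R x" if x: "x \<in> set as" for x
    proof -
      obtain i where i: "x = a (enumerate {i. \<not> P (a i)} i)" using x by (auto simp: as_def)
      then have "\<not> P x" using enumerate_in_set[OF inf, of i] by simp
      then show ?thesis using Q(2) mor_tuples[OF as(1) x] by (simp add: R_def)
    qed
    moreover have "length (filter Not (map t [0..<N])) \<le> length as"
      using length_filter_le[of Not "map t [0..<N]"] as(2) by simp
    ultimately obtain ds where ds: "mor MM ds" "list_all2 (\<lambda>d v. R d \<longleftrightarrow> v) ds (map t [0..<N])"
      using mor_interleave[OF df fs sb R iR order_refl small_MM as(1)] by blast
    have l: "length ds = N" using list_all2_lengthD[OF ds(2)] by simp
    have "\<forall>j<N. Q (ds ! j @ b) \<longleftrightarrow> t j"
      using list_all2_nthD[OF ds(2)] l by (simp add: R_def)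
    then have "pattern U n m Q N t (concat ds)"
      using pattern_concat[OF mor_length[OF ds(1)] l, of U m Q t] b by blast
    then show ?thesis
      using iter_mor[OF df order_refl ds(1), of "pattern U n m Q N t"] dfn_pattern[OF QM] l by simp
  qed
  \<comment> \<open>Which \<open>N\<close> and \<open>E\<close> eventual NIP will produce is unknown
    when the sequence is built, so all patterns of each length are demanded.\<close>
  define \<Theta> where "\<Theta> N z \<longleftrightarrow> (\<forall>E\<in>Pow {..<N}. pattern U n m Q N (\<lambda>j. j \<in> E) z)" for N z
  have d\<Theta>: "df MM (N * n) (\<Theta> N)" for N
    unfolding \<Theta>_def by (intro dfn_ball MM_sub dfn_pattern QM) auto
  have i\<Theta>: "iter N (\<Theta> N)" for N
  proof -
    obtain as where as: "mor MM as" "length as = N" using mor_exists[OF small_MM] .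
    have "pattern U n m Q N t (concat as)" for t
      using iter_mor[OF df order_refl as(1), of "pattern U n m Q N t"] all_patterns[of N t]
        dfn_pattern[OF QM] as(2) by simp
    then have "\<Theta> N (concat as)" by (simp add: \<Theta>_def)
    then show ?thesis using iter_mor[OF df order_refl as(1), of "\<Theta> N"] d\<Theta> as(2) by simp
  qed
  obtain c\<^sub>0 where c\<^sub>0: "c\<^sub>0 \<in> tuples MM n" using finitely_satisfiableD[OF fs P] by blast
  \<comment> \<open>All lists serve as indices; those that are not tuples of \<open>M\<close> are
    sent to a default.\<close>
  define g where "g x = (if x \<in> tuples MM n then x else c\<^sub>0)" for x
  have g: "g x \<in> tuples MM n" for x using c\<^sub>0 by (simp add: g_def)
  obtain f :: "nat \<Rightarrow> 'u list" where f: "\<And>js. sorted_wrt (<) js \<Longrightarrow> (\<And>j. j \<in> set js \<Longrightarrow> length js \<le> j) \<Longrightarrow>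
       \<Theta> (length js) (concat (map (\<lambda>j. g (f j)) js))"
  proof (rule reflect_sequence[OF df g d\<Theta> i\<Theta>, of "\<lambda>_ _. True"])
    fix P assume "df MM n P" "inp P"
    then obtain c where "c \<in> tuples MM n" "P c" using finitely_satisfiableD[OF fs dfU] by blast
    then show "\<exists>i. True \<and> P (g i)" by (intro exI[of _ c]) (simp add: g_def)
  next
    fix f :: "nat \<Rightarrow> 'u list"
    assume *: "\<And>js. sorted_wrt (<) js \<Longrightarrow> (\<And>j. j \<in> set js \<Longrightarrow> length js \<le> j) \<Longrightarrow>
      \<Theta> (length js) (concat (map (\<lambda>j. g (f j)) js))"
    show thesis by (rule that) (fact *)
  qed
  define c where "c = (\<lambda>j. g (f j))"
  have cM: "c j \<in> tuples MM n" for j by (simp add: c_def g)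
  have cU: "c j \<in> tuples UU n" for j using cM MM_sub by (rule tuples_mono)
  have "eventually_NIP_formula U M n m \<phi>"
    using nip Form_mono[OF \<phi>(1)] unfolding eventually_NIP_def by blast
  then obtain r :: "nat \<Rightarrow> nat" and N E where r: "strict_mono r" and E: "E \<subseteq> {1..N}"
    and none: "\<And>s :: nat \<Rightarrow> nat. strict_mono_on {1..N} s \<Longrightarrow> \<not> (\<exists>y\<in>tuples UU m.
      (\<forall>j\<in>E. holds U \<phi> (c (r (s j)) @ y)) \<and> (\<forall>j\<in>{1..N} - E. \<not> holds U \<phi> (c (r (s j)) @ y)))"
    unfolding eventually_NIP_formula_def using cM by metis
  \<comment> \<open>As \<open>r i \<ge> i\<close>, the shift by \<open>N\<close> pushes all indices
    used beyond the bound required by reflection.\<close>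
  define s where "s j = j + N" for j :: nat
  define js where "js = map (\<lambda>j. r (s (Suc j))) [0..<N]"
  have lj: "length js = N" by (simp add: js_def)
  have "sorted_wrt (<) js"
    using r by (auto simp: js_def s_def sorted_wrt_iff_nth_less strict_mono_def)
  moreover have "length js \<le> j" if j: "j \<in> set js" for j
  proof -
    obtain i where "j = r (s (Suc i))" using j by (auto simp: js_def)
    then show ?thesis using strict_mono_imp_increasing[OF r, of "s (Suc i)"] lj by (simp add: s_def)
  qed
  ultimately have "\<Theta> N (concat (map c js))" using f[of js] lj by (simp add: c_def)
  \<comment> \<open>The set \<open>E\<close> lies in \<open>{1..N}\<close>, whereas blocks are
    numbered from 0.\<close>
  moreover have "{j. j < N \<and> Suc j \<in> E} \<in> Pow {..<N}" by auto
  ultimately have "pattern U n m Q N (\<lambda>j. j \<in> {j. j < N \<and> Suc j \<in> E}) (concat (map c js))"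
    unfolding \<Theta>_def by blast
  moreover have "length x = n" if "x \<in> set (map c js)" for x
    using that cU by (auto simp: tuples_def)
  ultimately obtain y where y: "y \<in> tuples UU m"
    "\<And>j. j < N \<Longrightarrow> Q (map c js ! j @ y) \<longleftrightarrow> Suc j \<in> E"
    using pattern_concat[of "map c js" n N U m Q "\<lambda>j. j \<in> {j. j < N \<and> Suc j \<in> E}"] lj by auto
  have "holds U \<phi> (c (r (s j)) @ y) \<longleftrightarrow> j \<in> E" if j: "j \<in> {1..N}" for j
  proof -
    obtain i where i: "j = Suc i" "i < N" using j by (cases j) auto
    have "map c js ! i = c (r (s j))" using i by (simp add: js_def)
    then show ?thesis using y(2)[OF i(2)] \<phi>(2)[OF append_tuples[OF cU y(1)]] i(1) by simp
  qed
  then have "(\<forall>j\<in>E. holds U \<phi> (c (r (s j)) @ y)) \<and> (\<forall>j\<in>{1..N} - E. \<not> holds U \<phi> (c (r (s j)) @ y))"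
    using E by blast
  then show False using none[of s] y(1) by (auto simp: s_def strict_mono_on_def)
qed

text \<open>Convergence for formulas in \<open>p\<close> suffices: a formula outside
  \<open>p\<close> has its negation in \<open>p\<close>, so it cannot hold for all large
  indices.\<close>

lemma coheir_generically_stable:
  assumes fs: "finitely_satisfiable" and es: "eventually_stable L U M"
  shows "generically_stable L U MM n p"
proof -
  have df: "definable" using coheir_definable[OF fs] es by (simp add: eventually_stable_def)
  have conv: "\<exists>i\<^sub>0. \<forall>i\<ge>i\<^sub>0. P (a i)" if "mseq MM a" "df UU n P" "inp P" for a P
    using eventually_NIP_convergent[OF df fs _ that] es by (simp add: eventually_stable_def)
  have "lim_type L U n a p" if a: "mseq MM a" for a
    unfolding lim_type_def
  proof
    fix \<phi> assume \<phi>: "\<phi> \<in> Form L UU n"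
    note d = dfn_holds[OF \<phi> order_refl]
    show "\<phi> \<in> p \<longleftrightarrow> (\<exists>i\<^sub>0. \<forall>i\<ge>i\<^sub>0. holds U \<phi> (a i))"
    proof
      assume "\<phi> \<in> p"
      then show "\<exists>i\<^sub>0. \<forall>i\<ge>i\<^sub>0. holds U \<phi> (a i)"
        using conv[OF a d] in_type_holds[OF \<phi> order_refl] by simp
    next
      assume ev: "\<exists>i\<^sub>0. \<forall>i\<ge>i\<^sub>0. holds U \<phi> (a i)"
      show "\<phi> \<in> p"
      proof (rule ccontr)
        assume "\<phi> \<notin> p"
        then have "inp (\<lambda>x. \<not> holds U \<phi> x)"
          using in_type_not[OF d] in_type_holds[OF \<phi> order_refl] by simp
        from conv[OF a dfn_not[OF d] this] ev show False by (meson linear order_trans order_refl)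
      qed
    qed
  qed
  then show ?thesis
    using definable_invariant_type[OF df] Morley_sequence_mseq[OF MM_sub]
    by (simp add: generically_stable_def)
qed

end

theorem theorem4p10:
  fixes L :: "('f, 'r) language"
    and T :: "('f, 'r, 'u) fm set"
    and U M :: "('f, 'r, 'u) struct"
    and \<kappa> :: "'k rel"
  assumes "complete_theory L T"
    and "monster L T \<kappa> U"
    and "is_model L M T"
    and "elementary_sub L M U"
    and "card_of (carr M) <o \<kappa>"
  shows "eventually_stable L U M \<longleftrightarrow>
    (\<forall>n. \<forall>p\<in>ctypes L U (carr M) n.
       \<exists>p'\<in>ctypes L U (carr U) n. p \<subseteq> p' \<and> generically_stable L U (carr M) n p')"
proof -
  interpret small_submodel L T U M \<kappa> by unfold_locales fact+
  show ?thesis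
  proof
    assume es: "eventually_stable L U M"
    show "\<forall>n. \<forall>p\<in>ctypes L U MM n. \<exists>p'\<in>ctypes L U UU n. p \<subseteq> p' \<and> generically_stable L U MM n p'"
    proof (intro allI ballI)
      fix n p assume "p \<in> ctypes L U MM n"
      then obtain p' where p': "global_type L T U M \<kappa> n p'" "p \<subseteq> p'"
        "global_type.finitely_satisfiable L U M n p'"
        by (rule coheir_exists) (rule that)
      interpret p': global_type L T U M \<kappa> n p' by (rule p')
      show "\<exists>p'\<in>ctypes L U UU n. p \<subseteq> p' \<and> generically_stable L U MM n p'"
        using p'.global p'(2) p'.coheir_generically_stable[OF p'(3) es] by blast
    qed
  next
    assume "\<forall>n. \<forall>p\<in>ctypes L U MM n. \<exists>p'\<in>ctypes L U UU n. p \<subseteq> p' \<and> generically_stable L U MM n p'"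
    then show "eventually_stable L U M"
      using stable_no_order stable_eventually_NIP by (simp add: eventually_stable_def)
  qed
qed

end
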